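(* Let $l\in\{+1,-1\}^m$ and let $\Gamma=\Gamma_l\subset D_l$ be a $K_B$-bounded contour such that $$\mathcal V_0(B,\Gamma)<\tfrac14 d_0^2(\Gamma),\qquad d_0(\Gamma)=\operatorname{dist}\{\sigma(A_1),\sigma'(A_0)\cup\Gamma\}.$$ Put $$r_{\min}(\Gamma)=\frac{d_0(\Gamma)}2-\sqrt{\frac{d_0^2(\Gamma)}4-\mathcal V_0(B,\Gamma)},\qquad r_{\max}(\Gamma)=d_0(\Gamma)-\sqrt{\mathcal V_0(B,\Gamma)}.$$ Then for every $r$ with $r_{\min}(\Gamma)\le r<r_{\max}(\Gamma)$ the equation $$X=V_1(A_1+X,\Gamma),\qquad V_1(Y,\Gamma)=\int_{\sigma'(A_0)\cup\Gamma}K_B(d\mu)\,(Y-\mu)^{-1},$$ has exactly one solution $X$ in the ball $\mathcal S_1(r)=\{X\in\mathbf B(\mathcal H_1,\mathcal H_1):\|X\|\le r\}$. The solution $X$ is the same for all such $r$, and it belongs to the smallest ball: $\|X\|\le r_{\min}(\Gamma)$.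
   Context: Setting. $\mathcal H_0,\mathcal H_1$ are separable Hilbert spaces; $A_0$, $A_1$ are (possibly unbounded) self-adjoint operators in $\mathcal H_0$, $\mathcal H_1$; $B_{01}:\mathcal H_1\to\mathcal H_0$ is bounded and $B_{10}=B_{01}^*$. $\mathbf B(\mathcal H_1,\mathcal H_1)$ denotes the bounded operators on $\mathcal H_1$. $E_0$ is the spectral measure of $A_0$, $E^0(\mu)=E_0((-\infty,\mu))$, and $K_B(\mu)=B_{10}E^0(\mu)B_{01}$. Spectral assumptions. There are finitely many pairwise disjoint open intervals $\Delta_k^0=(\mu_k^{(1)},\mu_k^{(2)})$, $k=1,\dots,m$ ($1\le m<\infty$, $-\infty\le\mu_1^{(1)}$, $\mu_m^{(2)}\le+\infty$), contained in the continuous spectrum $\sigma_c(A_0)$ (no eigenvalues of $A_0$ lie in them), with $\Delta_k^0\cap\sigma(A_1)\ne\emptyset$ for all $k$ and $\sigma(A_1)\cap\sigma'(A_0)=\emptyset$, where $\sigma'(A_0)=\sigma(A_0)\setminus\bigcup_{k=1}^m\Delta_k^0$. Analyticity assumptions. On each $\Delta_k^0$ the function $K_B(\mu)$ is differentiable in operator norm; $K_B'$ is continuous on $\overline{\Delta_k^0}$ and has an analytic continuation from $\Delta_k^0$ to a simply connected domain $D_k^-\subset\mathbb C^-$ whose boundary contains $\Delta_k^0$ (the $D_k^-$ are mutually disjoint for different $k$), hence also to $D_k^+=\{z:\bar z\in D_k^-\}$; the continuations are still denoted $K_B'$. At finite end points $\mu_k^{(i)}$, $\|K'_B(\mu)-K'_B(\mu_k^{(i)})\|\le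 C|\mu-\mu_k^{(i)}|^\gamma$ for $\mu\in D_k^\pm$, with some $C,\gamma>0$. Contours. For $l=(l_1,\dots,l_m)$, $l_k=\pm1$, put $D_l=\bigcup_kD_k^{l_k}$, where $D_k^{\pm1}=D_k^\pm$. A contour $\Gamma_l=\bigcup_k\Gamma_k^{l_k}$ consists of rectifiable Jordan curves $\Gamma_k^{l_k}$ in $D_k^{l_k}$ obtained by continuous deformation of $\Delta_k^0$ with the (finite) end points kept fixed, whose closures have no points in common with $\sigma_c(A_0)$ other than end points. The modified variation is $$\mathcal V_0(B,\Gamma_l)=\sup_{\{\delta_k\}}\sum_k\|B_{10}E_0(\delta_k\cap\sigma'(A_0))B_{01}\|+\int_{\Gamma_l}|d\mu|\,\|K_B'(\mu)\|,$$ the supremum over finite or countable partitions of $\sigma(A_0)$ into disjoint Borel sets. $\Gamma_l$ is $K_B$-bounded if $\mathcal V_0(B,\Gamma_l)<\infty$. Integrals. $\int_{\sigma'(A_0)\cup\Gamma}K_B(d\mu)T(\mu):=\int_{\sigma'(A_0)}B_{10}E_0(d\mu)B_{01}T(\mu)+\int_\Gamma d\mu\,K_B'(\mu)T(\mu)$ (operator norm sense). *)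

theory Defs
  imports "HOL-Analysis.Analysis"
begin

section \<open>Complex Hilbert spaces and bounded operators\<close>

class complex_hilbert_space = banach +
  fixes scaleC :: "complex \<Rightarrow> 'a \<Rightarrow> 'a"
    and cinner :: "'a \<Rightarrow> 'a \<Rightarrow> complex"
  assumes scaleC_add_right: "scaleC c (x + y) = scaleC c x + scaleC c y"
    and scaleC_add_left: "scaleC (c + d) x = scaleC c x + scaleC d x"
    and scaleC_scaleC: "scaleC c (scaleC d x) = scaleC (c * d) x"
    and scaleR_eq_scaleC: "r *\<^sub>R x = scaleC (complex_of_real r) x"
    and cinner_commute: "cinner x y = cnj (cinner y x)"
    and cinner_add_right: "cinner x (y + z) = cinner x y + cinner x z"
    and cinner_scaleC_right: "cinner x (scaleC c y) = c * cinner x y"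
    and cinner_self: "cinner x x = complex_of_real ((norm x)\<^sup>2)"

instantiation complex :: complex_hilbert_space
begin

definition scaleC_complex :: "complex \<Rightarrow> complex \<Rightarrow> complex"
  where "scaleC_complex c x = c * x"

definition cinner_complex :: "complex \<Rightarrow> complex \<Rightarrow> complex"
  where "cinner_complex x y = cnj x * y"

instance
proof
  show "cinner x x = complex_of_real ((norm x)\<^sup>2)" for x :: complex
    unfolding cinner_complex_def by (metis complex_norm_square mult.commute)
qed (auto simp: scaleC_complex_def cinner_complex_def algebra_simps scaleR_conv_of_real)

end

lemma norm_scaleC:
  fixes x :: "'a::complex_hilbert_space"
  shows "norm (scaleC c x) = cmod c * norm x"
proof -
  have "cinner (scaleC c x) (scaleC c x) = c * cnj (cinner x (scaleC c x))"
    by (metis cinner_commute cinner_scaleC_right)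
  also have "\<dots> = c * cnj c * cnj (cinner x x)"
    by (simp add: cinner_scaleC_right)
  also have "\<dots> = complex_of_real ((cmod c)\<^sup>2 * (norm x)\<^sup>2)"
    by (simp add: cinner_self complex_norm_square [symmetric])
  finally have "(norm (scaleC c x))\<^sup>2 = (cmod c * norm x)\<^sup>2"
    by (metis cinner_self of_real_eq_iff power_mult_distrib)
  then show ?thesis
    by (simp add: power2_eq_iff_nonneg)
qed

text \<open>The type \<open>'a \<Rightarrow>\<^sub>L 'b\<close> consists of the bounded real-linear operators; \<open>bounded_ops\<close> is
  the space of bounded complex-linear ones.\<close>

definition bounded_ops :: "('a::complex_hilbert_space \<Rightarrow>\<^sub>L 'b::complex_hilbert_space) set"
  where "bounded_ops = {T. \<forall>c x. blinfun_apply T (scaleC c x) = scaleC c (blinfun_apply T x)}"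

definition op_scale ::
    "complex \<Rightarrow> ('a::complex_hilbert_space \<Rightarrow>\<^sub>L 'b::complex_hilbert_space) \<Rightarrow> ('a \<Rightarrow>\<^sub>L 'b)"
  where "op_scale c T = Blinfun (\<lambda>x. scaleC c (blinfun_apply T x))"

lemma blinfun_apply_op_scale:
  "blinfun_apply (op_scale c T) x = scaleC c (blinfun_apply T x)"
proof -
  have "bounded_linear (\<lambda>x. scaleC c (blinfun_apply T x))"
  proof (rule bounded_linear_intro)
    show "norm (scaleC c (blinfun_apply T x)) \<le> norm x * (cmod c * norm T)" for x
      using mult_left_mono [OF norm_blinfun [of T x], of "cmod c"]
      by (simp add: norm_scaleC mult_ac)
    show "scaleC c (blinfun_apply T (r *\<^sub>R x)) = r *\<^sub>R scaleC c (blinfun_apply T x)" for r x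
      unfolding blinfun.scaleR_right
      by (simp add: scaleR_eq_scaleC scaleC_scaleC mult.commute)
  qed (simp add: blinfun.add_right scaleC_add_right)
  then show ?thesis
    unfolding op_scale_def by (simp add: bounded_linear_Blinfun_apply)
qed

definition is_adjoint ::
    "('a::complex_hilbert_space \<Rightarrow>\<^sub>L 'b::complex_hilbert_space) \<Rightarrow> ('b \<Rightarrow>\<^sub>L 'a) \<Rightarrow> bool"
  where "is_adjoint B C \<longleftrightarrow>
    (\<forall>x y. cinner (blinfun_apply B x) y = cinner x (blinfun_apply C y))"

definition op_holomorphic_on ::
    "(complex \<Rightarrow> ('a::complex_hilbert_space \<Rightarrow>\<^sub>L 'b::complex_hilbert_space)) \<Rightarrow> complex set \<Rightarrow> bool"
  where "op_holomorphic_on F U \<longleftrightarrow>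
    (\<forall>z\<in>U. \<exists>L. ((\<lambda>w. op_scale (inverse (w - z)) (F w - F z)) \<longlongrightarrow> L) (at z within U))"


section \<open>Unbounded operators\<close>

text \<open>A possibly unbounded operator is represented by its graph, so that its domain is
  \<open>Domain A\<close>.\<close>

definition linear_graph :: "('a::complex_hilbert_space \<times> 'a) set \<Rightarrow> bool"
  where "linear_graph A \<longleftrightarrow> single_valued A \<and> (0, 0) \<in> A \<and>
    (\<forall>x y u v. (x, u) \<in> A \<longrightarrow> (y, v) \<in> A \<longrightarrow> (x + y, u + v) \<in> A) \<and>
    (\<forall>c x u. (x, u) \<in> A \<longrightarrow> (scaleC c x, scaleC c u) \<in> A)"

definition graph_adjoint :: "('a::complex_hilbert_space \<times> 'a) set \<Rightarrow> ('a \<times> 'a) set"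
  where "graph_adjoint A = {(y, v). \<forall>(x, u)\<in>A. cinner u y = cinner x v}"

definition self_adjoint :: "('a::complex_hilbert_space \<times> 'a) set \<Rightarrow> bool"
  where "self_adjoint A \<longleftrightarrow>
    linear_graph A \<and> closure (Domain A) = UNIV \<and> graph_adjoint A = A"

definition graph_plus ::
    "('a::complex_hilbert_space \<times> 'a) set \<Rightarrow> ('a \<Rightarrow>\<^sub>L 'a) \<Rightarrow> ('a \<times> 'a) set"
  where "graph_plus A X = {(x, u + blinfun_apply X x) | x u. (x, u) \<in> A}"

text \<open>\<open>is_resolvent A z R\<close> says \<open>R = (A - z)\<^sup>-\<^sup>1\<close>, a bounded everywhere defined operator.\<close>

definition is_resolvent ::
    "('a::complex_hilbert_space \<times> 'a) set \<Rightarrow> complex \<Rightarrow> ('a \<Rightarrow>\<^sub>L 'a) \<Rightarrow> bool"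
  where "is_resolvent A z R \<longleftrightarrow> R \<in> bounded_ops \<and>
    {(u - scaleC z x, x) | x u. (x, u) \<in> A} = {(y, blinfun_apply R y) | y. True}"

definition spectrum :: "('a::complex_hilbert_space \<times> 'a) set \<Rightarrow> complex set"
  where "spectrum A = {z. \<nexists>R. is_resolvent A z R}"

definition continuous_spectrum :: "('a::complex_hilbert_space \<times> 'a) set \<Rightarrow> complex set"
  where "continuous_spectrum A = {z \<in> spectrum A.
    (\<forall>x. (x, scaleC z x) \<in> A \<longrightarrow> x = 0) \<and>
    closure {u - scaleC z x | x u. (x, u) \<in> A} = UNIV}"

text \<open>For self-adjoint \<open>A\<close> the spectrum is contained in the real line, so nothing is lost here.\<close>

definition real_spectrum :: "('a::complex_hilbert_space \<times> 'a) set \<Rightarrow> real set"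
  where "real_spectrum A = {x. complex_of_real x \<in> spectrum A}"


section \<open>Spectral measures\<close>

definition projection_valued_measure ::
    "(real set \<Rightarrow> ('a::complex_hilbert_space \<Rightarrow>\<^sub>L 'a)) \<Rightarrow> bool"
  where "projection_valued_measure E \<longleftrightarrow>
    (\<forall>S\<in>sets borel. E S \<in> bounded_ops \<and> E S o\<^sub>L E S = E S \<and> is_adjoint (E S) (E S)) \<and>
    E UNIV = id_blinfun \<and>
    (\<forall>F x. range F \<subseteq> sets borel \<longrightarrow> disjoint_family F \<longrightarrow>
      (\<lambda>n::nat. blinfun_apply (E (F n)) x) sums blinfun_apply (E (\<Union>n. F n)) x)"

definition scalar_spectral_measure ::
    "(real set \<Rightarrow> ('a::complex_hilbert_space \<Rightarrow>\<^sub>L 'a)) \<Rightarrow> 'a \<Rightarrow> real measure"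
  where "scalar_spectral_measure E x =
    measure_of UNIV (sets borel) (\<lambda>S. ennreal ((norm (blinfun_apply (E S) x))\<^sup>2))"

text \<open>\<open>A = \<integral> \<lambda> dE(\<lambda>)\<close>: the domain consists of the \<open>x\<close> with
  \<open>\<integral> \<lambda>\<^sup>2 d\<langle>x, E(\<lambda>) x\<rangle> < \<infinity>\<close>, and \<open>\<langle>x, A x\<rangle> = \<integral> \<lambda> d\<langle>x, E(\<lambda>) x\<rangle>\<close> there, which
  determines \<open>A\<close> by polarization. Here \<open>\<langle>x, E(S) x\<rangle> = \<parallel>E(S) x\<parallel>\<^sup>2\<close>.\<close>

definition spectral_measure_of ::
    "('a::complex_hilbert_space \<times> 'a) set \<Rightarrow> (real set \<Rightarrow> ('a \<Rightarrow>\<^sub>L 'a)) \<Rightarrow> bool"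
  where "spectral_measure_of A E \<longleftrightarrow> projection_valued_measure E \<and>
    Domain A = {x. (\<integral>\<^sup>+ t. ennreal (t\<^sup>2) \<partial>scalar_spectral_measure E x) < \<infinity>} \<and>
    (\<forall>(x, u)\<in>A. cinner x u = complex_of_real (\<integral> t. t \<partial>scalar_spectral_measure E x))"

definition K_fun ::
    "('b::complex_hilbert_space \<Rightarrow>\<^sub>L 'a::complex_hilbert_space) \<Rightarrow> (real set \<Rightarrow> ('b \<Rightarrow>\<^sub>L 'b)) \<Rightarrow>
     ('a \<Rightarrow>\<^sub>L 'b) \<Rightarrow> real \<Rightarrow> ('a \<Rightarrow>\<^sub>L 'a)"
  where "K_fun B10 E0 B01 \<mu> = B10 o\<^sub>L E0 {..<\<mu>} o\<^sub>L B01"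

definition open_interval :: "ereal \<Rightarrow> ereal \<Rightarrow> real set"
  where "open_interval a b = {x. a < ereal x \<and> ereal x < b}"


section \<open>Contours\<close>

text \<open>A contour piece is a curve \<open>g\<close> on the open parameter interval \<open>{0<..<1}\<close>, running from the
  lower to the upper end point of a real interval with possibly infinite end points. An infinite
  end point is approached by going to infinity in the complex plane.\<close>

definition end_filter :: "ereal \<Rightarrow> complex filter"
  where "end_filter e =
    (if \<bar>e\<bar> = \<infinity> then at_infinity else nhds (complex_of_real (real_of_ereal e)))"

definition arc_length :: "(real \<Rightarrow> complex) \<Rightarrow> real set \<Rightarrow> ennreal"
  where "arc_length g S =
    (SUP (n, t) \<in> {(n, t). mono_on {..n} t \<and> t ` {..n} \<subseteq> S}.
      \<Sum>i<n. ennreal (cmod (g (t (Suc i)) - g (t i))))"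

text \<open>Finite length up to a finite end point; up to an infinite one only locally finite length
  can be required.\<close>

definition rectifiable_arc :: "ereal \<Rightarrow> ereal \<Rightarrow> (real \<Rightarrow> complex) \<Rightarrow> bool"
  where "rectifiable_arc a b g \<longleftrightarrow>
    (\<forall>c d. 0 \<le> c \<longrightarrow> d \<le> 1 \<longrightarrow> (c = 0 \<longrightarrow> \<bar>a\<bar> \<noteq> \<infinity>) \<longrightarrow> (d = 1 \<longrightarrow> \<bar>b\<bar> \<noteq> \<infinity>) \<longrightarrow>
      arc_length g ({c..d} \<inter> {0<..<1}) < \<infinity>)"

text \<open>The limits are uniform in the deformation parameter \<open>s\<close>, i.e.\ the homotopy extends
  continuously to the closed square with its end points kept fixed.\<close>

definition deformation_of_interval ::
    "ereal \<Rightarrow> ereal \<Rightarrow> complex set \<Rightarrow> (real \<Rightarrow> complex) \<Rightarrow> bool"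
  where "deformation_of_interval a b D g \<longleftrightarrow>
    (\<exists>(h :: real \<times> real \<Rightarrow> complex) (p :: real \<Rightarrow> real).
      continuous_on {0<..<1} p \<and> strict_mono_on {0<..<1} p \<and>
      p ` {0<..<1} = open_interval a b \<and>
      continuous_on ({0..1} \<times> {0<..<1}) h \<and>
      h ` ({0..1} \<times> {0<..<1}) \<subseteq> D \<union> complex_of_real ` open_interval a b \<and>
      (\<forall>t\<in>{0<..<1}. h (0, t) = complex_of_real (p t) \<and> h (1, t) = g t) \<and>
      filterlim h (end_filter a) (principal {0..1} \<times>\<^sub>F at_right 0) \<and>
      filterlim h (end_filter b) (principal {0..1} \<times>\<^sub>F at_left 1))"

definition contour_piece ::
    "('a::complex_hilbert_space \<times> 'a) set \<Rightarrow> ereal \<Rightarrow> ereal \<Rightarrow> complex set \<Rightarrow>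
     (real \<Rightarrow> complex) \<Rightarrow> bool"
  where "contour_piece A0 a b D g \<longleftrightarrow>
    continuous_on {0<..<1} g \<and> inj_on g {0<..<1} \<and> g ` {0<..<1} \<subseteq> D \<and>
    rectifiable_arc a b g \<and> deformation_of_interval a b D g \<and>
    closure (g ` {0<..<1}) \<inter> continuous_spectrum A0
      \<subseteq> {complex_of_real x | x. ereal x = a \<or> ereal x = b}"


section \<open>Integrals\<close>

text \<open>\<open>\<integral> |d\<mu>| \<phi>(\<mu>)\<close> along \<open>g\<close>, as the supremum of the lower Darboux sums with respect to arc
  length.\<close>

definition arc_integral :: "(complex \<Rightarrow> ennreal) \<Rightarrow> (real \<Rightarrow> complex) \<Rightarrow> ennreal"
  where "arc_integral \<phi> g =
    (SUP (n, t) \<in> {(n, t). mono_on {..n} t \<and> t ` {..n} \<subseteq> {0<..<1}}.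
      \<Sum>i<n. (INF s \<in> {t i..t (Suc i)}. \<phi> (g s)) * arc_length g {t i..t (Suc i)})"

text \<open>The Riemann--Stieltjes integral \<open>\<integral> dg(t) F(t)\<close> over \<open>{c..d}\<close>.\<close>

definition has_stieltjes_integral ::
    "(real \<Rightarrow> ('a::complex_hilbert_space \<Rightarrow>\<^sub>L 'b::complex_hilbert_space)) \<Rightarrow> (real \<Rightarrow> complex) \<Rightarrow>
     real \<Rightarrow> real \<Rightarrow> ('a \<Rightarrow>\<^sub>L 'b) \<Rightarrow> bool"
  where "has_stieltjes_integral F g c d I \<longleftrightarrow>
    (\<forall>\<epsilon>>0. \<exists>\<delta>>0. \<forall>(n::nat) t \<tau>.
      mono_on {..n} t \<longrightarrow> t 0 = c \<longrightarrow> t n = d \<longrightarrow>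
      (\<forall>i<n. t (Suc i) - t i < \<delta> \<and> \<tau> i \<in> {t i..t (Suc i)}) \<longrightarrow>
      norm ((\<Sum>i<n. op_scale (g (t (Suc i)) - g (t i)) (F (\<tau> i))) - I) < \<epsilon>)"

definition has_op_contour_integral ::
    "(complex \<Rightarrow> ('a::complex_hilbert_space \<Rightarrow>\<^sub>L 'b::complex_hilbert_space)) \<Rightarrow>
     (real \<Rightarrow> complex) \<Rightarrow> ('a \<Rightarrow>\<^sub>L 'b) \<Rightarrow> bool"
  where "has_op_contour_integral F g I \<longleftrightarrow>
    (\<exists>J. (\<forall>c d. 0 < c \<longrightarrow> c < d \<longrightarrow> d < 1 \<longrightarrow>
            has_stieltjes_integral (\<lambda>t. F (g t)) g c d (J c d)) \<and>
         ((\<lambda>(c, d). J c d) \<longlongrightarrow> I) (at_right 0 \<times>\<^sub>F at_left 1))"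

definition borel_partition :: "real set \<Rightarrow> real set set \<Rightarrow> bool"
  where "borel_partition S P \<longleftrightarrow> partition_on S P \<and> countable P \<and> P \<subseteq> sets borel"

text \<open>The integral \<open>\<integral>\<^sub>S B\<^sub>1\<^sub>0 E\<^sub>0(d\<mu>) B\<^sub>0\<^sub>1 T(\<mu>)\<close>, as the operator norm limit of the sums
  \<open>\<Sum> B\<^sub>1\<^sub>0 E\<^sub>0(\<delta>\<^sub>k) B\<^sub>0\<^sub>1 T(\<mu>\<^sub>k)\<close>, \<open>\<mu>\<^sub>k \<in> \<delta>\<^sub>k\<close>, over finite Borel partitions of \<open>S\<close> directed by
  refinement.\<close>

definition has_spectral_integral ::
    "('b::complex_hilbert_space \<Rightarrow>\<^sub>L 'a::complex_hilbert_space) \<Rightarrow> (real set \<Rightarrow> ('b \<Rightarrow>\<^sub>L 'b)) \<Rightarrow>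
     ('a \<Rightarrow>\<^sub>L 'b) \<Rightarrow> real set \<Rightarrow> (complex \<Rightarrow> ('a \<Rightarrow>\<^sub>L 'a)) \<Rightarrow> ('a \<Rightarrow>\<^sub>L 'a) \<Rightarrow> bool"
  where "has_spectral_integral B10 E0 B01 S T I \<longleftrightarrow>
    (\<forall>\<epsilon>>0. \<exists>P0. finite P0 \<and> borel_partition S P0 \<and>
      (\<forall>P \<tau>. finite P \<longrightarrow> borel_partition S P \<longrightarrow> refines S P P0 \<longrightarrow> (\<forall>\<delta>\<in>P. \<tau> \<delta> \<in> \<delta>) \<longrightarrow>
        norm ((\<Sum>\<delta>\<in>P. B10 o\<^sub>L E0 \<delta> o\<^sub>L B01 o\<^sub>L T (complex_of_real (\<tau> \<delta>))) - I) < \<epsilon>))"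

text \<open>In the remaining definitions \<open>S\<close> stands for \<open>\<sigma>'(A\<^sub>0)\<close>, the contour \<open>\<Gamma>\<close> is made of the
  pieces \<open>g 1, \<dots>, g m\<close>, and \<open>K' k\<close> is the function \<open>K\<^sub>B'\<close> on the \<open>k\<close>-th interval together with
  its continuation.\<close>

definition contour_image :: "nat \<Rightarrow> (nat \<Rightarrow> real \<Rightarrow> complex) \<Rightarrow> complex set"
  where "contour_image m g = (\<Union>k\<in>{1..m}. g k ` {0<..<1})"

definition modified_variation ::
    "('b::complex_hilbert_space \<times> 'b) set \<Rightarrow> ('b \<Rightarrow>\<^sub>L 'a::complex_hilbert_space) \<Rightarrow>
     (real set \<Rightarrow> ('b \<Rightarrow>\<^sub>L 'b)) \<Rightarrow> ('a \<Rightarrow>\<^sub>L 'b) \<Rightarrow> real set \<Rightarrow> nat \<Rightarrow>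
     (nat \<Rightarrow> complex \<Rightarrow> ('a \<Rightarrow>\<^sub>L 'a)) \<Rightarrow> (nat \<Rightarrow> real \<Rightarrow> complex) \<Rightarrow> ennreal"
  where "modified_variation A0 B10 E0 B01 S m K' g =
    (SUP P \<in> {P. borel_partition (real_spectrum A0) P}.
      \<Sum>\<^sub>\<infinity>\<delta>\<in>P. ennreal (norm (B10 o\<^sub>L E0 (\<delta> \<inter> S) o\<^sub>L B01))) +
    (\<Sum>k\<in>{1..m}. arc_integral (\<lambda>\<mu>. ennreal (norm (K' k \<mu>))) (g k))"

definition has_K_integral ::
    "('b::complex_hilbert_space \<Rightarrow>\<^sub>L 'a::complex_hilbert_space) \<Rightarrow> (real set \<Rightarrow> ('b \<Rightarrow>\<^sub>L 'b)) \<Rightarrow>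
     ('a \<Rightarrow>\<^sub>L 'b) \<Rightarrow> real set \<Rightarrow> nat \<Rightarrow> (nat \<Rightarrow> complex \<Rightarrow> ('a \<Rightarrow>\<^sub>L 'a)) \<Rightarrow>
     (nat \<Rightarrow> real \<Rightarrow> complex) \<Rightarrow> (complex \<Rightarrow> ('a \<Rightarrow>\<^sub>L 'a)) \<Rightarrow> ('a \<Rightarrow>\<^sub>L 'a) \<Rightarrow> bool"
  where "has_K_integral B10 E0 B01 S m K' g T I \<longleftrightarrow>
    (\<exists>I0 J. has_spectral_integral B10 E0 B01 S T I0 \<and>
      (\<forall>k\<in>{1..m}. has_op_contour_integral (\<lambda>\<mu>. K' k \<mu> o\<^sub>L T \<mu>) (g k) (J k)) \<and>
      I = I0 + (\<Sum>k\<in>{1..m}. J k))"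

text \<open>\<open>V\<^sub>1(Y, \<Gamma>)\<close> is defined and equal to \<open>I\<close>. The resolvents \<open>R \<mu>\<close> are unique, and only their
  values for \<open>\<mu> \<in> S \<union> \<Gamma>\<close> enter the integral.\<close>

definition V1_eq ::
    "('b::complex_hilbert_space \<Rightarrow>\<^sub>L 'a::complex_hilbert_space) \<Rightarrow> (real set \<Rightarrow> ('b \<Rightarrow>\<^sub>L 'b)) \<Rightarrow>
     ('a \<Rightarrow>\<^sub>L 'b) \<Rightarrow> real set \<Rightarrow> nat \<Rightarrow> (nat \<Rightarrow> complex \<Rightarrow> ('a \<Rightarrow>\<^sub>L 'a)) \<Rightarrow>
     (nat \<Rightarrow> real \<Rightarrow> complex) \<Rightarrow> ('a \<times> 'a) set \<Rightarrow> ('a \<Rightarrow>\<^sub>L 'a) \<Rightarrow> bool"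
  where "V1_eq B10 E0 B01 S m K' g Y I \<longleftrightarrow>
    (\<exists>R. (\<forall>\<mu>\<in>complex_of_real ` S \<union> contour_image m g. is_resolvent Y \<mu> (R \<mu>)) \<and>
      has_K_integral B10 E0 B01 S m K' g R I)"

definition r_min :: "real \<Rightarrow> real \<Rightarrow> real"
  where "r_min d V = d / 2 - sqrt (d\<^sup>2 / 4 - V)"

definition r_max :: "real \<Rightarrow> real \<Rightarrow> real"
  where "r_max d V = d - sqrt V"

definition op_ball :: "real \<Rightarrow> ('a::complex_hilbert_space \<Rightarrow>\<^sub>L 'a) set"
  where "op_ball r = {X \<in> bounded_ops. norm X \<le> r}"

end

(* V\<^sub>1(A\<^sub>1 + X, \<Gamma>) is bounded by V / (d - \<parallel>X\<parallel>), and since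
   R\<^sub>X - R\<^sub>Y = R\<^sub>X (Y - X) R\<^sub>Y for the resolvents, its increments are bounded by
   V \<parallel>X - Y\<parallel> / ((d - \<parallel>X\<parallel>) (d - \<parallel>Y\<parallel>)). As r_min is the smaller root of r (d - r) = V, the ball of
   radius r_min is mapped into itself, and the map is a contraction on every ball of radius
   r < r_max = d - sqrt V, so Banach's fixed point theorem applies. The resolvents need not be small
   far out; the integrals converge because the variation has small tails, both at infinity on the
   real axis and at the ends of the contour. *)

theory Submission
  imports Defs
begin

section \<open>Bounded complex-linear operators\<close>

text \<open>The obstacle is the mode of convergence. \<open>E0\<close> is countably additive only
  strongly, whereas the integrals are norm limits, so finite variation has to take over the role of
  dominated convergence: a subdivision or family that comes within e of the total lives, up to a
  small loss, on a bounded part, and superadditivity leaves little outside it. The integrand then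
  only has to be bounded and continuous (uniformly so on the real part of the path). The first
  resolvent identity and the bound 1 / (d - norm X) give both, even on an unbounded path. That bound
  rests on the norm of a self-adjoint resolvent being the inverse distance to the spectrum.
  \<open>V1_eq\<close> is a relation with the resolvents and integrals hidden under existential
  quantifiers. One estimate comparing two integrands serves all purposes: another resolvent family
  gives the contraction, the zero integrand gives the norm bound. Existence is shown in the ball of
  radius r_min only. Larger balls inherit that solution, and the factor V / (d - r)^2, which is
  below 1 exactly for r < d - sqrt V, gives uniqueness there; hence X does not depend on r.\<close>

lemma cinner_add_left: "cinner (x + y) z = cinner x z + cinner y z"
  by (metis cinner_commute cinner_add_right complex_cnj_add)

lemma cinner_scaleC_left: "cinner (scaleC c x) y = cnj c * cinner x y"
  by (metis cinner_commute cinner_scaleC_right complex_cnj_mult)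

lemma bounded_linear_scaleC: "bounded_linear (scaleC c :: 'a \<Rightarrow> 'a::complex_hilbert_space)"
proof (rule bounded_linear_intro)
  show "scaleC c (r *\<^sub>R x) = r *\<^sub>R scaleC c x" for r and x :: 'a
    by (simp add: scaleR_eq_scaleC scaleC_scaleC mult.commute)
  show "norm (scaleC c x) \<le> norm x * cmod c" for x :: 'a
    by (simp add: norm_scaleC)
qed (simp add: scaleC_add_right)

lemma scaleC_diff_right: "scaleC c (x - y) = scaleC c x - scaleC c y"
  by (rule linear_diff [OF bounded_linear.linear [OF bounded_linear_scaleC]])

lemma scaleC_zero_right [simp]: "scaleC c 0 = 0"
  by (rule linear_0 [OF bounded_linear.linear [OF bounded_linear_scaleC]])

lemma scaleC_zero_left [simp]: "scaleC 0 x = 0"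
  using scaleC_add_left [of 0 0 x] by simp

lemma scaleC_minus_left: "scaleC (- c) x = - scaleC c x"
  using scaleC_add_left [of c "- c" x] by (simp add: minus_unique)

lemma scaleC_diff_left: "scaleC (c - d) x = scaleC c x - scaleC d x"
  using scaleC_add_left [of c "- d" x] by (simp add: scaleC_minus_left)

lemma scaleC_sum_left: "scaleC (\<Sum>i\<in>I. c i) x = (\<Sum>i\<in>I. scaleC (c i) x)"
  by (induction I rule: infinite_finite_induct) (auto simp: scaleC_add_left)

lemma cinner_diff_right: "cinner x (y - z) = cinner x y - cinner x z"
  using cinner_add_right [of x "y - z" z] by (simp add: algebra_simps)

lemma cinner_diff_left: "cinner (x - y) z = cinner x z - cinner y z"
  using cinner_add_left [of "x - y" y z] by (simp add: algebra_simps)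

lemma norm_add_power2:
  "(norm (x + y))\<^sup>2 = (norm x)\<^sup>2 + (norm y)\<^sup>2 + 2 * Re (cinner x y)"
proof -
  have "complex_of_real ((norm (x + y))\<^sup>2)
      = complex_of_real ((norm x)\<^sup>2) + complex_of_real ((norm y)\<^sup>2) + (cinner x y + cnj (cinner x y))"
    unfolding cinner_self [symmetric]
    by (simp add: cinner_add_left cinner_add_right cinner_commute [of y x])
  also have "cinner x y + cnj (cinner x y) = complex_of_real (2 * Re (cinner x y))"
    by (simp add: complex_add_cnj)
  finally show ?thesis
    by (metis of_real_add of_real_eq_iff)
qed

text \<open>Cauchy-Schwarz, read off from the triangle inequality (which the class already provides)
  by expanding both squares.\<close>

lemma Re_cinner_le: "Re (cinner x y) \<le> norm x * norm y"
proof -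
  have "(norm (x + y))\<^sup>2 \<le> (norm x + norm y)\<^sup>2"
    by (simp add: norm_triangle_ineq power_mono)
  then show ?thesis
    by (simp add: norm_add_power2 power2_sum)
qed

lemma cinner_right_eqI:
  assumes "\<And>x. cinner x y = cinner x z"
  shows "y = z"
proof -
  have "cinner (y - z) (y - z) = 0"
    by (simp add: cinner_diff_right assms)
  then show ?thesis
    by (simp add: cinner_self)
qed

text \<open>Test the adjoint relation on \<open>C y\<close> and cancel one factor norm (C y). This
  carries continuity of the continuation of K_B' across the real axis.\<close>

lemma norm_adjoint_le:
  assumes "is_adjoint B C"
  shows "norm C \<le> norm B"
proof (rule norm_blinfun_bound)
  fix y
  have "(norm (C y))\<^sup>2 = Re (cinner (C y) (C y))"
    by (simp add: cinner_self)
  also have "\<dots> = Re (cinner (B (C y)) y)"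
    using assms by (simp add: is_adjoint_def)
  also have "\<dots> \<le> norm (B (C y)) * norm y"
    by (rule Re_cinner_le)
  also have "\<dots> \<le> (norm B * norm (C y)) * norm y"
    by (intro mult_right_mono norm_blinfun) auto
  finally have "norm (C y) * norm (C y) \<le> (norm B * norm y) * norm (C y)"
    by (simp add: power2_eq_square mult_ac)
  then show "norm (C y) \<le> norm B * norm y"
    by (cases "norm (C y) = 0") (auto simp: mult_le_cancel_right)
qed auto

lemma is_adjoint_diff:
  assumes "is_adjoint B C" "is_adjoint B' C'"
  shows "is_adjoint (B - B') (C - C')"
  using assms by (simp add: is_adjoint_def blinfun.diff_left cinner_diff_right cinner_diff_left)

lemma bounded_opsD: "T \<in> bounded_ops \<Longrightarrow> T (scaleC c x) = scaleC c (T x)"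
  by (simp add: bounded_ops_def)

text \<open>The operator type only gives real linearity; complex homogeneity of \<open>C\<close> is
  forced by linearity of the inner product in its second slot.\<close>

lemma adjoint_in_bounded_ops:
  assumes "is_adjoint B C"
  shows "C \<in> bounded_ops"
proof -
  have "C (scaleC c y) = scaleC c (C y)" for c y
  proof (rule cinner_right_eqI)
    show "cinner x (C (scaleC c y)) = cinner x (scaleC c (C y))" for x
      by (simp add: cinner_scaleC_right flip: assms [unfolded is_adjoint_def, rule_format])
  qed
  then show ?thesis
    by (simp add: bounded_ops_def)
qed

lemma zero_in_bounded_ops: "0 \<in> bounded_ops"
  by (simp add: bounded_ops_def)

lemma id_in_bounded_ops: "id_blinfun \<in> bounded_ops"
  by (simp add: bounded_ops_def)

lemma add_in_bounded_ops: "S \<in> bounded_ops \<Longrightarrow> T \<in> bounded_ops \<Longrightarrow> S + T \<in> bounded_ops"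
  by (simp add: bounded_ops_def blinfun.add_left scaleC_add_right)

lemma diff_in_bounded_ops: "S \<in> bounded_ops \<Longrightarrow> T \<in> bounded_ops \<Longrightarrow> S - T \<in> bounded_ops"
  by (simp add: bounded_ops_def blinfun.diff_left scaleC_diff_right)

lemma compose_in_bounded_ops: "S \<in> bounded_ops \<Longrightarrow> T \<in> bounded_ops \<Longrightarrow> S o\<^sub>L T \<in> bounded_ops"
  by (simp add: bounded_ops_def)

lemma op_scale_in_bounded_ops: "T \<in> bounded_ops \<Longrightarrow> op_scale c T \<in> bounded_ops"
  by (simp add: bounded_ops_def blinfun_apply_op_scale scaleC_scaleC mult.commute)

lemma sum_in_bounded_ops: "(\<And>i. i \<in> I \<Longrightarrow> T i \<in> bounded_ops) \<Longrightarrow> (\<Sum>i\<in>I. T i) \<in> bounded_ops"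
  by (induction I rule: infinite_finite_induct) (auto simp: zero_in_bounded_ops add_in_bounded_ops)

text \<open>One closed condition for each pair \<open>c\<close>, \<open>x\<close>. Hence norm limits
  of integral sums stay complex-linear, and Banach's theorem applies inside
  \<open>bounded_ops\<close>.\<close>

lemma closed_bounded_ops: "closed (bounded_ops :: ('a::complex_hilbert_space \<Rightarrow>\<^sub>L 'b::complex_hilbert_space) set)"
proof -
  have "closed {T :: 'a \<Rightarrow>\<^sub>L 'b. T (scaleC c x) = scaleC c (T x)}" for c x
    by (intro closed_Collect_eq continuous_intros
        continuous_on_compose2 [OF linear_continuous_on [OF bounded_linear_scaleC], where t = UNIV]) auto
  then have "closed (\<Inter>c x. {T :: 'a \<Rightarrow>\<^sub>L 'b. T (scaleC c x) = scaleC c (T x)})"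
    by (intro closed_INT) auto
  moreover have "(\<Inter>c x. {T :: 'a \<Rightarrow>\<^sub>L 'b. T (scaleC c x) = scaleC c (T x)}) = bounded_ops"
    by (auto simp: bounded_ops_def)
  ultimately show ?thesis by simp
qed

lemma norm_op_scale_le: "norm (op_scale c T) \<le> cmod c * norm T"
proof (rule norm_blinfun_bound)
  show "norm (op_scale c T x) \<le> cmod c * norm T * norm x" for x
    using mult_left_mono [OF norm_blinfun [of T x], of "cmod c"]
    by (simp add: blinfun_apply_op_scale norm_scaleC mult_ac)
qed simp

lemma op_scale_diff_right: "op_scale c (S - T) = op_scale c S - op_scale c T"
  by (rule blinfun_eqI) (simp add: blinfun_apply_op_scale blinfun.diff_left scaleC_diff_right)

lemma op_scale_zero_right [simp]: "op_scale c 0 = 0"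
  by (rule blinfun_eqI) (simp add: blinfun_apply_op_scale)

lemma op_scale_sum_left: "op_scale (\<Sum>i\<in>I. c i) T = (\<Sum>i\<in>I. op_scale (c i) T)"
  by (rule blinfun_eqI) (simp add: blinfun_apply_op_scale blinfun.sum_left scaleC_sum_left)

lemma blinfun_compose_diff_right: "S o\<^sub>L (T - U) = (S o\<^sub>L T) - (S o\<^sub>L U)"
  by (rule blinfun_eqI) (simp add: blinfun.diff_left blinfun.diff_right)

lemma norm_blinfun_compose_le:
  assumes "norm S \<le> s" "norm T \<le> t"
  shows "norm (S o\<^sub>L T) \<le> s * t"
proof -
  have "norm (S o\<^sub>L T) \<le> norm S * norm T"
    by (rule norm_blinfun_compose)
  also have "\<dots> \<le> s * t"
    using assms order_trans [OF norm_ge_zero assms(1)] by (intro mult_mono) auto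
  finally show ?thesis .
qed


section \<open>Resolvents\<close>

text \<open>The two inclusions of the graph equation separately: \<open>R\<close> is a right inverse
  with values in the domain, and a left inverse on the graph. Resolvents are built and used in this
  form.\<close>

lemma is_resolvent_iff:
  "is_resolvent A z R \<longleftrightarrow> R \<in> bounded_ops \<and>
    (\<forall>y. (R y, y + scaleC z (R y)) \<in> A) \<and> (\<forall>x u. (x, u) \<in> A \<longrightarrow> R (u - scaleC z x) = x)"
proof -
  have "{(u - scaleC z x, x) | x u. (x, u) \<in> A} = {(y, R y) | y. True} \<longleftrightarrow>
    (\<forall>y. (R y, y + scaleC z (R y)) \<in> A) \<and> (\<forall>x u. (x, u) \<in> A \<longrightarrow> R (u - scaleC z x) = x)"
    (is "?L = ?R \<longleftrightarrow> ?P \<and> ?Q")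
  proof
    assume eq: "?L = ?R"
    have "(R y, y + scaleC z (R y)) \<in> A" for y
    proof -
      have "(y, R y) \<in> ?L"
        unfolding eq by auto
      then obtain u where "(R y, u) \<in> A" "y = u - scaleC z (R y)"
        by auto
      then show ?thesis
        by (simp add: algebra_simps)
    qed
    moreover have "R (u - scaleC z x) = x" if "(x, u) \<in> A" for x u
    proof -
      have "(u - scaleC z x, x) \<in> ?R"
        unfolding eq [symmetric] using that by auto
      then show ?thesis by auto
    qed
    ultimately show "?P \<and> ?Q" by blast
  next
    assume PQ: "?P \<and> ?Q"
    have "(y, R y) \<in> ?L" for y
      using PQ by (intro CollectI exI [of _ "R y"] exI [of _ "y + scaleC z (R y)"]) simp
    then show "?L = ?R"
      using PQ by auto
  qed
  then show ?thesis
    by (simp add: is_resolvent_def)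
qed

lemma resolvent_in_bounded_ops: "is_resolvent A z R \<Longrightarrow> R \<in> bounded_ops"
  and resolvent_range: "is_resolvent A z R \<Longrightarrow> (R y, y + scaleC z (R y)) \<in> A"
  and resolvent_left_inverse: "is_resolvent A z R \<Longrightarrow> (x, u) \<in> A \<Longrightarrow> R (u - scaleC z x) = x"
  by (auto simp: is_resolvent_iff)

lemma not_in_spectrumD: "z \<notin> spectrum A \<Longrightarrow> \<exists>R. is_resolvent A z R"
  by (simp add: spectrum_def)

text \<open>The resolvent of the perturbed operator is the fixed point of
  \<open>R = R\<^sub>1 - R\<^sub>1 X R\<close>, which is a Banach contraction.\<close>

lemma resolvent_graph_plus_exists:
  fixes X R1 :: "'a::complex_hilbert_space \<Rightarrow>\<^sub>L 'a"
  assumes R1: "is_resolvent A z R1" and X: "X \<in> bounded_ops" and small: "norm R1 * norm X < 1"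
  obtains R where "is_resolvent (graph_plus A X) z R" "norm R * (1 - norm R1 * norm X) \<le> norm R1"
proof -
  define q where "q = norm R1 * norm X"
  note R1_ops = resolvent_in_bounded_ops [OF R1]
  have R1X: "norm (R1 (X x)) \<le> q * norm x" for x
    using norm_blinfun [of "R1 o\<^sub>L X" x] norm_blinfun_compose [of R1 X]
    by (smt (verit) blinfun_apply_blinfun_compose mult_right_mono norm_ge_zero q_def)
  have "\<exists>!R\<in>bounded_ops. R1 - (R1 o\<^sub>L (X o\<^sub>L R)) = R"
  proof (rule Banach_fix)
    show "complete (bounded_ops :: ('a \<Rightarrow>\<^sub>L 'a) set)"
      by (simp add: closed_bounded_ops complete_eq_closed)
    show "bounded_ops \<noteq> ({} :: ('a \<Rightarrow>\<^sub>L 'a) set)"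
      using zero_in_bounded_ops by auto
    show "0 \<le> q" "q < 1"
      using small by (auto simp: q_def)
    show "(\<lambda>R. R1 - (R1 o\<^sub>L (X o\<^sub>L R))) ` bounded_ops \<subseteq> bounded_ops"
      by (auto intro!: diff_in_bounded_ops compose_in_bounded_ops R1_ops X)
  next
    fix R S :: "'a \<Rightarrow>\<^sub>L 'a"
    show "dist (R1 - (R1 o\<^sub>L (X o\<^sub>L R))) (R1 - (R1 o\<^sub>L (X o\<^sub>L S))) \<le> q * dist R S"
    proof -
      have "dist (R1 - (R1 o\<^sub>L (X o\<^sub>L R))) (R1 - (R1 o\<^sub>L (X o\<^sub>L S))) = norm (R1 o\<^sub>L (X o\<^sub>L (S - R)))"
        by (simp add: dist_norm blinfun_compose_diff_right)
      also have "\<dots> \<le> norm R1 * (norm X * norm (S - R))"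
        by (intro norm_blinfun_compose_le norm_blinfun_compose order_refl)
      finally show "dist (R1 - (R1 o\<^sub>L (X o\<^sub>L R))) (R1 - (R1 o\<^sub>L (X o\<^sub>L S))) \<le> q * dist R S"
        by (simp add: q_def dist_norm norm_minus_commute mult_ac)
    qed
  qed
  then obtain R where R_ops: "R \<in> bounded_ops" and R: "R1 - (R1 o\<^sub>L (X o\<^sub>L R)) = R"
    by blast
  have Ry: "R y = R1 (y - X (R y))" for y
    using arg_cong [OF R, of "\<lambda>T. blinfun_apply T y"]
    by (simp add: blinfun.diff_left blinfun.diff_right)
  have "is_resolvent (graph_plus A X) z R"
    unfolding is_resolvent_iff
  proof (intro conjI allI impI R_ops)
    fix y
    have "(R y, (y - X (R y)) + scaleC z (R y)) \<in> A"
      using resolvent_range [OF R1, of "y - X (R y)"] by (simp flip: Ry)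
    then have "(R y, ((y - X (R y)) + scaleC z (R y)) + X (R y)) \<in> graph_plus A X"
      unfolding graph_plus_def by blast
    then show "(R y, y + scaleC z (R y)) \<in> graph_plus A X"
      by (simp add: algebra_simps)
  next
    fix x v assume "(x, v) \<in> graph_plus A X"
    then obtain u where u: "(x, u) \<in> A" "v = u + X x"
      by (auto simp: graph_plus_def)
    define y where "y = v - scaleC z x"
    have "u - scaleC z x = y - X x"
      by (simp add: y_def u)
    then have "x = R1 (y - X x)"
      using resolvent_left_inverse [OF R1 u(1)] by simp
    \<comment> \<open>Both \<open>x\<close> and \<open>R y\<close> are fixed points of the
      contraction sending v to \<open>R1 (y - X v)\<close>, so they coincide.\<close>
    then have "x - R y = R1 (y - X x) - R1 (y - X (R y))"
      by (simp flip: Ry)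
    also have "\<dots> = - R1 (X (x - R y))"
      by (simp add: blinfun.diff_right)
    finally have "norm (x - R y) \<le> q * norm (x - R y)"
      using R1X [of "x - R y"] by (metis norm_minus_cancel)
    moreover have "q < 1"
      using small by (simp add: q_def)
    ultimately have "norm (x - R y) = 0"
      by (smt (verit) mult_le_cancel_right1 norm_ge_zero)
    then show "R (v - scaleC z x) = x"
      by (simp add: y_def)
  qed
  \<comment> \<open>The Neumann series bound, in product form to avoid a division.\<close>
  moreover have "norm R * (1 - norm R1 * norm X) \<le> norm R1"
  proof -
    have "norm R \<le> norm R1 + norm (R1 o\<^sub>L (X o\<^sub>L R))"
      using norm_triangle_ineq4 [of R1 "R1 o\<^sub>L (X o\<^sub>L R)"] R by simp
    also have "\<dots> \<le> norm R1 + norm R1 * (norm X * norm R)"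
      by (intro add_mono norm_blinfun_compose_le norm_blinfun_compose order_refl)
    finally show ?thesis
      by (simp add: algebra_simps)
  qed
  ultimately show thesis
    using that by blast
qed

text \<open>Moving the spectral parameter is a bounded perturbation: A - w = (A + (z - w)) - z, so
  the preceding lemma applies with a multiple of the identity. Closedness makes \<sigma>'(A0) a
  Borel set.\<close>

lemma closed_spectrum:
  fixes A :: "('a::complex_hilbert_space \<times> 'a) set"
  shows "closed (spectrum A)"
proof -
  have "open (- spectrum A)"
    unfolding open_dist
  proof
    fix z assume "z \<in> - spectrum A"
    then obtain R1 where R1: "is_resolvent A z R1"
      using not_in_spectrumD by auto
    \<comment> \<open>The added 1 covers \<open>R1 = 0\<close>, which occurs on the trivial
      space.\<close>
    have "w \<in> - spectrum A" if "dist w z < 1 / (norm R1 + 1)" for w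
    proof -
      define X :: "'a \<Rightarrow>\<^sub>L 'a" where "X = op_scale (z - w) id_blinfun"
      have X_apply: "X x = scaleC (z - w) x" for x
        by (simp add: X_def blinfun_apply_op_scale)
      have X: "X \<in> bounded_ops"
        unfolding X_def by (intro op_scale_in_bounded_ops id_in_bounded_ops)
      have "norm X \<le> dist w z"
        by (intro norm_blinfun_bound) (simp_all add: X_apply norm_scaleC dist_norm norm_minus_commute)
      then have "norm R1 * norm X \<le> norm R1 * dist w z"
        by (simp add: mult_left_mono)
      also have "\<dots> \<le> norm R1 * (1 / (norm R1 + 1))"
        using that by (intro mult_left_mono) auto
      also have "\<dots> < 1"
        by (simp add: divide_simps add_nonneg_pos)
      finally obtain R where R: "is_resolvent (graph_plus A X) z R"
        using resolvent_graph_plus_exists [OF R1 X] by blast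
      have "is_resolvent A w R"
        unfolding is_resolvent_iff
      proof (intro conjI allI impI)
        show "R \<in> bounded_ops"
          by (rule resolvent_in_bounded_ops [OF R])
      next
        fix y
        obtain u where "(R y, u) \<in> A" "y + scaleC z (R y) = u + X (R y)"
          using resolvent_range [OF R, of y] by (auto simp: graph_plus_def)
        moreover from this have "u = y + scaleC w (R y)"
          by (simp add: X_apply scaleC_diff_left algebra_simps)
        ultimately show "(R y, y + scaleC w (R y)) \<in> A"
          by simp
      next
        fix x u assume "(x, u) \<in> A"
        then have "(x, u + X x) \<in> graph_plus A X"
          by (auto simp: graph_plus_def)
        from resolvent_left_inverse [OF R this] show "R (u - scaleC w x) = x"
          by (simp add: X_apply scaleC_diff_left algebra_simps)
      qed
      then show ?thesis
        by (auto simp: spectrum_def)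
    qed
    then show "\<exists>e>0. \<forall>w. dist w z < e \<longrightarrow> w \<in> - spectrum A"
      by (intro exI [of _ "1 / (norm R1 + 1)"]) (auto simp: add_nonneg_pos)
  qed
  then show ?thesis
    by (simp add: closed_def)
qed

lemma borel_real_spectrum: "real_spectrum A \<in> sets borel"
proof -
  have "closed (complex_of_real -` spectrum A)"
    by (intro closed_vimage closed_spectrum continuous_intros)
  then show ?thesis
    by (auto simp: real_spectrum_def vimage_def)
qed

text \<open>The first resolvent identity: apply \<open>R\<close> to (A - z) (S y) = y + (w - z) S y.
  It yields Lipschitz dependence on the spectral parameter and, for z = w, uniqueness of
  resolvents.\<close>

lemma resolvent_diff:
  assumes R: "is_resolvent A z R" and S: "is_resolvent A w S"
  shows "R - S = op_scale (z - w) (R o\<^sub>L S)"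
proof (rule blinfun_eqI)
  fix y
  have "R (y + scaleC w (S y) - scaleC z (S y)) = S y"
    by (rule resolvent_left_inverse [OF R resolvent_range [OF S]])
  moreover have "R (scaleC c x) = scaleC c (R x)" for c x
    by (rule bounded_opsD [OF resolvent_in_bounded_ops [OF R]])
  ultimately show "(R - S) y = op_scale (z - w) (R o\<^sub>L S) y"
    by (simp add: blinfun.diff_left blinfun.diff_right blinfun.add_right blinfun_apply_op_scale
        scaleC_diff_left algebra_simps)
qed

text \<open>The second resolvent identity: apply \<open>R\<close> to (A + X - z) (S y) = y + (X - Y)
  (S y).\<close>

lemma resolvent_graph_plus_diff:
  fixes A :: "('a::complex_hilbert_space \<times> 'a) set"
  assumes R: "is_resolvent (graph_plus A X) z R" and S: "is_resolvent (graph_plus A Y) z S"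
  shows "R - S = R o\<^sub>L (Y - X) o\<^sub>L S"
proof (rule blinfun_eqI)
  fix y
  obtain u where u: "(S y, u) \<in> A" "y + scaleC z (S y) = u + Y (S y)"
    using resolvent_range [OF S, of y] by (auto simp: graph_plus_def)
  then have "(S y, u + X (S y)) \<in> graph_plus A X"
    by (auto simp: graph_plus_def)
  from resolvent_left_inverse [OF R this]
  have "R (y - Y (S y) + X (S y)) = S y"
    using u(2) by (metis (no_types, lifting) add.commute add_diff_cancel_left' add_diff_eq diff_diff_eq2)
  then show "(R - S) y = (R o\<^sub>L (Y - X) o\<^sub>L S) y"
    by (simp add: blinfun.diff_left blinfun.diff_right blinfun.add_right algebra_simps)
qed

section \<open>Resolvent norm and distance to the spectrum for self-adjoint operators\<close>

lemma self_adjoint_symmetric: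
  assumes "self_adjoint A" "(x, u) \<in> A" "(y, v) \<in> A"
  shows "cinner u y = cinner x v"
proof -
  have "(y, v) \<in> graph_adjoint A"
    using assms by (simp add: self_adjoint_def)
  then show ?thesis
    using assms(2) by (auto simp: graph_adjoint_def)
qed

text \<open>Symmetry of A on the graph points over \<open>R y\<close> and \<open>R z\<close>; the
  two terms with the real factor \<open>t\<close> cancel.\<close>

lemma resolvent_symmetric:
  assumes A: "self_adjoint A" and R: "is_resolvent A (complex_of_real t) R"
  shows "cinner (R y) z = cinner y (R z)"
proof -
  have "cinner (y + scaleC t (R y)) (R z) = cinner (R y) (z + scaleC t (R z))"
    by (rule self_adjoint_symmetric [OF A resolvent_range [OF R] resolvent_range [OF R]])
  then show ?thesis
    by (simp add: cinner_add_left cinner_add_right cinner_scaleC_left cinner_scaleC_right)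
qed

text \<open>The cross term of the expanded square is a multiple of Im (cinner x y).\<close>

lemma norm_power2_diff_scaleC_ii:
  assumes "Im (cinner x y) = 0"
  shows "(norm (x - scaleC (complex_of_real t * \<i>) y))\<^sup>2 = (norm x)\<^sup>2 + t\<^sup>2 * (norm y)\<^sup>2"
proof -
  have eq: "x - scaleC (complex_of_real t * \<i>) y = x + scaleC (- (complex_of_real t * \<i>)) y"
    by (simp add: scaleC_minus_left)
  show ?thesis
    unfolding eq norm_add_power2 using assms
    by (simp add: cinner_scaleC_right norm_scaleC norm_mult power_mult_distrib
      )
qed

text \<open>A bounded self-adjoint operator has c or -c in its spectrum, where c is its norm; for R
  = (A - t)^-1 the corresponding spectral points of A are t + 1/c and t - 1/c. If neither were
  spectral, 1 - R/c and 1 + R/c would be bounded below, hence so would their product 1 - R^2/c^2,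
  and this would push the norm of R below c.\<close>

lemma real_resolvent_bound:
  assumes A: "self_adjoint A" and R: "is_resolvent A (complex_of_real t) R" and "R \<noteq> 0"
  shows "\<exists>s. complex_of_real s \<in> spectrum A \<and> \<bar>s - t\<bar> = 1 / norm R"
proof (rule ccontr)
  assume none: "\<not> ?thesis"
  define c where "c = norm R"
  have c: "c > 0"
    using \<open>R \<noteq> 0\<close> by (simp add: c_def)
  have R_scaleC: "R (scaleC a y) = scaleC a (R y)" for a y
    by (rule bounded_opsD [OF resolvent_in_bounded_ops [OF R]])
  \<comment> \<open>The resolvent at t + e/c maps y - (e/c) R y to R y, so that vector controls R y
    and therefore y itself.\<close>
  have bounded_below: "\<exists>K\<ge>0. \<forall>y. norm y \<le> K * norm (y - (e / c) *\<^sub>R R y)" if e: "\<bar>e\<bar> = 1" for e :: real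
  proof -
    have "complex_of_real (t + e / c) \<notin> spectrum A"
    proof
      assume "complex_of_real (t + e / c) \<in> spectrum A"
      moreover have "\<bar>t + e / c - t\<bar> = 1 / norm R"
        using e c by (simp add: c_def abs_divide)
      ultimately show False
        using none by blast
    qed
    then obtain S where S: "is_resolvent A (complex_of_real (t + e / c)) S"
      using not_in_spectrumD by blast
    have "norm y \<le> (1 + norm S / c) * norm (y - (e / c) *\<^sub>R R y)" for y
    proof -
      let ?w = "y - (e / c) *\<^sub>R R y"
      have "S ?w = R y"
        using resolvent_left_inverse [OF S resolvent_range [OF R, of y]]
        by (simp add: scaleR_eq_scaleC scaleC_add_left algebra_simps)
      then have "norm (R y) \<le> norm S * norm ?w"
        using norm_blinfun [of S ?w] by simp
      have "norm y \<le> norm ?w + norm ((e / c) *\<^sub>R R y)"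
        using norm_triangle_ineq [of ?w "(e / c) *\<^sub>R R y"] by simp
      also have "norm ((e / c) *\<^sub>R R y) = norm (R y) / c"
        using e c by simp
      also have "norm (R y) / c \<le> norm S * norm ?w / c"
        using \<open>norm (R y) \<le> _\<close> c by (intro divide_right_mono) auto
      finally show ?thesis
        by (simp add: algebra_simps)
    qed
    moreover have "1 + norm S / c \<ge> 0"
      using c by simp
    ultimately show ?thesis by blast
  qed
  obtain K1 where K1: "K1 \<ge> 0" "\<And>y. norm y \<le> K1 * norm (y - (1 / c) *\<^sub>R R y)"
    using bounded_below [of 1] by auto
  obtain K2 where K2: "K2 \<ge> 0" "\<And>y. norm y \<le> K2 * norm (y - (-1 / c) *\<^sub>R R y)"
    using bounded_below [of "-1"] by auto
  \<comment> \<open>The added 1 makes K positive, for the division by its square in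
    \<kappa>.\<close>
  define K where "K = K1 * K2 + 1"
  have K: "K > 0"
    using K1(1) K2(1) by (simp add: K_def add_nonneg_pos)
  have below: "norm y \<le> K * norm (y - (1 / c\<^sup>2) *\<^sub>R R (R y))" for y
  proof -
    let ?w = "y - (-1 / c) *\<^sub>R R y"
    have "norm y \<le> K2 * norm ?w"
      by (rule K2(2))
    also have "\<dots> \<le> K2 * (K1 * norm (?w - (1 / c) *\<^sub>R R ?w))"
      using K2(1) K1(2) by (intro mult_left_mono) auto
    also have "?w - (1 / c) *\<^sub>R R ?w = y - (1 / c\<^sup>2) *\<^sub>R R (R y)"
      by (simp add: blinfun.diff_right blinfun.scaleR_right blinfun.minus_right blinfun.add_right algebra_simps power2_eq_square)
    finally have "norm y \<le> K1 * K2 * norm (y - (1 / c\<^sup>2) *\<^sub>R R (R y))"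
      by (simp add: mult_ac)
    also have "\<dots> \<le> K * norm (y - (1 / c\<^sup>2) *\<^sub>R R (R y))"
      by (intro mult_right_mono) (auto simp: K_def)
    finally show ?thesis .
  qed
  \<comment> \<open>By symmetry of R the cross term is -2 |R y|^2 / c^2. Since |R (R y)| \<le> c |R
    y|, the last square restores at most half of it.\<close>
  have sq: "(norm (y - (1 / c\<^sup>2) *\<^sub>R R (R y)))\<^sup>2 \<le> (norm y)\<^sup>2 - (norm (R y))\<^sup>2 / c\<^sup>2" for y
  proof -
    have *: "Re (cinner y (R (R y))) = (norm (R y))\<^sup>2"
      by (simp add: resolvent_symmetric [OF A R, symmetric] cinner_self)
    have eq: "y - (1 / c\<^sup>2) *\<^sub>R R (R y) = y + scaleC (complex_of_real (- (1 / c\<^sup>2))) (R (R y))"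
      by (simp add: scaleC_minus_left scaleR_eq_scaleC)
    have "(norm (y - (1 / c\<^sup>2) *\<^sub>R R (R y)))\<^sup>2
        = (norm y)\<^sup>2 + (norm (R (R y)) / c\<^sup>2)\<^sup>2 - 2 * ((norm (R y))\<^sup>2 / c\<^sup>2)"
      unfolding eq norm_add_power2 cinner_scaleC_right norm_scaleC
      by (simp add: * norm_divide norm_power)
    also have "norm (R (R y)) / c\<^sup>2 \<le> norm (R y) / c"
      using norm_blinfun [of R "R y"] c by (simp add: c_def power2_eq_square field_simps)
    then have "(norm (R (R y)) / c\<^sup>2)\<^sup>2 \<le> (norm (R y) / c)\<^sup>2"
      by (intro power_mono) auto
    finally show ?thesis
      by (simp add: power_divide)
  qed
  \<comment> \<open>\<open>below\<close> and \<open>sq\<close> give |y|^2 \<le> K^2 (|y|^2 - |R y|^2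
    / c^2); \<kappa> comes from solving this for |R y|^2.\<close>
  define \<kappa> where "\<kappa> = c\<^sup>2 * (1 - 1 / K\<^sup>2)"
  have R_bound: "(norm (R y))\<^sup>2 \<le> \<kappa> * (norm y)\<^sup>2" for y
  proof -
    have "(norm y)\<^sup>2 \<le> (K * norm (y - (1 / c\<^sup>2) *\<^sub>R R (R y)))\<^sup>2"
      using below by (intro power_mono) auto
    also have "\<dots> \<le> K\<^sup>2 * ((norm y)\<^sup>2 - (norm (R y))\<^sup>2 / c\<^sup>2)"
      unfolding power_mult_distrib by (intro mult_left_mono sq) auto
    finally show ?thesis
      using c K by (simp add: \<kappa>_def field_simps)
  qed
  have "\<kappa> < c\<^sup>2"
    using c K by (simp add: \<kappa>_def)
  obtain y where y: "norm (R y) \<noteq> 0"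
    using \<open>R \<noteq> 0\<close> by (metis blinfun_eqI norm_eq_zero zero_blinfun.rep_eq)
  then have "0 < \<kappa> * (norm y)\<^sup>2"
    using R_bound [of y] by (smt (verit) zero_less_power2)
  then have "\<kappa> \<ge> 0"
    by (simp add: zero_less_mult_iff)
  have "norm R \<le> sqrt \<kappa>"
  proof (rule norm_blinfun_bound)
    show "norm (R y) \<le> sqrt \<kappa> * norm y" for y
      using real_sqrt_le_mono [OF R_bound [of y]] by (simp add: real_sqrt_mult)
  qed (simp add: \<open>\<kappa> \<ge> 0\<close>)
  then have "c\<^sup>2 \<le> (sqrt \<kappa>)\<^sup>2"
    unfolding c_def by (intro power_mono) auto
  then show False
    using \<open>\<kappa> < c\<^sup>2\<close> \<open>\<kappa> \<ge> 0\<close> by simp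
qed

text \<open>Off the real axis the bound follows from the one at \<open>x = Re z\<close> and the identity
  \<open>\<parallel>(A - z)u\<parallel>\<^sup>2 = \<parallel>(A - x)u\<parallel>\<^sup>2 + (Im z)\<^sup>2 \<parallel>u\<parallel>\<^sup>2\<close>, so that no functional calculus is needed.\<close>

lemma self_adjoint_resolvent_norm_le:
  assumes A: "self_adjoint A" and R: "is_resolvent A z R" and "d \<ge> 0"
    and d: "\<And>s. s \<in> spectrum A \<Longrightarrow> d \<le> dist s z"
  shows "norm R * d \<le> 1"
proof -
  define t where "t = Re z"
  have sq: "(norm (u - scaleC z x))\<^sup>2 = (norm (u - t *\<^sub>R x))\<^sup>2 + (Im z)\<^sup>2 * (norm x)\<^sup>2"
    if xu: "(x, u) \<in> A" for x u
  proof -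
    have "cnj (cinner u x) = cinner u x"
      using self_adjoint_symmetric [OF A xu xu] cinner_commute by metis
    then have "Im (cinner (u - t *\<^sub>R x) x) = 0"
      by (simp add: cinner_diff_left scaleR_eq_scaleC cinner_scaleC_left cinner_self complex_eq_iff)
    from norm_power2_diff_scaleC_ii [OF this, of "Im z"] show ?thesis
      by (simp add: t_def scaleR_eq_scaleC flip: diff_diff_eq scaleC_add_left)
         (metis complex_eq mult.commute diff_diff_eq scaleC_add_left)
  qed
  have main: "(d * norm x)\<^sup>2 \<le> (norm (u - scaleC z x))\<^sup>2" if xu: "(x, u) \<in> A" for x u
  proof (cases "complex_of_real t \<in> spectrum A")
    case True
    \<comment> \<open>Here Re z is itself a spectral point, and the second term of \<open>sq\<close>
      alone suffices.\<close>
    then have "d \<le> \<bar>Im z\<bar>"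
      using d [of "complex_of_real t"] by (simp add: t_def dist_norm cmod_def)
    then have "(d * norm x)\<^sup>2 \<le> (\<bar>Im z\<bar> * norm x)\<^sup>2"
      using \<open>d \<ge> 0\<close> by (intro power_mono mult_right_mono) auto
    then show ?thesis
      unfolding sq [OF xu] by (simp add: power_mult_distrib add_increasing)
  next
    case False
    then obtain S where S: "is_resolvent A (complex_of_real t) S"
      using not_in_spectrumD by blast
    have Sx: "S (u - t *\<^sub>R x) = x"
      using resolvent_left_inverse [OF S xu] by (simp add: scaleR_eq_scaleC)
    show ?thesis
    proof (cases "S = 0")
      case True
      then show ?thesis using Sx by simp
    next
      case False
      \<comment> \<open>With s from the preceding lemma, d^2 \<le> (s - t)^2 + (Im z)^2 = 1 / |S|^2
        + (Im z)^2, while |x| / |S| is at most |(A - t) x|. This is \<open>sq\<close> term by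
        term.\<close>
      obtain s where s: "complex_of_real s \<in> spectrum A" "\<bar>s - t\<bar> = 1 / norm S"
        using real_resolvent_bound [OF A S False] by blast
      have "d\<^sup>2 \<le> (dist (complex_of_real s) z)\<^sup>2"
        using d [OF s(1)] \<open>d \<ge> 0\<close> by (intro power_mono) auto
      also have "\<dots> = (s - t)\<^sup>2 + (Im z)\<^sup>2"
        by (simp add: dist_norm cmod_power2 t_def)
      also have "(s - t)\<^sup>2 = (1 / norm S)\<^sup>2"
        by (metis s(2) power2_abs)
      finally have "d\<^sup>2 * (norm x)\<^sup>2 \<le> ((1 / norm S)\<^sup>2 + (Im z)\<^sup>2) * (norm x)\<^sup>2"
        by (intro mult_right_mono) auto
      moreover have "norm x / norm S \<le> norm (u - t *\<^sub>R x)"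
        using norm_blinfun [of S "u - t *\<^sub>R x"] False by (simp add: Sx field_simps)
      then have "(norm x / norm S)\<^sup>2 \<le> (norm (u - t *\<^sub>R x))\<^sup>2"
        by (intro power_mono) auto
      ultimately show ?thesis
        unfolding sq [OF xu] by (simp add: power_mult_distrib power_divide distrib_right)
    qed
  qed
  have bound: "d * norm (R y) \<le> norm y" for y
    using main [OF resolvent_range [OF R, of y]] by (simp add: abs_le_square_iff [symmetric] abs_mult \<open>d \<ge> 0\<close>)
  show ?thesis
  proof (cases "d = 0")
    case False
    with \<open>d \<ge> 0\<close> have "d > 0" by simp
    then have "norm R \<le> 1 / d"
      using bound by (intro norm_blinfun_bound) (auto simp: field_simps)
    then show ?thesis
      using \<open>d > 0\<close> by (simp add: field_simps)
  qed simp
qed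

section \<open>Suprema over monotone subdivisions\<close>

text \<open>Both \<open>arc_length\<close> and \<open>arc_integral\<close> are instances.\<close>

definition partition_sup :: "(real \<Rightarrow> real \<Rightarrow> ennreal) \<Rightarrow> real set \<Rightarrow> ennreal"
  where "partition_sup f S =
    (SUP (n, t) \<in> {(n, t). mono_on {..n} t \<and> t ` {..n} \<subseteq> S}. \<Sum>i<n. f (t i) (t (Suc i)))"

lemma arc_length_eq_partition_sup:
  "arc_length g = partition_sup (\<lambda>u v. ennreal (cmod (g v - g u)))"
  by (simp add: arc_length_def partition_sup_def fun_eq_iff)

lemma arc_integral_eq_partition_sup:
  "arc_integral \<phi> g =
    partition_sup (\<lambda>u v. (INF s \<in> {u..v}. \<phi> (g s)) * arc_length g {u..v}) {0<..<1}"
  by (simp add: arc_integral_def partition_sup_def)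

lemma sum_le_partition_sup:
  assumes "mono_on {..n} t" "t ` {..n} \<subseteq> S"
  shows "(\<Sum>i<n. f (t i) (t (Suc i))) \<le> partition_sup f S"
  unfolding partition_sup_def using assms by (intro SUP_upper2 [of "(n, t)"]) auto

lemma le_partition_sup:
  assumes "u \<le> v" "u \<in> S" "v \<in> S"
  shows "f u v \<le> partition_sup f S"
proof -
  have "mono_on {..1::nat} (\<lambda>i. if i = 0 then u else v)"
    using assms by (auto simp: mono_on_def)
  from sum_le_partition_sup [OF this, of S f] assms show ?thesis
    by auto
qed

lemma partition_sup_mono: "S \<subseteq> T \<Longrightarrow> partition_sup f S \<le> partition_sup f T"
  unfolding partition_sup_def by (intro SUP_subset_mono) auto

lemma sum_lessThan_add: "(\<Sum>i<a + b. h i) = (\<Sum>i<a. h i) + (\<Sum>i<b. h (a + i :: nat) :: 'a::comm_monoid_add)"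
  by (induction b) (auto simp: add.assoc)

text \<open>Superadditivity: two subdivisions are joined end to end, and the bridging interval
  between them only adds a nonnegative term. No property of \<open>f\<close> is involved.\<close>

lemma partition_sup_add_le:
  assumes "A \<noteq> {}" "B \<noteq> {}" "A \<subseteq> C" "B \<subseteq> C" and le: "\<And>a b. a \<in> A \<Longrightarrow> b \<in> B \<Longrightarrow> a \<le> b"
  shows "partition_sup f A + partition_sup f B \<le> partition_sup f C"
proof -
  define I where "I S = {(n::nat, t :: nat \<Rightarrow> real). mono_on {..n} t \<and> t ` {..n} \<subseteq> S}" for S
  define F where "F = (\<lambda>(n::nat, t). \<Sum>i<n. f (t i) (t (Suc i)))"
  have sup: "partition_sup f S = (SUP p\<in>I S. F p)" for S
    by (simp add: partition_sup_def I_def F_def)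
  have ne: "I S \<noteq> {}" if S: "S \<noteq> {}" for S
  proof -
    obtain a where "a \<in> S"
      using S by auto
    then have "(0, \<lambda>_. a) \<in> I S"
      by (auto simp: I_def mono_on_def)
    then show ?thesis by auto
  qed
  have "F p + F q \<le> partition_sup f C" if "p \<in> I A" "q \<in> I B" for p q
  proof -
    obtain m s n t where p: "p = (m, s)" and q: "q = (n, t)"
      by (metis surj_pair)
    have s: "mono_on {..m} s" "s ` {..m} \<subseteq> A" and t: "mono_on {..n} t" "t ` {..n} \<subseteq> B"
      using that by (auto simp: I_def p q)
    \<comment> \<open>\<open>s\<close> has m + 1 points, so \<open>t\<close> starts at index Suc m,
      and interval number m is the bridge from \<open>s m\<close> to \<open>t 0\<close>.\<close>
    define r where "r i = (if i \<le> m then s i else t (i - Suc m))" for i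
    have "mono_on {..Suc m + n} r"
    proof (rule mono_onI)
      fix i j assume "i \<in> {..Suc m + n}" "j \<in> {..Suc m + n}" "i \<le> j"
      moreover have "s i \<le> s j" if "i \<le> j" "j \<le> m"
        using mono_onD [OF s(1)] that by auto
      moreover have "t (i - Suc m) \<le> t (j - Suc m)" if "i \<le> j" "j \<le> Suc m + n"
        using that by (intro mono_onD [OF t(1)]) auto
      moreover have "s i \<le> t (j - Suc m)" if "i \<le> m" "j \<le> Suc m + n"
        using that s t by (intro le) auto
      ultimately show "r i \<le> r j"
        by (auto simp: r_def)
    qed
    moreover have "r ` {..Suc m + n} \<subseteq> C"
    proof -
      have "s ` {..m} \<subseteq> C" "t ` {..n} \<subseteq> C"
        using s t assms by auto
      then show ?thesis
        by (auto simp: r_def image_subset_iff)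
    qed
    ultimately have "(\<Sum>i<Suc m + n. f (r i) (r (Suc i))) \<le> partition_sup f C"
      by (rule sum_le_partition_sup)
    moreover have "(\<Sum>i<Suc m + n. f (r i) (r (Suc i)))
        = (\<Sum>i<m. f (s i) (s (Suc i))) + f (s m) (t 0) + (\<Sum>i<n. f (t i) (t (Suc i)))"
      unfolding sum_lessThan_add by (simp add: r_def)
    moreover have "F p + F q \<le> F p + f (s m) (t 0) + F q"
      by (intro add_right_mono) simp
    ultimately show ?thesis
      by (simp only: F_def p q prod.case)
  qed
  then have "(SUP q\<in>I B. F p + F q) \<le> partition_sup f C" if "p \<in> I A" for p
    using that by (intro SUP_least) auto
  then have "F p + partition_sup f B \<le> partition_sup f C" if "p \<in> I A" for p
    using that unfolding sup [of B] ennreal_SUP_add_right [OF ne [OF \<open>B \<noteq> {}\<close>]] by blast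
  then have "(SUP p\<in>I A. F p + partition_sup f B) \<le> partition_sup f C"
    by (intro SUP_least) auto
  then show ?thesis
    unfolding sup [of A] ennreal_SUP_add_left [OF ne [OF \<open>A \<noteq> {}\<close>]] .
qed

lemma sum_partition_sup_le:
  assumes "mono_on {..n} t"
  shows "(\<Sum>i<n. partition_sup f {t i..t (Suc i)}) \<le> partition_sup f {t 0..t n}"
  using assms
proof (induction n)
  case (Suc n)
  have t: "t 0 \<le> t n" "t n \<le> t (Suc n)"
    using Suc.prems by (auto simp: mono_on_def)
  have "mono_on {..n} t"
    using Suc.prems by (auto simp: mono_on_def)
  then have "(\<Sum>i<Suc n. partition_sup f {t i..t (Suc i)})
      \<le> partition_sup f {t 0..t n} + partition_sup f {t n..t (Suc n)}"
    using Suc.IH by (simp add: add_right_mono)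
  also have "\<dots> \<le> partition_sup f {t 0..t (Suc n)}"
    using t by (intro partition_sup_add_le) auto
  finally show ?case .
qed simp

text \<open>Take a subdivision within e of the supremum and let u, v be its first and last points.
  By superadditivity anything to the left or right of it contributes at most e; finiteness allows
  the cancellation in \<open>ennreal\<close>.\<close>

lemma partition_sup_tails:
  assumes fin: "partition_sup f {a<..<b} < \<infinity>" and "a < b" "e > 0"
  obtains u v where "a < u" "u \<le> v" "v < b"
    "\<And>c d. a < c \<Longrightarrow> c \<le> d \<Longrightarrow> d \<le> u \<Longrightarrow> partition_sup f {c..d} \<le> ennreal e"
    "\<And>c d. v \<le> c \<Longrightarrow> c \<le> d \<Longrightarrow> d < b \<Longrightarrow> partition_sup f {c..d} \<le> ennreal e"
proof -
  define I where "I = {(n::nat, t :: nat \<Rightarrow> real). mono_on {..n} t \<and> t ` {..n} \<subseteq> {a<..<b}}"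
  define F where "F = (\<lambda>(n::nat, t). \<Sum>i<n. f (t i) (t (Suc i)))"
  have sup: "partition_sup f {a<..<b} = (SUP p\<in>I. F p)"
    by (simp add: partition_sup_def I_def F_def)
  have "(0, \<lambda>_. (a + b) / 2) \<in> I"
    using \<open>a < b\<close> by (auto simp: I_def mono_on_def)
  then have ne: "I \<noteq> {}" by auto
  have "\<exists>p\<in>I. partition_sup f {a<..<b} \<le> F p + ennreal e"
  proof (rule ccontr)
    assume "\<not> ?thesis"
    then have "(SUP p\<in>I. F p + ennreal e) \<le> partition_sup f {a<..<b}"
      by (intro SUP_least) (auto simp: not_le)
    then have "partition_sup f {a<..<b} + ennreal e \<le> partition_sup f {a<..<b} + 0"
      using ne by (simp add: sup ennreal_SUP_add_left)
    then have "ennreal e \<le> 0"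
      using fin by (subst (asm) ennreal_add_left_cancel_le) auto
    then show False
      using \<open>e > 0\<close> by (auto simp: ennreal_eq_0_iff)
  qed
  then obtain n t where t: "mono_on {..n} t" "t ` {..n} \<subseteq> {a<..<b}"
    and total: "partition_sup f {a<..<b} \<le> (\<Sum>i<n. f (t i) (t (Suc i))) + ennreal e"
    by (auto simp: I_def F_def)
  have t0n: "a < t 0" "t 0 \<le> t n" "t n < b"
    using t by (auto simp: mono_on_def image_subset_iff)
  define x where "x = partition_sup f {t 0..t n}"
  have "{t 0..t n} \<subseteq> {a<..<b}"
    using t0n by auto
  then have x: "x < \<infinity>"
    using fin partition_sup_mono unfolding x_def by (metis order_le_less_trans)
  have "t ` {..n} \<subseteq> {t 0..t n}"
    using t(1) by (auto simp: mono_on_def)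
  then have "(\<Sum>i<n. f (t i) (t (Suc i))) \<le> x"
    unfolding x_def by (intro sum_le_partition_sup t)
  then have tot: "partition_sup f {a<..<b} \<le> x + ennreal e"
    using total by (meson add_right_mono order_trans)
  show thesis
  proof (rule that [OF t0n])
    fix c d assume cd: "a < c" "c \<le> d" "d \<le> t 0"
    have "partition_sup f {c..d} + x \<le> partition_sup f {a<..<b}"
      unfolding x_def using cd t0n by (intro partition_sup_add_le) auto
    then have "x + partition_sup f {c..d} \<le> x + ennreal e"
      using tot by (metis add.commute order_trans)
    then show "partition_sup f {c..d} \<le> ennreal e"
      using x by (subst (asm) ennreal_add_left_cancel_le) auto
  next
    fix c d assume cd: "t n \<le> c" "c \<le> d" "d < b"
    have "x + partition_sup f {c..d} \<le> partition_sup f {a<..<b}"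
      unfolding x_def using cd t0n by (intro partition_sup_add_le) auto
    then have "x + partition_sup f {c..d} \<le> x + ennreal e"
      using tot by (rule order_trans)
    then show "partition_sup f {c..d} \<le> ennreal e"
      using x by (subst (asm) ennreal_add_left_cancel_le) auto
  qed
qed


section \<open>Riemann--Stieltjes integrals\<close>

definition tagged_mesh ::
    "real \<Rightarrow> real \<Rightarrow> real \<Rightarrow> nat \<Rightarrow> (nat \<Rightarrow> real) \<Rightarrow> (nat \<Rightarrow> real) \<Rightarrow> bool"
  where "tagged_mesh c d \<delta> n t \<tau> \<longleftrightarrow> mono_on {..n} t \<and> t 0 = c \<and> t n = d \<and>
    (\<forall>i<n. t (Suc i) - t i < \<delta> \<and> \<tau> i \<in> {t i..t (Suc i)})"

definition stieltjes_sum ::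
    "(real \<Rightarrow> ('a::complex_hilbert_space \<Rightarrow>\<^sub>L 'b::complex_hilbert_space)) \<Rightarrow> (real \<Rightarrow> complex) \<Rightarrow>
     nat \<Rightarrow> (nat \<Rightarrow> real) \<Rightarrow> (nat \<Rightarrow> real) \<Rightarrow> ('a \<Rightarrow>\<^sub>L 'b)"
  where "stieltjes_sum F g n t \<tau> = (\<Sum>i<n. op_scale (g (t (Suc i)) - g (t i)) (F (\<tau> i)))"

lemma has_stieltjes_integral_iff:
  "has_stieltjes_integral F g c d I \<longleftrightarrow>
    (\<forall>\<epsilon>>0. \<exists>\<delta>>0. \<forall>n t \<tau>. tagged_mesh c d \<delta> n t \<tau> \<longrightarrow> norm (stieltjes_sum F g n t \<tau> - I) < \<epsilon>)"
  unfolding has_stieltjes_integral_def tagged_mesh_def stieltjes_sum_def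
  by (simp only: imp_conjL)

lemma tagged_mesh_exists:
  assumes "c \<le> d" "\<delta> > 0"
  shows "\<exists>n t \<tau>. tagged_mesh c d \<delta> n t \<tau>"
proof -
  obtain n :: nat where n: "(d - c) / \<delta> < real n"
    using reals_Archimedean2 by blast
  moreover have "(d - c) / \<delta> \<ge> 0"
    using assms by simp
  ultimately have "n > 0"
    by (cases n) auto
  define t where "t i = c + real i * ((d - c) / n)" for i
  have step: "t (Suc i) - t i = (d - c) / n" for i
    by (simp add: t_def add_divide_distrib distrib_right)
  have "(d - c) / n < \<delta>"
    using n \<open>n > 0\<close> \<open>\<delta> > 0\<close> by (simp add: field_simps)
  moreover have "mono_on {..n} t"
    unfolding t_def using assms by (intro mono_onI add_left_mono mult_right_mono) auto
  moreover have "t i \<le> t (Suc i)" for i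
    using step [of i] assms by (smt (verit) divide_nonneg_nonneg of_nat_0_le_iff)
  ultimately have "tagged_mesh c d \<delta> n t t"
    using \<open>n > 0\<close> step by (auto simp: tagged_mesh_def) (auto simp: t_def)
  then show ?thesis by blast
qed

lemma tagged_mesh_mono: "tagged_mesh c d \<delta> n t \<tau> \<Longrightarrow> \<delta> \<le> \<delta>' \<Longrightarrow> tagged_mesh c d \<delta>' n t \<tau>"
  unfolding tagged_mesh_def by fastforce

lemma tagged_mesh_point: "tagged_mesh c d \<delta> n t \<tau> \<Longrightarrow> i \<le> n \<Longrightarrow> t i \<in> {c..d}"
  unfolding tagged_mesh_def by (auto simp: mono_on_def)

lemma tagged_mesh_tag:
  assumes "tagged_mesh c d \<delta> n t \<tau>" "i < n"
  shows "\<tau> i \<in> {c..d}"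
proof -
  have "\<tau> i \<in> {t i..t (Suc i)}" "t i \<in> {c..d}" "t (Suc i) \<in> {c..d}"
    using assms tagged_mesh_point [OF assms(1)] by (auto simp: tagged_mesh_def)
  then show ?thesis by auto
qed

lemma sum_cmod_le_arc_length:
  assumes "tagged_mesh c d \<delta> n t \<tau>"
  shows "(\<Sum>i<n. ennreal (cmod (g (t (Suc i)) - g (t i)))) \<le> arc_length g {c..d}"
  unfolding arc_length_eq_partition_sup
  using assms tagged_mesh_point [OF assms] by (intro sum_le_partition_sup) (auto simp: tagged_mesh_def)

text \<open>The sums over two subdivisions are compared through their common refinement, whose cell
  \<open>(i, j)\<close> carries the increment \<open>D i j\<close>; it vanishes unless the \<open>i\<close>-th and the \<open>j\<close>-th interval
  overlap.\<close>

lemma stieltjes_sum_diff_le: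
  assumes P: "tagged_mesh c d \<delta> n t \<tau>" and Q: "tagged_mesh c d \<delta> m s \<sigma>"
    and len: "arc_length g {c..d} \<le> ennreal len" and "len \<ge> 0" "e \<ge> 0"
    and osc: "\<And>u v. u \<in> {c..d} \<Longrightarrow> v \<in> {c..d} \<Longrightarrow> \<bar>u - v\<bar> < 2 * \<delta> \<Longrightarrow> norm (F u - F v) \<le> e"
  shows "norm (stieltjes_sum F g n t \<tau> - stieltjes_sum F g m s \<sigma>) \<le> e * len"
proof -
  \<comment> \<open>The mixed difference of (x, y) \<mapsto> g (min x y) over the cell. It is the
    increment of g over the intersection of the two intervals, and telescopes in both indices
    without case distinctions.\<close>
  define D where "D i j = (g (min (t (Suc i)) (s (Suc j))) - g (min (t i) (s (Suc j))))
    - (g (min (t (Suc i)) (s j)) - g (min (t i) (s j)))" for i j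
  have t: "mono_on {..n} t" "t 0 = c" "t n = d" and s: "mono_on {..m} s" "s 0 = c" "s m = d"
    using P Q by (auto simp: tagged_mesh_def)
  note t_in = tagged_mesh_point [OF P] and s_in = tagged_mesh_point [OF Q]
  have D_row: "g (t (Suc i)) - g (t i) = (\<Sum>j<m. D i j)" if "i < n" for i
  proof -
    have "(\<Sum>j<m. D i j) = (g (min (t (Suc i)) (s m)) - g (min (t i) (s m)))
      - (g (min (t (Suc i)) (s 0)) - g (min (t i) (s 0)))"
      unfolding D_def by (rule sum_lessThan_telescope)
    then show ?thesis
      using t_in [of i] t_in [of "Suc i"] that by (simp add: s)
  qed
  have D_col: "g (s (Suc j)) - g (s j) = (\<Sum>i<n. D i j)" if "j < m" for j
  proof -
    have "(\<Sum>i<n. D i j)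
      = (\<Sum>i<n. (g (min (t (Suc i)) (s (Suc j))) - g (min (t (Suc i)) (s j)))
          - (g (min (t i) (s (Suc j))) - g (min (t i) (s j))))"
      unfolding D_def by (intro sum.cong) (auto simp: algebra_simps)
    also have "\<dots> = (g (min (t n) (s (Suc j))) - g (min (t n) (s j)))
      - (g (min (t 0) (s (Suc j))) - g (min (t 0) (s j)))"
      by (rule sum_lessThan_telescope)
    finally show ?thesis
      using s_in [of j] s_in [of "Suc j"] that by (simp add: t min.absorb1 min.absorb2)
  qed
  have D_zero: "D i j = 0" if "i < n" "j < m" "s (Suc j) \<le> t i \<or> t (Suc i) \<le> s j" for i j
  proof -
    have "t i \<le> t (Suc i)" "s j \<le> s (Suc j)"
      using that t(1) s(1) by (auto simp: mono_on_def)
    with that(3) consider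
        "s j \<le> t i" "s j \<le> t (Suc i)" "s (Suc j) \<le> t i" "s (Suc j) \<le> t (Suc i)"
      | "t i \<le> s j" "t (Suc i) \<le> s j" "t i \<le> s (Suc j)" "t (Suc i) \<le> s (Suc j)"
      by linarith
    then show ?thesis
      by cases (simp_all add: D_def min.absorb1 min.absorb2)
  qed
  \<comment> \<open>For fixed i these are increments of g along the points of \<open>s\<close>
    clamped to the i-th interval, so their moduli sum to at most the arc length there.\<close>
  have D_clamp: "D i j = g (max (t i) (min (t (Suc i)) (s (Suc j)))) - g (max (t i) (min (t (Suc i)) (s j)))"
    if "i < n" for i j
  proof -
    have "t i \<le> t (Suc i)"
      using that t(1) by (auto simp: mono_on_def)
    then have "g (min (t (Suc i)) x) - g (min (t i) x) = g (max (t i) (min (t (Suc i)) x)) - g (t i)" for x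
      by (auto simp: min_def max_def)
    then show ?thesis
      by (simp add: D_def)
  qed
  have "(\<Sum>j<m. ennreal (cmod (D i j))) \<le> arc_length g {t i..t (Suc i)}" if "i < n" for i
  proof -
    have "t i \<le> t (Suc i)"
      using that t(1) by (auto simp: mono_on_def)
    moreover have "mono_on {..m} (\<lambda>j. max (t i) (min (t (Suc i)) (s j)))"
      using s(1) unfolding mono_on_def by (meson max.mono min.mono order_refl)
    ultimately show ?thesis
      unfolding arc_length_eq_partition_sup D_clamp [OF that]
      by (intro sum_le_partition_sup [where t = "\<lambda>j. max (t i) (min (t (Suc i)) (s j))"]) auto
  qed
  then have "(\<Sum>i<n. \<Sum>j<m. ennreal (cmod (D i j))) \<le> (\<Sum>i<n. arc_length g {t i..t (Suc i)})"
    by (intro sum_mono) auto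
  also have "\<dots> \<le> arc_length g {c..d}"
    using sum_partition_sup_le [OF t(1)] unfolding arc_length_eq_partition_sup t(2,3) .
  also have "\<dots> \<le> ennreal len"
    by (rule len)
  finally have D_sum: "(\<Sum>i<n. \<Sum>j<m. cmod (D i j)) \<le> len"
    using \<open>len \<ge> 0\<close> by (simp add: sum_nonneg)
  have term_le: "norm (op_scale (D i j) (F (\<tau> i) - F (\<sigma> j))) \<le> e * cmod (D i j)" if ij: "i < n" "j < m" for i j
  proof (cases "D i j = 0")
    case True
    then show ?thesis
      using norm_op_scale_le [of "D i j" "F (\<tau> i) - F (\<sigma> j)"] by simp
  next
    case False
    \<comment> \<open>Only overlapping intervals remain; both are shorter than \<delta>, so their
      tags are less than 2 \<delta> apart.\<close>
    then have "t i < s (Suc j)" "s j < t (Suc i)"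
      using D_zero [OF ij] by (meson not_le)+
    moreover have "\<tau> i \<in> {t i..t (Suc i)}" "\<sigma> j \<in> {s j..s (Suc j)}"
      "t (Suc i) - t i < \<delta>" "s (Suc j) - s j < \<delta>"
      using P Q ij by (auto simp: tagged_mesh_def)
    ultimately have "\<bar>\<tau> i - \<sigma> j\<bar> < 2 * \<delta>"
      by auto
    then have "norm (F (\<tau> i) - F (\<sigma> j)) \<le> e"
      using ij by (intro osc tagged_mesh_tag [OF P] tagged_mesh_tag [OF Q])
    then have "cmod (D i j) * norm (F (\<tau> i) - F (\<sigma> j)) \<le> cmod (D i j) * e"
      by (intro mult_left_mono) auto
    then show ?thesis
      using norm_op_scale_le [of "D i j" "F (\<tau> i) - F (\<sigma> j)"] by (simp add: mult.commute)
  qed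
  have "stieltjes_sum F g n t \<tau> = (\<Sum>i<n. \<Sum>j<m. op_scale (D i j) (F (\<tau> i)))"
    unfolding stieltjes_sum_def by (intro sum.cong) (auto simp: D_row op_scale_sum_left)
  moreover have "stieltjes_sum F g m s \<sigma> = (\<Sum>j<m. \<Sum>i<n. op_scale (D i j) (F (\<sigma> j)))"
    unfolding stieltjes_sum_def by (intro sum.cong) (auto simp: D_col op_scale_sum_left)
  ultimately have "stieltjes_sum F g n t \<tau> - stieltjes_sum F g m s \<sigma>
      = (\<Sum>i<n. \<Sum>j<m. op_scale (D i j) (F (\<tau> i) - F (\<sigma> j)))"
    by (simp add: sum.swap [of _ "{..<m}"] op_scale_diff_right sum_subtractf)
  also have "norm \<dots> \<le> (\<Sum>i<n. \<Sum>j<m. e * cmod (D i j))"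
    by (intro sum_norm_le order_trans [OF norm_sum] sum_mono term_le) auto
  also have "\<dots> = e * (\<Sum>i<n. \<Sum>j<m. cmod (D i j))"
    by (simp add: sum_distrib_left)
  also have "\<dots> \<le> e * len"
    using D_sum \<open>e \<ge> 0\<close> by (rule mult_left_mono)
  finally show ?thesis .
qed

text \<open>The comparison of two sums, with uniform continuity of F on the compact interval, is a
  Cauchy criterion; the limit is taken along meshes of size 1 / (k + 1).\<close>

lemma stieltjes_integral_exists:
  assumes "c \<le> d" and F: "continuous_on {c..d} F" and fin: "arc_length g {c..d} < \<infinity>"
  shows "\<exists>I. has_stieltjes_integral F g c d I"
proof -
  define len where "len = enn2real (arc_length g {c..d})"
  have len: "arc_length g {c..d} \<le> ennreal len" "len \<ge> 0"
    using fin by (auto simp: len_def)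
  have cauchy: "\<exists>\<delta>>0. \<forall>n t \<tau> m s \<sigma>. tagged_mesh c d \<delta> n t \<tau> \<longrightarrow> tagged_mesh c d \<delta> m s \<sigma> \<longrightarrow>
      norm (stieltjes_sum F g n t \<tau> - stieltjes_sum F g m s \<sigma>) < e" if "e > 0" for e
  proof -
    define e' where "e' = e / (len + 1)"
    have e': "e' > 0" "e' * len < e"
      using \<open>e > 0\<close> len by (auto simp: e'_def field_simps)
    have "uniformly_continuous_on {c..d} F"
      using F by (intro compact_uniformly_continuous) auto
    then obtain \<eta> where \<eta>: "\<eta> > 0"
      "\<And>u v. u \<in> {c..d} \<Longrightarrow> v \<in> {c..d} \<Longrightarrow> dist u v < \<eta> \<Longrightarrow> dist (F u) (F v) < e'"
      using e' unfolding uniformly_continuous_on_def by metis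
    \<comment> \<open>Meshes of size \<eta> / 2, because the comparison needs the oscillation of F
      at distance twice the mesh.\<close>
    show ?thesis
    proof (intro exI [of _ "\<eta> / 2"] conjI allI impI)
      fix n t \<tau> m s \<sigma> assume "tagged_mesh c d (\<eta> / 2) n t \<tau>" "tagged_mesh c d (\<eta> / 2) m s \<sigma>"
      then have "norm (stieltjes_sum F g n t \<tau> - stieltjes_sum F g m s \<sigma>) \<le> e' * len"
        using len less_imp_le [OF e'(1)]
        by (rule stieltjes_sum_diff_le) (use \<eta>(2) in \<open>auto simp: dist_norm intro: less_imp_le\<close>)
      then show "norm (stieltjes_sum F g n t \<tau> - stieltjes_sum F g m s \<sigma>) < e"
        using e' by simp
    qed (use \<eta> in auto)
  qed
  have "\<exists>n t \<tau>. tagged_mesh c d (inverse (real (Suc k))) n t \<tau>" for k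
    by (intro tagged_mesh_exists \<open>c \<le> d\<close>) auto
  then obtain N T \<tau> where mesh: "\<And>k. tagged_mesh c d (inverse (real (Suc k))) (N k) (T k) (\<tau> k)"
    by metis
  define S where "S k = stieltjes_sum F g (N k) (T k) (\<tau> k)" for k
  have fine: "\<exists>k0. \<forall>k\<ge>k0. tagged_mesh c d \<delta> (N k) (T k) (\<tau> k)" if "\<delta> > 0" for \<delta>
  proof -
    obtain k0 where k0: "inverse (real (Suc k0)) < \<delta>"
      using reals_Archimedean \<open>\<delta> > 0\<close> by blast
    have "inverse (real (Suc k)) \<le> \<delta>" if "k \<ge> k0" for k
    proof -
      have "inverse (real (Suc k)) \<le> inverse (real (Suc k0))"
        using that by (intro le_imp_inverse_le) auto
      then show ?thesis using k0 by linarith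
    qed
    then show ?thesis
      using mesh tagged_mesh_mono by blast
  qed
  have "Cauchy S"
    unfolding Cauchy_def
  proof (intro allI impI)
    fix e :: real assume "e > 0"
    then obtain \<delta> where \<delta>: "\<delta> > 0" "\<And>n t \<tau> m s \<sigma>. tagged_mesh c d \<delta> n t \<tau> \<Longrightarrow> tagged_mesh c d \<delta> m s \<sigma> \<Longrightarrow>
      norm (stieltjes_sum F g n t \<tau> - stieltjes_sum F g m s \<sigma>) < e"
      using cauchy by metis
    obtain k0 where "\<forall>k\<ge>k0. tagged_mesh c d \<delta> (N k) (T k) (\<tau> k)"
      using fine \<delta>(1) by blast
    then show "\<exists>M. \<forall>m\<ge>M. \<forall>n\<ge>M. dist (S m) (S n) < e"
      using \<delta>(2) unfolding S_def dist_norm by blast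
  qed
  then obtain I where I: "S \<longlonglongrightarrow> I"
    by (meson Cauchy_convergent_iff convergent_def)
  have "has_stieltjes_integral F g c d I"
    unfolding has_stieltjes_integral_iff
  proof (intro allI impI)
    fix e :: real assume "e > 0"
    then obtain \<delta> where \<delta>: "\<delta> > 0" "\<And>n t \<tau> m s \<sigma>. tagged_mesh c d \<delta> n t \<tau> \<Longrightarrow> tagged_mesh c d \<delta> m s \<sigma> \<Longrightarrow>
      norm (stieltjes_sum F g n t \<tau> - stieltjes_sum F g m s \<sigma>) < e / 2"
      using cauchy [of "e / 2"] by (metis half_gt_zero)
    obtain k0 where k0: "\<forall>k\<ge>k0. tagged_mesh c d \<delta> (N k) (T k) (\<tau> k)"
      using fine \<delta>(1) by blast
    obtain k1 where k1: "\<forall>k\<ge>k1. norm (S k - I) < e / 2"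
      using LIMSEQ_D [OF I, of "e / 2"] \<open>e > 0\<close> by auto
    define k where "k = max k0 k1"
    have "norm (stieltjes_sum F g n t \<tau>' - I) < e" if "tagged_mesh c d \<delta> n t \<tau>'" for n t \<tau>'
    proof -
      have "norm (stieltjes_sum F g n t \<tau>' - S k) < e / 2"
        unfolding S_def using that k0 by (intro \<delta>(2)) (auto simp: k_def)
      moreover have "norm (S k - I) < e / 2"
        using k1 by (auto simp: k_def)
      ultimately show ?thesis
        using norm_triangle_ineq [of "stieltjes_sum F g n t \<tau>' - S k" "S k - I"] by simp
    qed
    then show "\<exists>\<delta>>0. \<forall>n t \<tau>. tagged_mesh c d \<delta> n t \<tau> \<longrightarrow> norm (stieltjes_sum F g n t \<tau> - I) < e"
      using \<delta>(1) by blast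
  qed
  then show ?thesis by blast
qed

lemma has_stieltjes_integral_zero: "has_stieltjes_integral (\<lambda>_. 0) g c d 0"
  unfolding has_stieltjes_integral_iff stieltjes_sum_def by (auto intro: exI [of _ 1])

lemma has_stieltjes_integral_in_bounded_ops:
  assumes I: "has_stieltjes_integral F g c d I" and "c \<le> d"
    and F: "\<And>u. u \<in> {c..d} \<Longrightarrow> F u \<in> bounded_ops"
  shows "I \<in> bounded_ops"
proof -
  have "I \<in> closure bounded_ops"
    unfolding closure_approachable
  proof (intro allI impI)
    fix e :: real assume "e > 0"
    then obtain \<delta> where \<delta>: "\<delta> > 0"
        "\<And>n t \<tau>. tagged_mesh c d \<delta> n t \<tau> \<Longrightarrow> norm (stieltjes_sum F g n t \<tau> - I) < e"
      using I unfolding has_stieltjes_integral_iff by metis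
    obtain n t \<tau> where P: "tagged_mesh c d \<delta> n t \<tau>"
      using tagged_mesh_exists [OF \<open>c \<le> d\<close> \<delta>(1)] by blast
    have "stieltjes_sum F g n t \<tau> \<in> bounded_ops"
      unfolding stieltjes_sum_def
      by (intro sum_in_bounded_ops op_scale_in_bounded_ops F) (use tagged_mesh_tag [OF P] in auto)
    then show "\<exists>y\<in>bounded_ops. dist y I < e"
      using \<delta>(2) [OF P] by (auto simp: dist_norm)
  qed
  then show ?thesis
    by (simp add: closed_bounded_ops)
qed

text \<open>Fine meshes of the two halves concatenate to a fine mesh of the whole, and the sums
  add.\<close>

lemma has_stieltjes_integral_combine:
  assumes I: "has_stieltjes_integral F g c d I" and J: "has_stieltjes_integral F g d e J"
    and K: "has_stieltjes_integral F g c e K" and "c \<le> d" "d \<le> e"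
  shows "K = I + J"
proof -
  have "norm (K - (I + J)) \<le> 0"
  proof (rule field_le_epsilon)
    fix \<epsilon> :: real assume "\<epsilon> > 0"
    then have "\<epsilon> / 3 > 0" by simp
    with I J K obtain \<delta>1 \<delta>2 \<delta>3 where
      \<delta>: "\<delta>1 > 0" "\<And>n t \<tau>. tagged_mesh c d \<delta>1 n t \<tau> \<Longrightarrow> norm (stieltjes_sum F g n t \<tau> - I) < \<epsilon> / 3"
      "\<delta>2 > 0" "\<And>n t \<tau>. tagged_mesh d e \<delta>2 n t \<tau> \<Longrightarrow> norm (stieltjes_sum F g n t \<tau> - J) < \<epsilon> / 3"
      "\<delta>3 > 0" "\<And>n t \<tau>. tagged_mesh c e \<delta>3 n t \<tau> \<Longrightarrow> norm (stieltjes_sum F g n t \<tau> - K) < \<epsilon> / 3"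
      unfolding has_stieltjes_integral_iff by metis
    define \<delta> where "\<delta> = min \<delta>1 (min \<delta>2 \<delta>3)"
    have "\<delta> > 0"
      using \<delta> by (simp add: \<delta>_def)
    obtain n t \<tau> where P: "tagged_mesh c d \<delta> n t \<tau>"
      using tagged_mesh_exists [OF \<open>c \<le> d\<close> \<open>\<delta> > 0\<close>] by blast
    obtain m s \<sigma> where Q: "tagged_mesh d e \<delta> m s \<sigma>"
      using tagged_mesh_exists [OF \<open>d \<le> e\<close> \<open>\<delta> > 0\<close>] by blast
    \<comment> \<open>Here the meshes share the point t n = s 0 = d at index n, so no extra interval
      is inserted.\<close>
    define r where "r i = (if i \<le> n then t i else s (i - n))" for i
    define \<rho> where "\<rho> i = (if i < n then \<tau> i else \<sigma> (i - n))" for i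
    have t: "mono_on {..n} t" "t n = d" "t 0 = c" and s: "mono_on {..m} s" "s 0 = d" "s m = e"
      using P Q by (auto simp: tagged_mesh_def)
    have r_right: "r (n + i) = s i" for i
      by (auto simp: r_def t s)
    have r_left: "r i = t i" if "i \<le> n" for i
      using that by (simp add: r_def)
    have "mono_on {..n + m} r"
    proof (rule mono_onI)
      fix i j assume ij: "i \<in> {..n + m}" "j \<in> {..n + m}" "i \<le> j"
      consider "j \<le> n" | i' j' where "i = n + i'" "j = n + j'" | j' where "i \<le> n" "j = n + j'"
        using ij by (metis le_Suc_ex nat_le_linear)
      then show "r i \<le> r j"
      proof cases
        case 1
        then show ?thesis using ij t by (auto simp: r_left mono_on_def)
      next
        case 2
        then show ?thesis using ij s by (auto simp: r_right mono_on_def)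
      next
        case 3
        then have "r i \<le> d" "d \<le> r j"
          using ij tagged_mesh_point [OF P, of i] tagged_mesh_point [OF Q, of j'] by (auto simp: r_left r_right)
        then show ?thesis by simp
      qed
    qed
    moreover have "r 0 = c"
      using r_left [of 0] t by simp
    moreover have "r (n + m) = e"
      using r_right [of m] s by simp
    moreover have "r (Suc i) - r i < \<delta> \<and> \<rho> i \<in> {r i..r (Suc i)}" if "i < n + m" for i
    proof (cases "i < n")
      case True
      then show ?thesis
        using P by (auto simp: r_left \<rho>_def tagged_mesh_def)
    next
      case False
      then obtain j where j: "i = n + j"
        by (metis le_Suc_ex not_less)
      then show ?thesis
        using Q that r_right [of "Suc j"] by (auto simp: r_right \<rho>_def tagged_mesh_def)
    qed
    ultimately have R: "tagged_mesh c e \<delta> (n + m) r \<rho>"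
      by (simp add: tagged_mesh_def)
    have "stieltjes_sum F g (n + m) r \<rho> = stieltjes_sum F g n t \<tau> + stieltjes_sum F g m s \<sigma>"
      unfolding stieltjes_sum_def sum_lessThan_add
      using r_right [of "Suc _"] by (simp add: r_left r_right \<rho>_def)
    moreover have "norm (stieltjes_sum F g n t \<tau> - I) < \<epsilon> / 3"
      by (rule \<delta>(2) [OF tagged_mesh_mono [OF P]]) (simp add: \<delta>_def)
    moreover have "norm (stieltjes_sum F g m s \<sigma> - J) < \<epsilon> / 3"
      by (rule \<delta>(4) [OF tagged_mesh_mono [OF Q]]) (simp add: \<delta>_def)
    moreover have "norm (stieltjes_sum F g (n + m) r \<rho> - K) < \<epsilon> / 3"
      by (rule \<delta>(6) [OF tagged_mesh_mono [OF R]]) (simp add: \<delta>_def)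
    moreover have "norm (K - (I + J)) \<le> norm (x - I) + norm (y - J) + norm (x + y - K)" for x y
    proof -
      have "K - (I + J) = (x - I) + (y - J) - (x + y - K)"
        by simp
      also have "norm \<dots> \<le> norm (x - I) + norm (y - J) + norm (x + y - K)"
        by (meson add_right_mono norm_triangle_ineq norm_triangle_ineq4 order_trans)
      finally show ?thesis .
    qed
    then have "norm (K - (I + J)) \<le> norm (stieltjes_sum F g n t \<tau> - I) + norm (stieltjes_sum F g m s \<sigma> - J)
        + norm (stieltjes_sum F g n t \<tau> + stieltjes_sum F g m s \<sigma> - K)"
      .
    ultimately show "norm (K - (I + J)) \<le> 0 + \<epsilon>"
      by simp
  qed
  then show ?thesis by simp
qed

text \<open>Since \<open>G\<close> is uniformly continuous, the Riemann sums of \<open>\<integral> |dg| \<parallel>G\<parallel>\<close> exceed the lower Darboux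
  sums by arbitrarily little.\<close>

lemma stieltjes_integral_diff_le:
  fixes S T :: "real \<Rightarrow> ('a::complex_hilbert_space \<Rightarrow>\<^sub>L 'b::complex_hilbert_space)"
    and G :: "real \<Rightarrow> ('b \<Rightarrow>\<^sub>L 'c::complex_hilbert_space)"
  assumes I: "has_stieltjes_integral (\<lambda>u. G u o\<^sub>L S u) g c d I"
    and J: "has_stieltjes_integral (\<lambda>u. G u o\<^sub>L T u) g c d J"
    and "c \<le> d" and G: "continuous_on {c..d} G" and fin: "arc_length g {c..d} < \<infinity>"
    and \<phi>: "\<And>u. u \<in> {c..d} \<Longrightarrow> \<phi> (g u) = ennreal (norm (G u))"
    and L: "partition_sup (\<lambda>u v. (INF s \<in> {u..v}. \<phi> (g s)) * arc_length g {u..v}) {c..d} \<le> ennreal L"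
    and "L \<ge> 0" and ST: "\<And>u. u \<in> {c..d} \<Longrightarrow> norm (S u - T u) \<le> K" and "K \<ge> 0"
  shows "norm (I - J) \<le> K * L"
proof -
  define len where "len = enn2real (arc_length g {c..d})"
  have len: "arc_length g {c..d} \<le> ennreal len" "len \<ge> 0"
    using fin by (auto simp: len_def)
  define f where "f u v = (INF s \<in> {u..v}. \<phi> (g s)) * arc_length g {u..v}" for u v
  \<comment> \<open>The 2 counts the two Riemann sum errors; K len \<eta> is the price of replacing
    the tag value of norm G by its infimum over each cell.\<close>
  have main: "norm (I - J) \<le> K * L + (2 + K * len) * \<eta>" if "\<eta> > 0" for \<eta>
  proof -
    have "uniformly_continuous_on {c..d} G"
      using G by (intro compact_uniformly_continuous) auto
    then obtain \<delta>0 where \<delta>0: "\<delta>0 > 0"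
      "\<And>u v. u \<in> {c..d} \<Longrightarrow> v \<in> {c..d} \<Longrightarrow> dist u v < \<delta>0 \<Longrightarrow> dist (G u) (G v) < \<eta>"
      using \<open>\<eta> > 0\<close> unfolding uniformly_continuous_on_def by metis
    obtain \<delta>1 where \<delta>1: "\<delta>1 > 0" "\<And>n t \<tau>. tagged_mesh c d \<delta>1 n t \<tau> \<Longrightarrow>
        norm (stieltjes_sum (\<lambda>u. G u o\<^sub>L S u) g n t \<tau> - I) < \<eta>"
      using I \<open>\<eta> > 0\<close> unfolding has_stieltjes_integral_iff by metis
    obtain \<delta>2 where \<delta>2: "\<delta>2 > 0" "\<And>n t \<tau>. tagged_mesh c d \<delta>2 n t \<tau> \<Longrightarrow>
        norm (stieltjes_sum (\<lambda>u. G u o\<^sub>L T u) g n t \<tau> - J) < \<eta>"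
      using J \<open>\<eta> > 0\<close> unfolding has_stieltjes_integral_iff by metis
    define \<delta> where "\<delta> = min \<delta>0 (min \<delta>1 \<delta>2)"
    have \<delta>: "\<delta> > 0" "\<delta> \<le> \<delta>0" "\<delta> \<le> \<delta>1" "\<delta> \<le> \<delta>2"
      using \<delta>0 \<delta>1 \<delta>2 by (auto simp: \<delta>_def)
    obtain n t \<tau> where P: "tagged_mesh c d \<delta> n t \<tau>"
      using tagged_mesh_exists [OF \<open>c \<le> d\<close> \<delta>(1)] by blast
    define \<Delta> where "\<Delta> i = g (t (Suc i)) - g (t i)" for i
    have cell: "ennreal (cmod (\<Delta> i) * norm (G (\<tau> i))) \<le> f (t i) (t (Suc i)) + ennreal \<eta> * ennreal (cmod (\<Delta> i))"
      if "i < n" for i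
    proof -
      have ti: "t i \<le> \<tau> i" "\<tau> i \<le> t (Suc i)" "t (Suc i) - t i < \<delta>"
        using P that by (auto simp: tagged_mesh_def)
      have in_cd: "t i \<in> {c..d}" "t (Suc i) \<in> {c..d}"
        using tagged_mesh_point [OF P] that by auto
      \<comment> \<open>If the difference is negative, \<open>ennreal\<close> turns it into 0, and
        the bound is trivial.\<close>
      have "ennreal (norm (G (\<tau> i)) - \<eta>) \<le> (INF s \<in> {t i..t (Suc i)}. \<phi> (g s))"
      proof (rule INF_greatest)
        fix s assume s: "s \<in> {t i..t (Suc i)}"
        then have "dist (G (\<tau> i)) (G s) < \<eta>"
          using ti in_cd \<delta> by (intro \<delta>0(2)) (auto simp: dist_real_def)
        then have "norm (G (\<tau> i)) - \<eta> \<le> norm (G s)"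
          using norm_triangle_ineq2 [of "G (\<tau> i)" "G s"] by (simp add: dist_norm)
        moreover have "\<phi> (g s) = ennreal (norm (G s))"
          using s in_cd by (intro \<phi>) auto
        ultimately show "ennreal (norm (G (\<tau> i)) - \<eta>) \<le> \<phi> (g s)"
          by (simp add: ennreal_leI)
      qed
      moreover have "ennreal (cmod (\<Delta> i)) \<le> arc_length g {t i..t (Suc i)}"
        unfolding \<Delta>_def arc_length_eq_partition_sup
        using ti by (intro le_partition_sup [where f = "\<lambda>u v. ennreal (cmod (g v - g u))"]) auto
      ultimately have "ennreal (norm (G (\<tau> i)) - \<eta>) * ennreal (cmod (\<Delta> i)) \<le> f (t i) (t (Suc i))"
        unfolding f_def by (intro mult_mono) auto
      moreover have "ennreal (cmod (\<Delta> i) * norm (G (\<tau> i)))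
          \<le> ennreal (norm (G (\<tau> i)) - \<eta>) * ennreal (cmod (\<Delta> i)) + ennreal \<eta> * ennreal (cmod (\<Delta> i))"
      proof -
        have "norm (G (\<tau> i)) \<le> max 0 (norm (G (\<tau> i)) - \<eta>) + \<eta>"
          by auto
        then have "cmod (\<Delta> i) * norm (G (\<tau> i)) \<le> (max 0 (norm (G (\<tau> i)) - \<eta>) + \<eta>) * cmod (\<Delta> i)"
          by (subst mult.commute) (intro mult_right_mono, auto)
        then have "ennreal (cmod (\<Delta> i) * norm (G (\<tau> i)))
            \<le> ennreal (max 0 (norm (G (\<tau> i)) - \<eta>) * cmod (\<Delta> i) + \<eta> * cmod (\<Delta> i))"
          by (intro ennreal_leI) (simp add: distrib_right)
        also have "\<dots> = ennreal (max 0 (norm (G (\<tau> i)) - \<eta>)) * ennreal (cmod (\<Delta> i)) + ennreal \<eta> * ennreal (cmod (\<Delta> i))"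
          using \<open>\<eta> > 0\<close> by (simp add: ennreal_plus ennreal_mult)
        also have "ennreal (max 0 (norm (G (\<tau> i)) - \<eta>)) = ennreal (norm (G (\<tau> i)) - \<eta>)"
          by (simp add: max_def ennreal_neg)
        finally show ?thesis .
      qed
      ultimately show ?thesis
        by (meson add_right_mono order_trans)
    qed
    have "ennreal (\<Sum>i<n. cmod (\<Delta> i) * norm (G (\<tau> i))) = (\<Sum>i<n. ennreal (cmod (\<Delta> i) * norm (G (\<tau> i))))"
      by (simp add: sum_ennreal)
    also have "\<dots> \<le> (\<Sum>i<n. f (t i) (t (Suc i)) + ennreal \<eta> * ennreal (cmod (\<Delta> i)))"
      using cell by (intro sum_mono) auto
    also have "\<dots> = (\<Sum>i<n. f (t i) (t (Suc i))) + ennreal \<eta> * (\<Sum>i<n. ennreal (cmod (\<Delta> i)))"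
      by (simp only: sum.distrib sum_distrib_left)
    also have "\<dots> \<le> ennreal L + ennreal \<eta> * ennreal len"
    proof (intro add_mono mult_left_mono)
      have "(\<Sum>i<n. f (t i) (t (Suc i))) \<le> partition_sup f {c..d}"
        using P tagged_mesh_point [OF P] by (intro sum_le_partition_sup) (auto simp: tagged_mesh_def)
      also have "\<dots> \<le> ennreal L"
        using L unfolding f_def .
      finally show "(\<Sum>i<n. f (t i) (t (Suc i))) \<le> ennreal L" .
      show "(\<Sum>i<n. ennreal (cmod (\<Delta> i))) \<le> ennreal len"
        using sum_cmod_le_arc_length [OF P] len(1) unfolding \<Delta>_def by (rule order_trans)
    qed simp
    also have "\<dots> = ennreal (L + \<eta> * len)"
      using \<open>\<eta> > 0\<close> \<open>L \<ge> 0\<close> len(2) by (simp add: ennreal_plus ennreal_mult)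
    finally have sum_le: "(\<Sum>i<n. cmod (\<Delta> i) * norm (G (\<tau> i))) \<le> L + \<eta> * len"
      using \<open>\<eta> > 0\<close> \<open>L \<ge> 0\<close> len(2) by (subst (asm) ennreal_le_iff) auto
    define A where "A = stieltjes_sum (\<lambda>u. G u o\<^sub>L S u) g n t \<tau>"
    define B where "B = stieltjes_sum (\<lambda>u. G u o\<^sub>L T u) g n t \<tau>"
    have "A - B = (\<Sum>i<n. op_scale (\<Delta> i) (G (\<tau> i) o\<^sub>L (S (\<tau> i) - T (\<tau> i))))"
      by (simp add: A_def B_def stieltjes_sum_def \<Delta>_def op_scale_diff_right blinfun_compose_diff_right sum_subtractf)
    also have "norm \<dots> \<le> (\<Sum>i<n. cmod (\<Delta> i) * (norm (G (\<tau> i)) * K))"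
    proof (intro sum_norm_le)
      fix i assume "i \<in> {..<n}"
      then have "norm (S (\<tau> i) - T (\<tau> i)) \<le> K"
        by (intro ST tagged_mesh_tag [OF P]) auto
      then have "norm (G (\<tau> i) o\<^sub>L (S (\<tau> i) - T (\<tau> i))) \<le> norm (G (\<tau> i)) * K"
        by (intro norm_blinfun_compose_le) auto
      then show "norm (op_scale (\<Delta> i) (G (\<tau> i) o\<^sub>L (S (\<tau> i) - T (\<tau> i)))) \<le> cmod (\<Delta> i) * (norm (G (\<tau> i)) * K)"
        by (intro order_trans [OF norm_op_scale_le] mult_left_mono) auto
    qed
    also have "\<dots> = K * (\<Sum>i<n. cmod (\<Delta> i) * norm (G (\<tau> i)))"
      by (simp add: sum_distrib_left mult_ac)
    also have "\<dots> \<le> K * (L + \<eta> * len)"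
      using sum_le \<open>K \<ge> 0\<close> by (rule mult_left_mono)
    finally have AB: "norm (A - B) \<le> K * (L + \<eta> * len)" .
    have "norm (A - I) < \<eta>" "norm (B - J) < \<eta>"
      unfolding A_def B_def using \<delta> by (auto intro!: \<delta>1(2) \<delta>2(2) intro: tagged_mesh_mono [OF P])
    moreover have "I - J = (A - B) - (A - I) + (B - J)"
      by simp
    then have "norm (I - J) \<le> norm (A - B) + norm (A - I) + norm (B - J)"
      by (metis (no_types, lifting) add_right_mono norm_triangle_ineq norm_triangle_ineq4 order_trans)
    ultimately have "norm (I - J) \<le> K * (L + \<eta> * len) + \<eta> + \<eta>"
      using AB by linarith
    then show ?thesis
      by (simp add: algebra_simps)
  qed
  show ?thesis
  proof (rule field_le_epsilon)
    fix e :: real assume "e > 0"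
    have pos: "2 + K * len > 0"
      using \<open>K \<ge> 0\<close> len(2) by (simp add: add_pos_nonneg)
    then show "norm (I - J) \<le> K * L + e"
      using main [of "e / (2 + K * len)"] \<open>e > 0\<close> by simp
  qed
qed


section \<open>Contour integrals\<close>

lemma eventually_at_right_prod_at_left:
  fixes a b u v :: real
  assumes "a < u" "v < b" and P: "\<And>c d. a < c \<Longrightarrow> c < u \<Longrightarrow> v < d \<Longrightarrow> d < b \<Longrightarrow> P (c, d)"
  shows "\<forall>\<^sub>F p in at_right a \<times>\<^sub>F at_left b. P p"
  unfolding eventually_prod_filter
  using eventually_at_right_real [OF \<open>a < u\<close>] eventually_at_left_real [OF \<open>v < b\<close>] P
  by (intro exI [of _ "\<lambda>c. c \<in> {a<..<u}"] exI [of _ "\<lambda>d. d \<in> {v<..<b}"]) auto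

text \<open>Rectifiability is asked for only on closed subintervals of the open parameter interval,
  since a piece may run to infinity; the ends are controlled by \<open>integrable\<close>.\<close>

locale integrable_arc =
  fixes \<Phi> :: "complex \<Rightarrow> ('b::complex_hilbert_space \<Rightarrow>\<^sub>L 'c::complex_hilbert_space)"
    and g :: "real \<Rightarrow> complex"
  assumes \<Phi>_cont: "continuous_on {0<..<1} (\<lambda>u. \<Phi> (g u))"
    and rectifiable: "\<And>c d. 0 < c \<Longrightarrow> d < 1 \<Longrightarrow> arc_length g {c..d} < \<infinity>"
    and integrable: "arc_integral (\<lambda>z. ennreal (norm (\<Phi> z))) g < \<infinity>"
begin

definition weight :: "real \<Rightarrow> real \<Rightarrow> ennreal"
  where "weight u v = (INF s \<in> {u..v}. ennreal (norm (\<Phi> (g s)))) * arc_length g {u..v}"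

definition mass :: real
  where "mass = enn2real (arc_integral (\<lambda>z. ennreal (norm (\<Phi> z))) g)"

lemma mass_nonneg: "mass \<ge> 0"
  by (simp add: mass_def)

lemma arc_integral_eq: "arc_integral (\<lambda>z. ennreal (norm (\<Phi> z))) g = partition_sup weight {0<..<1}"
  by (simp add: arc_integral_eq_partition_sup weight_def [abs_def])

lemma partition_sup_le_mass: "0 < c \<Longrightarrow> d < 1 \<Longrightarrow> partition_sup weight {c..d} \<le> ennreal mass"
  using integrable
  by (auto simp: mass_def arc_integral_eq intro!: partition_sup_mono)

lemma stieltjes_diff_le:
  assumes "has_stieltjes_integral (\<lambda>u. \<Phi> (g u) o\<^sub>L S u) g c d I"
    "has_stieltjes_integral (\<lambda>u. \<Phi> (g u) o\<^sub>L T u) g c d J"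
    and cd: "0 < c" "c \<le> d" "d < 1" and "partition_sup weight {c..d} \<le> ennreal L" "L \<ge> 0"
    and "\<And>u. u \<in> {c..d} \<Longrightarrow> norm (S u - T u) \<le> K" "K \<ge> 0"
  shows "norm (I - J) \<le> K * L"
proof (rule stieltjes_integral_diff_le)
  show "continuous_on {c..d} (\<lambda>u. \<Phi> (g u))"
    using \<Phi>_cont by (rule continuous_on_subset) (use cd in auto)
  show "arc_length g {c..d} < \<infinity>"
    using cd by (intro rectifiable)
  show "partition_sup (\<lambda>u v. (INF s\<in>{u..v}. (\<lambda>z. ennreal (norm (\<Phi> z))) (g s)) * arc_length g {u..v}) {c..d} \<le> ennreal L"
    using assms(6) by (simp add: weight_def [abs_def])
qed (use assms in auto)

text \<open>\<open>mass\<close> dominates the weight of every compact part, so the bound there is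
  uniform in c and d and survives the limit.\<close>

lemma contour_integral_diff_le:
  assumes I: "has_op_contour_integral (\<lambda>z. \<Phi> z o\<^sub>L S z) g I"
    and J: "has_op_contour_integral (\<lambda>z. \<Phi> z o\<^sub>L T z) g J"
    and ST: "\<And>u. u \<in> {0<..<1} \<Longrightarrow> norm (S (g u) - T (g u)) \<le> K" and "K \<ge> 0"
  shows "norm (I - J) \<le> K * mass"
proof -
  obtain I' where I': "\<And>c d. 0 < c \<Longrightarrow> c < d \<Longrightarrow> d < 1 \<Longrightarrow>
      has_stieltjes_integral (\<lambda>u. \<Phi> (g u) o\<^sub>L S (g u)) g c d (I' c d)"
    "((\<lambda>(c, d). I' c d) \<longlongrightarrow> I) (at_right 0 \<times>\<^sub>F at_left 1)"
    using I unfolding has_op_contour_integral_def by auto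
  obtain J' where J': "\<And>c d. 0 < c \<Longrightarrow> c < d \<Longrightarrow> d < 1 \<Longrightarrow>
      has_stieltjes_integral (\<lambda>u. \<Phi> (g u) o\<^sub>L T (g u)) g c d (J' c d)"
    "((\<lambda>(c, d). J' c d) \<longlongrightarrow> J) (at_right 0 \<times>\<^sub>F at_left 1)"
    using J unfolding has_op_contour_integral_def by auto
  have "((\<lambda>p. norm ((\<lambda>(c, d). I' c d) p - (\<lambda>(c, d). J' c d) p)) \<longlongrightarrow> norm (I - J))
      (at_right 0 \<times>\<^sub>F at_left (1::real))"
    by (intro tendsto_intros I'(2) J'(2))
  moreover have "\<forall>\<^sub>F p in at_right 0 \<times>\<^sub>F at_left (1::real).
      norm ((\<lambda>(c, d). I' c d) p - (\<lambda>(c, d). J' c d) p) \<le> K * mass"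
  proof (rule eventually_at_right_prod_at_left [of 0 "1/2" "1/2" 1])
    fix c d :: real assume cd: "0 < c" "c < 1/2" "1/2 < d" "d < 1"
    then have "norm (I' c d - J' c d) \<le> K * mass"
      using \<open>K \<ge> 0\<close> mass_nonneg
      by (intro stieltjes_diff_le [OF I'(1) J'(1)] partition_sup_le_mass ST) auto
    then show "norm ((\<lambda>(c, d). I' c d) (c, d) - (\<lambda>(c, d). J' c d) (c, d)) \<le> K * mass"
      by simp
  qed auto
  ultimately show ?thesis
    by (rule tendsto_upperbound) (simp add: prod_filter_eq_bot)
qed

text \<open>An improper integral at both ends. The integrals over compact parts form a Cauchy family
  because a bounded T is multiplied by small end weights.\<close>

lemma contour_integral_exists:
  assumes T_cont: "continuous_on {0<..<1} (\<lambda>u. T (g u))"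
    and T_bound: "\<And>u. u \<in> {0<..<1} \<Longrightarrow> norm (T (g u)) \<le> M"
  shows "\<exists>I. has_op_contour_integral (\<lambda>z. \<Phi> z o\<^sub>L T z) g I"
proof -
  have "M \<ge> 0"
    using order_trans [OF norm_ge_zero T_bound [of "1/2"]] by simp
  have "\<exists>J. has_stieltjes_integral (\<lambda>u. \<Phi> (g u) o\<^sub>L T (g u)) g c d J" if "0 < c" "c \<le> d" "d < 1" for c d
  proof (intro stieltjes_integral_exists)
    have "continuous_on {0<..<1} (\<lambda>u. \<Phi> (g u) o\<^sub>L T (g u))"
      by (intro continuous_intros \<Phi>_cont T_cont)
    then show "continuous_on {c..d} (\<lambda>u. \<Phi> (g u) o\<^sub>L T (g u))"
      by (rule continuous_on_subset) (use that in auto)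
  qed (use that rectifiable in auto)
  then obtain J where J: "\<And>c d. 0 < c \<Longrightarrow> c \<le> d \<Longrightarrow> d < 1 \<Longrightarrow>
      has_stieltjes_integral (\<lambda>u. \<Phi> (g u) o\<^sub>L T (g u)) g c d (J c d)"
    by metis
  have J_bound: "norm (J c d) \<le> M * e"
    if "0 < c" "c \<le> d" "d < 1" "e \<ge> 0" "partition_sup weight {c..d} \<le> ennreal e" for c d e
    using stieltjes_diff_le [OF J [OF that(1-3)], of "\<lambda>_. 0" 0 e M] that T_bound \<open>M \<ge> 0\<close>
    by (auto simp: has_stieltjes_integral_zero)
  have J_add: "J c e = J c d + J d e" if "0 < c" "c \<le> d" "d \<le> e" "e < 1" for c d e
    using that by (intro has_stieltjes_integral_combine [OF J J J]) auto
  have close: "\<exists>u v. 0 < u \<and> u \<le> v \<and> v < 1 \<and> (\<forall>c d c' d'. 0 < c \<longrightarrow> c \<le> u \<longrightarrow> v \<le> d \<longrightarrow> d < 1 \<longrightarrow>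
      0 < c' \<longrightarrow> c' \<le> u \<longrightarrow> v \<le> d' \<longrightarrow> d' < 1 \<longrightarrow> norm (J c d - J c' d') < e)" if "e > 0" for e
  proof -
    \<comment> \<open>Two integrals over long intervals differ by four end pieces, each at most M
      e'.\<close>
    define e' where "e' = e / (4 * M + 1)"
    have e': "e' > 0" "4 * (M * e') < e"
      using \<open>e > 0\<close> \<open>M \<ge> 0\<close> by (auto simp: e'_def field_simps)
    have "partition_sup weight {0<..<1} < \<infinity>"
      using integrable by (simp add: arc_integral_eq)
    then obtain u v where uv: "0 < u" "u \<le> v" "v < 1"
      and left: "\<And>c d. 0 < c \<Longrightarrow> c \<le> d \<Longrightarrow> d \<le> u \<Longrightarrow> partition_sup weight {c..d} \<le> ennreal e'"
      and right: "\<And>c d. v \<le> c \<Longrightarrow> c \<le> d \<Longrightarrow> d < 1 \<Longrightarrow> partition_sup weight {c..d} \<le> ennreal e'"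
      using partition_sup_tails [of weight 0 1 e'] e'(1) by auto
    have "norm (J c d - J c' d') < e"
      if cd: "0 < c" "c \<le> u" "v \<le> d" "d < 1" "0 < c'" "c' \<le> u" "v \<le> d'" "d' < 1" for c d c' d'
    proof -
      \<comment> \<open>The middle part from u to v is common to both integrals and cancels.\<close>
      have split: "J x y = J x u + (J u v + J v y)" if "0 < x" "x \<le> u" "v \<le> y" "y < 1" for x y
        using that uv J_add [of x u y] J_add [of u v y] by simp
      have "norm (J x u) \<le> M * e'" if "0 < x" "x \<le> u" for x
        using that uv less_imp_le [OF e'(1)] left [of x u] by (intro J_bound) linarith+
      moreover have "norm (J v y) \<le> M * e'" if "v \<le> y" "y < 1" for y
        using that uv less_imp_le [OF e'(1)] right [of v y] by (intro J_bound) linarith+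
      ultimately have bounds: "norm (J c u) \<le> M * e'" "norm (J c' u) \<le> M * e'"
        "norm (J v d) \<le> M * e'" "norm (J v d') \<le> M * e'"
        using cd by blast+
      have "J c d - J c' d' = (J c u - J c' u) + (J v d - J v d')"
        using split [of c d] split [of c' d'] cd by simp
      also have "norm \<dots> \<le> (norm (J c u) + norm (J c' u)) + (norm (J v d) + norm (J v d'))"
        by (intro norm_triangle_mono norm_triangle_ineq4)
      also have "\<dots> \<le> 4 * (M * e')"
        using bounds by linarith
      finally show ?thesis
        using e'(2) by simp
    qed
    with uv show ?thesis by blast
  qed
  define x where "x k = inverse (real (Suc (Suc k)))" for k
  have x: "0 < x k" "x k < 1" for k
    by (auto simp: x_def divide_simps)
  have "x \<longlonglongrightarrow> 0"
    unfolding x_def using LIMSEQ_inverse_real_of_nat by (rule LIMSEQ_Suc [of "\<lambda>k. inverse (real (Suc k))"])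
  then have x_small: "\<exists>k0. \<forall>k\<ge>k0. x k < e" if "e > 0" for e
    using order_tendstoD(2) [of x 0 sequentially e] that by (auto simp: eventually_sequentially)
  have x_close: "\<exists>k0. \<forall>k\<ge>k0. x k \<le> u \<and> v \<le> 1 - x k" if uv: "0 < u" "v < 1" for u v
  proof -
    obtain k0 where "\<forall>k\<ge>k0. x k < min u (1 - v)"
      using x_small [of "min u (1 - v)"] uv by auto
    then show ?thesis
      by (intro exI [of _ k0]) (force simp: less_imp_le)
  qed
  define s where "s k = J (x k) (1 - x k)" for k
  have "Cauchy s"
    unfolding Cauchy_def
  proof (intro allI impI)
    fix e :: real assume "e > 0"
    obtain u v where uv: "0 < u" "v < 1" "\<And>c d c' d'. 0 < c \<Longrightarrow> c \<le> u \<Longrightarrow> v \<le> d \<Longrightarrow> d < 1 \<Longrightarrow>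
      0 < c' \<Longrightarrow> c' \<le> u \<Longrightarrow> v \<le> d' \<Longrightarrow> d' < 1 \<Longrightarrow> norm (J c d - J c' d') < e"
      using close [OF \<open>e > 0\<close>] by metis
    obtain k0 where "\<forall>k\<ge>k0. x k \<le> u \<and> v \<le> 1 - x k"
      using x_close uv by blast
    then have "dist (s m) (s n) < e" if "m \<ge> k0" "n \<ge> k0" for m n
      unfolding s_def dist_norm using that x by (intro uv(3)) auto
    then show "\<exists>k. \<forall>m\<ge>k. \<forall>n\<ge>k. dist (s m) (s n) < e"
      by blast
  qed
  then obtain I where I: "s \<longlonglongrightarrow> I"
    by (meson Cauchy_convergent_iff convergent_def)
  have "((\<lambda>(c, d). J c d) \<longlongrightarrow> I) (at_right 0 \<times>\<^sub>F at_left 1)"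
  proof (rule tendstoI)
    fix e :: real assume "e > 0"
    obtain u v where uv: "0 < u" "u \<le> v" "v < 1" "\<And>c d c' d'. 0 < c \<Longrightarrow> c \<le> u \<Longrightarrow> v \<le> d \<Longrightarrow> d < 1 \<Longrightarrow>
      0 < c' \<Longrightarrow> c' \<le> u \<Longrightarrow> v \<le> d' \<Longrightarrow> d' < 1 \<Longrightarrow> norm (J c d - J c' d') < e / 2"
      using close [of "e / 2"] \<open>e > 0\<close> by (metis half_gt_zero)
    obtain k0 where k0: "\<forall>k\<ge>k0. x k \<le> u \<and> v \<le> 1 - x k"
      using x_close uv by blast
    obtain k1 where k1: "\<forall>k\<ge>k1. norm (s k - I) < e / 2"
      using LIMSEQ_D [OF I, of "e / 2"] \<open>e > 0\<close> by auto
    define k where "k = max k0 k1"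
    show "\<forall>\<^sub>F p in at_right 0 \<times>\<^sub>F at_left (1::real). dist ((\<lambda>(c, d). J c d) p) I < e"
    proof (rule eventually_at_right_prod_at_left [of 0 u v 1])
      fix c d assume cd: "0 < c" "c < u" "v < d" "d < 1"
      have "norm (J c d - s k) < e / 2"
        unfolding s_def using cd x k0 by (intro uv(4)) (auto simp: k_def)
      moreover have "norm (s k - I) < e / 2"
        using k1 by (auto simp: k_def)
      ultimately show "dist ((\<lambda>(c, d). J c d) (c, d)) I < e"
        using norm_triangle_ineq [of "J c d - s k" "s k - I"] by (simp add: dist_norm)
    qed (use uv in auto)
  qed
  then show ?thesis
    unfolding has_op_contour_integral_def using J by (intro exI [of _ I] exI [of _ J]) auto
qed

end

lemma has_op_contour_integral_in_bounded_ops: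
  assumes I: "has_op_contour_integral F g I" and F: "\<And>u. u \<in> {0<..<1} \<Longrightarrow> F (g u) \<in> bounded_ops"
  shows "I \<in> bounded_ops"
proof -
  obtain J where J: "\<And>c d. 0 < c \<Longrightarrow> c < d \<Longrightarrow> d < 1 \<Longrightarrow> has_stieltjes_integral (\<lambda>u. F (g u)) g c d (J c d)"
    "((\<lambda>(c, d). J c d) \<longlongrightarrow> I) (at_right 0 \<times>\<^sub>F at_left 1)"
    using I unfolding has_op_contour_integral_def by auto
  show ?thesis
  proof (rule Lim_in_closed_set [OF closed_bounded_ops _ _ J(2)])
    show "\<forall>\<^sub>F p in at_right 0 \<times>\<^sub>F at_left (1::real). (\<lambda>(c, d). J c d) p \<in> bounded_ops"
    proof (rule eventually_at_right_prod_at_left [of 0 "1/2" "1/2" 1])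
      fix c d :: real assume "0 < c" "c < 1/2" "1/2 < d" "d < 1"
      then show "(\<lambda>(c, d). J c d) (c, d) \<in> bounded_ops"
        using has_stieltjes_integral_in_bounded_ops [OF J(1) [of c d]] F by auto
    qed auto
  qed (simp add: prod_filter_eq_bot)
qed

section \<open>Integrals with respect to operator measures\<close>

definition measure_sum ::
    "(real set \<Rightarrow> ('a::complex_hilbert_space \<Rightarrow>\<^sub>L 'b::complex_hilbert_space)) \<Rightarrow>
     (complex \<Rightarrow> ('c::complex_hilbert_space \<Rightarrow>\<^sub>L 'a)) \<Rightarrow> real set set \<Rightarrow> (real set \<Rightarrow> real) \<Rightarrow> ('c \<Rightarrow>\<^sub>L 'b)"
  where "measure_sum m T P \<tau> = (\<Sum>\<delta>\<in>P. m \<delta> o\<^sub>L T (complex_of_real (\<tau> \<delta>)))"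

lemma has_spectral_integral_iff:
  "has_spectral_integral B10 E0 B01 S T I \<longleftrightarrow>
    (\<forall>\<epsilon>>0. \<exists>P0. finite P0 \<and> borel_partition S P0 \<and>
      (\<forall>P \<tau>. finite P \<longrightarrow> borel_partition S P \<longrightarrow> refines S P P0 \<longrightarrow> (\<forall>\<delta>\<in>P. \<tau> \<delta> \<in> \<delta>) \<longrightarrow>
        norm (measure_sum (\<lambda>\<delta>. B10 o\<^sub>L E0 \<delta> o\<^sub>L B01) T P \<tau> - I) < \<epsilon>))"
  unfolding has_spectral_integral_def measure_sum_def ..

lemma borel_partition_tags_exist:
  assumes "borel_partition S P"
  shows "\<exists>\<tau>. \<forall>\<delta>\<in>P. \<tau> \<delta> \<in> \<delta>"
proof -
  have "{} \<notin> P"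
    using assms by (auto simp: borel_partition_def partition_on_def)
  then have "\<forall>\<delta>\<in>P. \<exists>x. x \<in> \<delta>"
    by (metis ex_in_conv)
  then show ?thesis
    by (rule bchoice)
qed

text \<open>The nonempty sets \<open>p \<inter> q\<close> do it. So the finite Borel partitions are
  directed, and limits along refinement can be compared.\<close>

lemma borel_partition_common_refinement:
  assumes P: "finite P" "borel_partition S P" and Q: "finite Q" "borel_partition S Q"
  shows "\<exists>R. finite R \<and> borel_partition S R \<and> refines S R P \<and> refines S R Q"
proof -
  define R where "R = (\<lambda>(p, q). p \<inter> q) ` (P \<times> Q) - {{}}"
  have part: "partition_on S P" "partition_on S Q"
    and borel: "P \<subseteq> sets borel" "Q \<subseteq> sets borel"
    using P Q by (auto simp: borel_partition_def)
  have "partition_on S R"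
  proof (rule partition_onI)
    have "\<Union>R = \<Union>P \<inter> \<Union>Q"
      unfolding R_def by blast
    then show "\<Union>R = S"
      using partition_onD1 [OF part(1)] partition_onD1 [OF part(2)] by simp
    show "disjnt a b" if ab: "a \<in> R" "b \<in> R" "a \<noteq> b" for a b
    proof -
      obtain p q where "a = p \<inter> q" "p \<in> P" "q \<in> Q"
        using ab(1) by (auto simp: R_def)
      moreover obtain p' q' where "b = p' \<inter> q'" "p' \<in> P" "q' \<in> Q"
        using ab(2) by (auto simp: R_def)
      moreover from calculation \<open>a \<noteq> b\<close> have "p \<noteq> p' \<or> q \<noteq> q'"
        by auto
      moreover have "p \<inter> p' = {}" if "p \<noteq> p'" "p \<in> P" "p' \<in> P" for p p'
        using partition_onD2 [OF part(1)] that by (simp add: disjoint_def)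
      moreover have "q \<inter> q' = {}" if "q \<noteq> q'" "q \<in> Q" "q' \<in> Q" for q q'
        using partition_onD2 [OF part(2)] that by (simp add: disjoint_def)
      ultimately show ?thesis
        unfolding disjnt_def by blast
    qed
  qed (auto simp: R_def)
  moreover have "finite R"
    using P(1) Q(1) by (simp add: R_def)
  moreover have "R \<subseteq> sets borel"
    using borel by (auto simp: R_def)
  ultimately have "finite R \<and> borel_partition S R \<and> refines S R P \<and> refines S R Q"
    using part by (auto simp: borel_partition_def refines_def countable_finite) (auto simp: R_def)
  then show ?thesis by blast
qed

lemma disjoint_family_on_partition_Int:
  assumes "partition_on S P" "partition_on S Q"
  shows "disjoint_family_on (\<lambda>(p, q). p \<inter> q) (P \<times> Q)"
  unfolding disjoint_family_on_def
proof (intro ballI impI)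
  fix i j assume ij: "i \<in> P \<times> Q" "j \<in> P \<times> Q" "i \<noteq> j"
  obtain p q p' q' where "i = (p, q)" "j = (p', q')"
    by (cases i, cases j)
  moreover from this ij have "p \<in> P" "p' \<in> P" "q \<in> Q" "q' \<in> Q" "p \<noteq> p' \<or> q \<noteq> q'"
    by auto
  then have "p \<inter> p' = {} \<or> q \<inter> q' = {}"
    using disjointD [OF partition_onD2 [OF assms(1)], of p p'] disjointD [OF partition_onD2 [OF assms(2)], of q q']
    by argo
  ultimately show "(case i of (p, q) \<Rightarrow> p \<inter> q) \<inter> (case j of (p, q) \<Rightarrow> p \<inter> q) = {}"
    by auto
qed

text \<open>Countable additivity is pointwise, as for a projection-valued measure; in norm only the
  variation is controlled. The families in \<open>variation_le\<close> need not cover S, so it also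
  applies to tails.\<close>

locale operator_measure =
  fixes m :: "real set \<Rightarrow> ('a::complex_hilbert_space \<Rightarrow>\<^sub>L 'b::complex_hilbert_space)"
    and S :: "real set" and C :: real
  assumes S_borel: "S \<in> sets borel"
    and countably_additive: "\<And>F x. range F \<subseteq> sets borel \<Longrightarrow> disjoint_family F \<Longrightarrow>
      (\<lambda>n::nat. m (F n) x) sums m (\<Union>n. F n) x"
    and variation_le: "\<And>P. finite P \<Longrightarrow> disjoint P \<Longrightarrow> {} \<notin> P \<Longrightarrow> P \<subseteq> sets borel \<Longrightarrow> \<Union>P \<subseteq> S \<Longrightarrow>
      (\<Sum>\<delta>\<in>P. norm (m \<delta>)) \<le> C"
begin

lemma C_nonneg: "C \<ge> 0"
  using variation_le [of "{}"] by simp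

lemma m_empty [simp]: "m {} = 0"
proof (rule blinfun_eqI)
  fix x
  \<comment> \<open>A constant series is summable only if its term is 0.\<close>
  have "(\<lambda>n::nat. m {} x) sums m (\<Union>n::nat. {}) x"
    by (rule countably_additive) (auto simp: disjoint_family_on_def)
  then have "summable (\<lambda>n::nat. m {} x)"
    by (rule sums_summable)
  then show "m {} x = blinfun_apply 0 x"
    by (simp add: summable_const_iff)
qed

lemma m_Un:
  assumes "A \<in> sets borel" "B \<in> sets borel" "A \<inter> B = {}"
  shows "m (A \<union> B) = m A + m B"
proof (rule blinfun_eqI)
  fix x
  have "(\<lambda>n. m (binaryset A B n) x) sums m (\<Union>n. binaryset A B n) x"
    using assms by (intro countably_additive)
      (auto simp: range_binaryset_eq disjoint_family_on_def binaryset_def)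
  moreover have "(\<lambda>n. m (binaryset A B n) x) sums (m A x + m B x)"
    by (rule binaryset_sums [where f = "\<lambda>A. m A x"]) simp
  ultimately show "m (A \<union> B) x = (m A + m B) x"
    by (simp add: UN_binaryset_eq sums_iff blinfun.add_left)
qed

lemma m_UN:
  assumes "finite I" "disjoint_family_on A I" "\<And>i. i \<in> I \<Longrightarrow> A i \<in> sets borel"
  shows "m (\<Union>i\<in>I. A i) = (\<Sum>i\<in>I. m (A i))"
  using assms
proof (induction I)
  case (insert i I)
  have "A i \<inter> (\<Union>j\<in>I. A j) = {}"
    using insert.prems(1) insert.hyps(2) by (auto simp: disjoint_family_on_def)
  moreover have "(\<Union>j\<in>I. A j) \<in> sets borel"
    using insert.prems(2) insert.hyps(1) by (intro sets.finite_UN) auto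
  ultimately have "m (\<Union>j\<in>insert i I. A j) = m (A i) + m (\<Union>j\<in>I. A j)"
    using insert.prems(2) by (simp add: m_Un)
  also have "m (\<Union>j\<in>I. A j) = (\<Sum>j\<in>I. m (A j))"
    using insert.prems by (intro insert.IH) (auto simp: disjoint_family_on_def)
  finally show ?case
    using insert.hyps by simp
qed simp

lemma m_split:
  assumes "finite P" "borel_partition S P" "A \<in> sets borel" "A \<subseteq> S"
  shows "m A = (\<Sum>p\<in>P. m (A \<inter> p))"
proof -
  have P: "partition_on S P" "P \<subseteq> sets borel"
    using assms by (auto simp: borel_partition_def)
  have "m (\<Union>p\<in>P. A \<inter> p) = (\<Sum>p\<in>P. m (A \<inter> p))"
  proof (rule m_UN)
    show "disjoint_family_on (\<lambda>p. A \<inter> p) P"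
      using partition_onD2 [OF P(1)] unfolding disjoint_family_on_def disjoint_def by blast
  qed (use P assms in auto)
  moreover have "(\<Union>p\<in>P. A \<inter> p) = A"
    using partition_onD1 [OF P(1)] assms by auto
  ultimately show ?thesis by simp
qed

definition finite_families :: "real set set set"
  where "finite_families = {P. finite P \<and> disjoint P \<and> {} \<notin> P \<and> P \<subseteq> sets borel \<and> \<Union>P \<subseteq> S}"

text \<open>An indexed family may repeat the empty set; once its empty members are dropped, the
  indexing is injective. The bound D is left open because \<open>tail_variation\<close> needs the
  exact supremum in place of C.\<close>

lemma indexed_variation_le_of:
  assumes D: "\<And>P. P \<in> finite_families \<Longrightarrow> (\<Sum>\<delta>\<in>P. norm (m \<delta>)) \<le> D"
    and A: "finite I" "disjoint_family_on A I" "\<And>i. i \<in> I \<Longrightarrow> A i \<in> sets borel" "\<And>i. i \<in> I \<Longrightarrow> A i \<subseteq> S"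
  shows "(\<Sum>i\<in>I. norm (m (A i))) \<le> D"
proof -
  define J where "J = {i\<in>I. A i \<noteq> {}}"
  have "(\<Sum>i\<in>I. norm (m (A i))) = (\<Sum>i\<in>J. norm (m (A i)))"
    using A(1) by (intro sum.mono_neutral_right) (auto simp: J_def)
  also have "\<dots> = (\<Sum>\<delta>\<in>A ` J. norm (m \<delta>))"
  proof -
    have "inj_on A J"
      using A(2) unfolding inj_on_def J_def disjoint_family_on_def by blast
    then show ?thesis
      by (simp add: sum.reindex)
  qed
  also have "\<dots> \<le> D"
  proof (rule D)
    have "disjoint (A ` J)"
    proof (rule disjointI)
      fix a b assume "a \<in> A ` J" "b \<in> A ` J" "a \<noteq> b"
      then obtain i j where "a = A i" "b = A j" "i \<in> I" "j \<in> I" "i \<noteq> j"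
        by (auto simp: J_def)
      then show "a \<inter> b = {}"
        using A(2) by (auto simp: disjoint_family_on_def)
    qed
    then show "A ` J \<in> finite_families"
      using A by (auto simp: finite_families_def J_def)
  qed
  finally show ?thesis .
qed

lemma indexed_variation_le:
  assumes "finite I" "disjoint_family_on A I" "\<And>i. i \<in> I \<Longrightarrow> A i \<in> sets borel" "\<And>i. i \<in> I \<Longrightarrow> A i \<subseteq> S"
  shows "(\<Sum>i\<in>I. norm (m (A i))) \<le> C"
proof (rule indexed_variation_le_of [OF _ assms])
  show "(\<Sum>\<delta>\<in>P. norm (m \<delta>)) \<le> C" if "P \<in> finite_families" for P
    using that unfolding finite_families_def by (intro variation_le) blast+
qed

text \<open>Continuity from below: the shells on which the integer part of |x| equals n split A, and
  the first N of them make up the truncation.\<close>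

lemma truncation_tendsto:
  assumes "A \<in> sets borel"
  shows "(\<lambda>N. m (A \<inter> {x. \<bar>x\<bar> < real N}) x) \<longlonglongrightarrow> m A x"
proof -
  define F where "F n = A \<inter> {x. nat \<lfloor>\<bar>x\<bar>\<rfloor> = n}" for n
  have "{x :: real. nat \<lfloor>\<bar>x\<bar>\<rfloor> = n} \<in> sets borel" for n
    by measurable
  then have F: "F n \<in> sets borel" for n
    using assms by (auto simp: F_def)
  have disj: "disjoint_family F"
    by (auto simp: F_def disjoint_family_on_def)
  have "(\<lambda>n. m (F n) x) sums m (\<Union>n. F n) x"
    using F disj by (intro countably_additive) auto
  then have "(\<lambda>N. \<Sum>n<N. m (F n) x) \<longlonglongrightarrow> m (\<Union>n. F n) x"
    by (simp add: sums_def)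
  moreover have "(\<Sum>n<N. m (F n) x) = m (A \<inter> {x. \<bar>x\<bar> < real N}) x" for N
  proof -
    have "(\<Union>n\<in>{..<N}. F n) = A \<inter> {x. \<bar>x\<bar> < real N}"
    proof -
      have "nat \<lfloor>\<bar>x\<bar>\<rfloor> < N \<longleftrightarrow> \<bar>x\<bar> < real N" for x :: real
        by linarith
      then show ?thesis
        by (auto simp: F_def)
    qed
    moreover have "m (\<Union>n\<in>{..<N}. F n) = (\<Sum>n<N. m (F n))"
      using F disj by (intro m_UN) (auto simp: disjoint_family_on_def)
    ultimately show ?thesis
      by (simp add: blinfun.sum_left)
  qed
  moreover have "(\<Union>n. F n) = A"
    by (auto simp: F_def)
  ultimately show ?thesis by simp
qed

text \<open>The operator norm is lower semicontinuous in the strong topology.\<close>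

lemma norm_truncation:
  assumes "A \<in> sets borel" "\<eta> > 0"
  shows "\<forall>\<^sub>F N in sequentially. norm (m A) - \<eta> \<le> norm (m (A \<inter> {x. \<bar>x\<bar> < real N}))"
proof (cases "norm (m A) - \<eta> \<ge> 0")
  case True
  \<comment> \<open>A vector on which the norm is attained up to \<eta>; strong convergence at this
    single vector is enough.\<close>
  have "\<exists>x. norm (m A x) > (norm (m A) - \<eta>) * norm x"
  proof (rule ccontr)
    assume "\<not> ?thesis"
    then have "norm (m A) \<le> norm (m A) - \<eta>"
      using True by (intro norm_blinfun_bound) (auto simp: not_less)
    then show False
      using \<open>\<eta> > 0\<close> by simp
  qed
  then obtain x where x: "norm (m A x) > (norm (m A) - \<eta>) * norm x"
    by blast
  have "(\<lambda>N. norm (m (A \<inter> {x. \<bar>x\<bar> < real N}) x)) \<longlonglongrightarrow> norm (m A x)"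
    by (intro tendsto_norm truncation_tendsto assms)
  then have "\<forall>\<^sub>F N in sequentially. (norm (m A) - \<eta>) * norm x < norm (m (A \<inter> {x. \<bar>x\<bar> < real N}) x)"
    using x by (rule order_tendstoD)
  then show ?thesis
  proof eventually_elim
    case (elim N)
    then have "(norm (m A) - \<eta>) * norm x < norm (m (A \<inter> {x. \<bar>x\<bar> < real N})) * norm x"
      using norm_blinfun less_le_trans by blast
    then show ?case
      by (simp add: mult_less_cancel_right)
  qed
next
  case False
  then show ?thesis
    by (intro always_eventually allI) (smt (verit) norm_ge_zero)
qed

text \<open>A family that almost exhausts the variation still does so after truncation, which leaves
  little for the complement.\<close>

lemma tail_variation:
  assumes "e > 0"
  shows "\<exists>N::nat. \<forall>(I :: 'i set) A. finite I \<longrightarrow> disjoint_family_on A I \<longrightarrow> (\<forall>i\<in>I. A i \<in> sets borel) \<longrightarrow>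
    (\<forall>i\<in>I. A i \<subseteq> S \<inter> {x. real N \<le> \<bar>x\<bar>}) \<longrightarrow> (\<Sum>i\<in>I. norm (m (A i))) \<le> e"
proof -
  define V where "V = (SUP P\<in>finite_families. \<Sum>\<delta>\<in>P. norm (m \<delta>))"
  have bdd: "bdd_above ((\<lambda>P. \<Sum>\<delta>\<in>P. norm (m \<delta>)) ` finite_families)"
    using variation_le by (intro bdd_aboveI [of _ C]) (auto simp: finite_families_def)
  have ne: "finite_families \<noteq> {}"
    by (auto simp: finite_families_def intro: exI [of _ "{}"])
  have V: "(\<Sum>\<delta>\<in>P. norm (m \<delta>)) \<le> V" if "P \<in> finite_families" for P
    unfolding V_def using that bdd by (rule cSUP_upper)
  obtain P where P: "P \<in> finite_families" "V - e / 2 < (\<Sum>\<delta>\<in>P. norm (m \<delta>))"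
    using less_cSUP_iff [OF ne bdd, of "V - e / 2"] \<open>e > 0\<close> by (auto simp: V_def)
  have fin: "finite P"
    using P by (simp add: finite_families_def)
  \<comment> \<open>Truncating all members of P costs at most e / 2 together; the other e / 2 was
    spent on the choice of P. The added 1 covers an empty P.\<close>
  define \<eta> where "\<eta> = e / (2 * (real (card P) + 1))"
  have \<eta>: "\<eta> > 0" "real (card P) * \<eta> \<le> e / 2"
    using \<open>e > 0\<close> by (auto simp: \<eta>_def field_simps)
  have "\<forall>\<^sub>F N in sequentially. \<forall>\<delta>\<in>P. norm (m \<delta>) - \<eta> \<le> norm (m (\<delta> \<inter> {x. \<bar>x\<bar> < real N}))"
    using P \<eta>(1) by (intro eventually_ball_finite fin ballI norm_truncation) (auto simp: finite_families_def)
  then obtain N where N: "\<And>\<delta>. \<delta> \<in> P \<Longrightarrow> norm (m \<delta>) - \<eta> \<le> norm (m (\<delta> \<inter> {x. \<bar>x\<bar> < real N}))"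
    using eventually_happens'[OF sequentially_bot] by blast
  have "(\<Sum>i\<in>I. norm (m (A i))) \<le> e"
    if A: "finite I" "disjoint_family_on A I" "\<And>i. i \<in> I \<Longrightarrow> A i \<in> sets borel"
      "\<And>i. i \<in> I \<Longrightarrow> A i \<subseteq> S \<inter> {x. real N \<le> \<bar>x\<bar>}" for I :: "'i set" and A
  proof -
    \<comment> \<open>The truncated members of P together with the tail family form one disjoint
      family inside S, so V bounds their joint sum. The disjoint sum serves as index set.\<close>
    define B where "B = case_sum (\<lambda>\<delta>. \<delta> \<inter> {x. \<bar>x\<bar> < real N}) A"
    have "(\<Sum>k\<in>P <+> I. norm (m (B k))) \<le> V"
    proof (rule indexed_variation_le_of)
      have dP: "disjoint P" and bP: "P \<subseteq> sets borel" "\<Union>P \<subseteq> S"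
        using P by (auto simp: finite_families_def)
      have tr: "{x. \<bar>x\<bar> < real N} \<in> sets borel"
        by measurable
      show "disjoint_family_on B (P <+> I)"
        unfolding disjoint_family_on_def
      proof (intro ballI impI)
        fix k k' assume k: "k \<in> P <+> I" "k' \<in> P <+> I" "k \<noteq> k'"
        have PP: "B (Inl \<delta>) \<inter> B (Inl \<delta>') = {}" if "\<delta> \<in> P" "\<delta>' \<in> P" "\<delta> \<noteq> \<delta>'" for \<delta> \<delta>'
          using that dP unfolding disjoint_def B_def by auto
        have II: "B (Inr i) \<inter> B (Inr j) = {}" if "i \<in> I" "j \<in> I" "i \<noteq> j" for i j
          using that A(2) unfolding disjoint_family_on_def B_def by auto
        have PI: "B (Inl \<delta>) \<inter> B (Inr i) = {}" if "i \<in> I" for \<delta> i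
          using A(4) [OF that] by (auto simp: B_def)
        show "B k \<inter> B k' = {}"
          using k PP II PI by (metis Int_commute PlusE)
      qed
      show "B k \<in> sets borel" if "k \<in> P <+> I" for k
        using that bP A(3) tr by (auto simp: B_def)
      show "B k \<subseteq> S" if "k \<in> P <+> I" for k
      proof (cases k)
        case (Inl \<delta>)
        then show ?thesis
          using that bP(2) by (auto simp: B_def)
      next
        case (Inr i)
        then show ?thesis
          using that A(4) [of i] by (auto simp: B_def)
      qed
    qed (use V A fin in auto)
    then have "(\<Sum>\<delta>\<in>P. norm (m (\<delta> \<inter> {x. \<bar>x\<bar> < real N}))) + (\<Sum>i\<in>I. norm (m (A i))) \<le> V"
      using fin A(1) by (simp add: sum.Plus B_def)
    moreover have "(\<Sum>\<delta>\<in>P. norm (m \<delta>) - \<eta>) \<le> (\<Sum>\<delta>\<in>P. norm (m (\<delta> \<inter> {x. \<bar>x\<bar> < real N})))"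
      using N by (rule sum_mono)
    then have "(\<Sum>\<delta>\<in>P. norm (m \<delta>)) - real (card P) * \<eta> \<le> (\<Sum>\<delta>\<in>P. norm (m (\<delta> \<inter> {x. \<bar>x\<bar> < real N})))"
      by (simp add: sum_subtractf)
    ultimately show ?thesis
      using P(2) \<eta>(2) by linarith
  qed
  then show ?thesis by blast
qed

text \<open>A grid of width \<eta> on |x| < N, with everything beyond as a single cell. The
  labelling \<open>f\<close> takes finitely many values, so the partition is finite.\<close>

lemma small_partition_exists:
  assumes "\<eta> > 0"
  shows "\<exists>P. finite P \<and> borel_partition S P \<and>
    (\<forall>p\<in>P. p \<subseteq> {x. real N \<le> \<bar>x\<bar>} \<or> (\<forall>x\<in>p. \<forall>y\<in>p. \<bar>x - y\<bar> < \<eta>))"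
proof -
  define f where "f x = (if \<bar>x\<bar> < real N then Some \<lfloor>x / \<eta>\<rfloor> else None)" for x :: real
  define P where "P = (\<lambda>k. S \<inter> f -` {k}) ` (f ` S)"
  have "f x \<in> insert None (Some ` {\<lfloor>- real N / \<eta>\<rfloor>..\<lfloor>real N / \<eta>\<rfloor>})" for x
  proof (cases "\<bar>x\<bar> < real N")
    case True
    then have "\<lfloor>x / \<eta>\<rfloor> \<in> {\<lfloor>- real N / \<eta>\<rfloor>..\<lfloor>real N / \<eta>\<rfloor>}"
      using assms unfolding atLeastAtMost_iff
      by (intro conjI floor_mono divide_right_mono) auto
    then show ?thesis
      using True by (simp only: f_def if_True) blast
  qed (simp add: f_def)
  then have "f ` S \<subseteq> insert None (Some ` {\<lfloor>- real N / \<eta>\<rfloor>..\<lfloor>real N / \<eta>\<rfloor>})"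
    by (meson image_subsetI)
  then have "finite (f ` S)"
    by (rule finite_subset) auto
  then have fin: "finite P"
    by (simp add: P_def)
  have "partition_on S P"
    by (rule partition_onI) (auto simp: P_def disjnt_def)
  moreover have "f -` {k} \<in> sets borel" for k
  proof (cases k)
    case None
    then have "f -` {k} = {x. real N \<le> \<bar>x\<bar>}"
      by (auto simp: f_def split: if_splits)
    then show ?thesis by simp
  next
    case (Some j)
    then have "f -` {k} = {x. \<bar>x\<bar> < real N \<and> \<lfloor>x / \<eta>\<rfloor> = j}"
      by (auto simp: f_def split: if_splits)
    moreover have "{x. \<bar>x\<bar> < real N \<and> \<lfloor>x / \<eta>\<rfloor> = j} \<in> sets borel"
      by measurable
    ultimately show ?thesis by simp
  qed
  then have "P \<subseteq> sets borel"
    using S_borel by (auto simp: P_def)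
  ultimately have part: "borel_partition S P"
    using fin by (simp add: borel_partition_def countable_finite)
  have "p \<subseteq> {x. real N \<le> \<bar>x\<bar>} \<or> (\<forall>x\<in>p. \<forall>y\<in>p. \<bar>x - y\<bar> < \<eta>)" if p: "p \<in> P" for p
  proof -
    obtain k where k: "p = S \<inter> f -` {k}"
      using p by (auto simp: P_def)
    show ?thesis
    proof (cases k)
      case None
      then show ?thesis
        by (auto simp: k f_def split: if_splits)
    next
      case (Some j)
      have "\<bar>x - y\<bar> < \<eta>" if "x \<in> p" "y \<in> p" for x y
      proof -
        have "\<lfloor>x / \<eta>\<rfloor> = j" "\<lfloor>y / \<eta>\<rfloor> = j"
          using that by (auto simp: k Some f_def split: if_splits)
        then have "\<bar>x / \<eta> - y / \<eta>\<bar> < 1"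
          by linarith
        then have "\<bar>x - y\<bar> / \<eta> < 1"
          using \<open>\<eta> > 0\<close> by (metis abs_divide abs_of_pos diff_divide_distrib)
        then show ?thesis
          using \<open>\<eta> > 0\<close> by simp
      qed
      then show ?thesis by blast
    qed
  qed
  with fin part show ?thesis by blast
qed

text \<open>Both sums are split over the cells \<open>p \<inter> q\<close>; empty cells do no harm
  because \<open>m {} = 0\<close>.\<close>

lemma measure_sum_diff:
  assumes P: "finite P" "borel_partition S P" and Q: "finite Q" "borel_partition S Q"
  shows "measure_sum m T P \<tau> - measure_sum m T Q \<sigma> =
    (\<Sum>(p, q)\<in>P \<times> Q. m (p \<inter> q) o\<^sub>L (T (complex_of_real (\<tau> p)) - T (complex_of_real (\<sigma> q))))"
proof -
  have sub: "p \<in> sets borel \<and> p \<subseteq> S" if "p \<in> R" "borel_partition S R" for p R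
    using that by (auto simp: borel_partition_def partition_on_def)
  have "measure_sum m T P \<tau> = (\<Sum>p\<in>P. \<Sum>q\<in>Q. m (p \<inter> q) o\<^sub>L T (complex_of_real (\<tau> p)))"
    unfolding measure_sum_def
    using sub [OF _ P(2)] by (intro sum.cong refl)
      (subst m_split [OF Q], auto simp: bounded_bilinear.sum_left [OF bounded_bilinear_blinfun_compose])
  moreover have "measure_sum m T Q \<sigma> = (\<Sum>q\<in>Q. \<Sum>p\<in>P. m (p \<inter> q) o\<^sub>L T (complex_of_real (\<sigma> q)))"
    unfolding measure_sum_def
    using sub [OF _ Q(2)] by (intro sum.cong refl)
      (subst m_split [OF P], auto simp: bounded_bilinear.sum_left [OF bounded_bilinear_blinfun_compose] Int_commute)
  moreover have "\<dots> = (\<Sum>p\<in>P. \<Sum>q\<in>Q. m (p \<inter> q) o\<^sub>L T (complex_of_real (\<sigma> q)))"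
    by (rule sum.swap)
  ultimately show ?thesis
    by (simp add: sum.cartesian_product [symmetric] blinfun_compose_diff_right sum_subtractf)
qed

lemma measure_sum_in_bounded_ops:
  assumes "\<And>\<delta>. \<delta> \<in> sets borel \<Longrightarrow> m \<delta> \<in> bounded_ops" "\<And>x. x \<in> S \<Longrightarrow> T (complex_of_real x) \<in> bounded_ops"
    and P: "borel_partition S P" "\<forall>\<delta>\<in>P. \<tau> \<delta> \<in> \<delta>"
  shows "measure_sum m T P \<tau> \<in> bounded_ops"
  unfolding measure_sum_def
proof (intro sum_in_bounded_ops compose_in_bounded_ops assms)
  show "\<delta> \<in> sets borel" "\<tau> \<delta> \<in> S" if "\<delta> \<in> P" for \<delta>
    using P that by (auto simp: borel_partition_def partition_on_def)
qed

text \<open>In a short cell of P0 the two tagged values of T differ by at most e', against total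
  variation C. In the unbounded cell they differ by at most 2 M, against a tail variation of at most
  e'.\<close>

lemma measure_sum_cauchy:
  fixes T :: "complex \<Rightarrow> ('c::complex_hilbert_space \<Rightarrow>\<^sub>L 'a)"
  assumes T_bound: "\<And>x. x \<in> S \<Longrightarrow> norm (T (complex_of_real x)) \<le> M"
    and T_cont: "uniformly_continuous_on S (\<lambda>x. T (complex_of_real x))" and "M \<ge> 0" "e > 0"
  shows "\<exists>P0. finite P0 \<and> borel_partition S P0 \<and>
    (\<forall>P \<tau> Q \<sigma>. finite P \<longrightarrow> borel_partition S P \<longrightarrow> refines S P P0 \<longrightarrow> (\<forall>\<delta>\<in>P. \<tau> \<delta> \<in> \<delta>) \<longrightarrow>
      finite Q \<longrightarrow> borel_partition S Q \<longrightarrow> refines S Q P0 \<longrightarrow> (\<forall>\<delta>\<in>Q. \<sigma> \<delta> \<in> \<delta>) \<longrightarrow>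
      norm (measure_sum m T P \<tau> - measure_sum m T Q \<sigma>) < e)"
proof -
  \<comment> \<open>Chosen so that e' C from the short cells plus 2 M e' from the tail stays below
    e.\<close>
  define e' where "e' = e / (C + 2 * M + 1)"
  have pos: "C + 2 * M + 1 > 0"
    using C_nonneg \<open>M \<ge> 0\<close> by simp
  then have e': "e' > 0" "e' * C + 2 * M * e' < e"
  proof -
    show "e' > 0"
      using \<open>e > 0\<close> pos by (simp add: e'_def)
    then have "e' * (C + 2 * M) < e' * (C + 2 * M + 1)"
      by (intro mult_strict_left_mono) auto
    also have "\<dots> = e"
      using pos by (simp add: e'_def)
    finally show "e' * C + 2 * M * e' < e"
      by (simp add: algebra_simps)
  qed
  obtain \<eta> where \<eta>: "\<eta> > 0"
    "\<And>x y. x \<in> S \<Longrightarrow> y \<in> S \<Longrightarrow> dist x y < \<eta> \<Longrightarrow> dist (T (complex_of_real x)) (T (complex_of_real y)) < e'"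
    using T_cont e'(1) unfolding uniformly_continuous_on_def by metis
  obtain N :: nat where N: "\<forall>(I :: (real set \<times> real set) set) A. finite I \<longrightarrow> disjoint_family_on A I \<longrightarrow>
      (\<forall>i\<in>I. A i \<in> sets borel) \<longrightarrow> (\<forall>i\<in>I. A i \<subseteq> S \<inter> {x. real N \<le> \<bar>x\<bar>}) \<longrightarrow> (\<Sum>i\<in>I. norm (m (A i))) \<le> e'"
    using tail_variation [OF e'(1)] ..
  obtain P0 where P0: "finite P0" "borel_partition S P0"
    and small: "\<And>p. p \<in> P0 \<Longrightarrow> p \<subseteq> {x. real N \<le> \<bar>x\<bar>} \<or> (\<forall>x\<in>p. \<forall>y\<in>p. \<bar>x - y\<bar> < \<eta>)"
    using small_partition_exists [OF \<eta>(1), of N] by metis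
  have "norm (measure_sum m T P \<tau> - measure_sum m T Q \<sigma>) < e"
    if P: "finite P" "borel_partition S P" "refines S P P0" "\<forall>\<delta>\<in>P. \<tau> \<delta> \<in> \<delta>"
      and Q: "finite Q" "borel_partition S Q" "refines S Q P0" "\<forall>\<delta>\<in>Q. \<sigma> \<delta> \<in> \<delta>" for P \<tau> Q \<sigma>
  proof -
    let ?tail = "{x. real N \<le> \<bar>x\<bar>}"
    have parts: "partition_on S P" "partition_on S Q" "partition_on S P0" "P \<subseteq> sets borel" "Q \<subseteq> sets borel"
      using P(2) Q(2) P0(2) by (auto simp: borel_partition_def)
    have PS: "p \<subseteq> S" if "p \<in> P" for p
      using parts(1) that by (auto simp: partition_on_def)
    have QS: "q \<subseteq> S" if "q \<in> Q" for q
      using parts(2) that by (auto simp: partition_on_def)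
    have cells: "p \<inter> q \<in> sets borel" "p \<inter> q \<subseteq> S" if "p \<in> P" "q \<in> Q" for p q
      using that parts(4,5) PS by auto
    note disj = disjoint_family_on_partition_Int [OF parts(1,2)]
    have cell: "norm (m (p \<inter> q) o\<^sub>L (T (complex_of_real (\<tau> p)) - T (complex_of_real (\<sigma> q))))
        \<le> e' * norm (m (p \<inter> q)) + 2 * M * norm (m (p \<inter> q \<inter> ?tail))" if pq: "p \<in> P" "q \<in> Q" for p q
    proof (cases "p \<inter> q = {}")
      case False
      obtain p0 q0 where p0: "p0 \<in> P0" "p \<subseteq> p0" and q0: "q0 \<in> P0" "q \<subseteq> q0"
        using P(3) Q(3) pq unfolding refines_def by meson
      \<comment> \<open>Sets p and q that meet lie in the same cell of P0, so both tags belong to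
        that cell.\<close>
      then have "p0 = q0"
        using False disjointD [OF partition_onD2 [OF parts(3)]] by blast
      have tags: "\<tau> p \<in> p" "\<sigma> q \<in> q"
        using P(4) Q(4) pq by auto
      then have in_S: "\<tau> p \<in> S" "\<sigma> q \<in> S"
        using PS QS pq by auto
      let ?D = "T (complex_of_real (\<tau> p)) - T (complex_of_real (\<sigma> q))"
      from small [OF p0(1)] show ?thesis
      proof
        assume "p0 \<subseteq> ?tail"
        then have eq: "p \<inter> q \<inter> ?tail = p \<inter> q"
          using p0 by auto
        have "norm ?D \<le> M + M"
          using T_bound [OF in_S(1)] T_bound [OF in_S(2)] norm_triangle_ineq4 order_trans add_mono by meson
        then have "norm (m (p \<inter> q) o\<^sub>L ?D) \<le> norm (m (p \<inter> q)) * (M + M)"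
          by (intro norm_blinfun_compose_le) auto
        moreover have "e' * norm (m (p \<inter> q)) \<ge> 0"
          using e' by simp
        ultimately show ?thesis
          unfolding eq by (simp add: algebra_simps)
      next
        assume "\<forall>x\<in>p0. \<forall>y\<in>p0. \<bar>x - y\<bar> < \<eta>"
        then have "\<bar>\<tau> p - \<sigma> q\<bar> < \<eta>"
          using tags p0 q0 \<open>p0 = q0\<close> by blast
        then have "norm ?D \<le> e'"
          using \<eta>(2) [OF in_S] by (simp add: dist_norm)
        then have "norm (m (p \<inter> q) o\<^sub>L ?D) \<le> norm (m (p \<inter> q)) * e'"
          by (intro norm_blinfun_compose_le) auto
        moreover have "2 * M * norm (m (p \<inter> q \<inter> ?tail)) \<ge> 0"
          using \<open>M \<ge> 0\<close> by simp
        ultimately show ?thesis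
          by (simp add: mult.commute)
      qed
    qed simp
    have "norm (measure_sum m T P \<tau> - measure_sum m T Q \<sigma>)
        \<le> (\<Sum>(p, q)\<in>P \<times> Q. e' * norm (m (p \<inter> q)) + 2 * M * norm (m (p \<inter> q \<inter> ?tail)))"
      unfolding measure_sum_diff [OF P(1,2) Q(1,2)] using cell by (intro sum_norm_le) auto
    also have "\<dots> = e' * (\<Sum>(p, q)\<in>P \<times> Q. norm (m (p \<inter> q))) + 2 * M * (\<Sum>(p, q)\<in>P \<times> Q. norm (m (p \<inter> q \<inter> ?tail)))"
      by (simp add: sum.distrib sum_distrib_left case_prod_beta)
    also have "\<dots> \<le> e' * C + 2 * M * e'"
    proof (intro add_mono mult_left_mono)
      show "(\<Sum>(p, q)\<in>P \<times> Q. norm (m (p \<inter> q))) \<le> C"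
        using indexed_variation_le [OF _ disj] P(1) Q(1) cells
        by (simp add: case_prod_beta mem_Times_iff)
      have "disjoint_family_on (\<lambda>(p, q). p \<inter> q \<inter> ?tail) (P \<times> Q)"
        by (rule disjoint_family_on_bisimulation [OF disj]) auto
      moreover have "?tail \<in> sets borel"
        by measurable
      ultimately have "(\<Sum>i\<in>P \<times> Q. norm (m (case i of (p, q) \<Rightarrow> p \<inter> q \<inter> ?tail))) \<le> e'"
        using P(1) Q(1) cells by (intro N [rule_format]) (auto dest: PS [THEN subsetD])
      then show "(\<Sum>(p, q)\<in>P \<times> Q. norm (m (p \<inter> q \<inter> ?tail))) \<le> e'"
        by (simp add: case_prod_beta)
    qed (use e' \<open>M \<ge> 0\<close> in auto)
    finally show ?thesis
      using e'(2) by simp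
  qed
  with P0 show ?thesis by blast
qed

text \<open>Completeness is applied along partitions P0 n with tolerance 1 / (n + 1); the limit then
  serves for all partitions that refine a late P0 n.\<close>

lemma measure_integral_exists:
  fixes T :: "complex \<Rightarrow> ('c::complex_hilbert_space \<Rightarrow>\<^sub>L 'a)"
  assumes T_bound: "\<And>x. x \<in> S \<Longrightarrow> norm (T (complex_of_real x)) \<le> M"
    and T_cont: "uniformly_continuous_on S (\<lambda>x. T (complex_of_real x))" and "M \<ge> 0"
  shows "\<exists>I. \<forall>\<epsilon>>0. \<exists>P0. finite P0 \<and> borel_partition S P0 \<and>
      (\<forall>P \<tau>. finite P \<longrightarrow> borel_partition S P \<longrightarrow> refines S P P0 \<longrightarrow> (\<forall>\<delta>\<in>P. \<tau> \<delta> \<in> \<delta>) \<longrightarrow>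
        norm (measure_sum m T P \<tau> - I) < \<epsilon>)"
proof -
  have "\<exists>P0. finite P0 \<and> borel_partition S P0 \<and>
    (\<forall>P \<tau> Q \<sigma>. finite P \<longrightarrow> borel_partition S P \<longrightarrow> refines S P P0 \<longrightarrow> (\<forall>\<delta>\<in>P. \<tau> \<delta> \<in> \<delta>) \<longrightarrow>
      finite Q \<longrightarrow> borel_partition S Q \<longrightarrow> refines S Q P0 \<longrightarrow> (\<forall>\<delta>\<in>Q. \<sigma> \<delta> \<in> \<delta>) \<longrightarrow>
      norm (measure_sum m T P \<tau> - measure_sum m T Q \<sigma>) < inverse (real (Suc n)))" for n
    by (rule measure_sum_cauchy [OF assms]) auto
  then obtain P0 where P0: "\<And>n. finite (P0 n)" "\<And>n. borel_partition S (P0 n)"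
    and close: "\<And>n P \<tau> Q \<sigma>. finite P \<Longrightarrow> borel_partition S P \<Longrightarrow> refines S P (P0 n) \<Longrightarrow> (\<forall>\<delta>\<in>P. \<tau> \<delta> \<in> \<delta>) \<Longrightarrow>
      finite Q \<Longrightarrow> borel_partition S Q \<Longrightarrow> refines S Q (P0 n) \<Longrightarrow> (\<forall>\<delta>\<in>Q. \<sigma> \<delta> \<in> \<delta>) \<Longrightarrow>
      norm (measure_sum m T P \<tau> - measure_sum m T Q \<sigma>) < inverse (real (Suc n))"
    by metis
  obtain \<rho> where \<rho>: "\<And>n. \<forall>\<delta>\<in>P0 n. \<rho> n \<delta> \<in> \<delta>"
    using borel_partition_tags_exist [OF P0(2)] by metis
  have refl: "refines S (P0 n) (P0 n)" for n
    using P0(2) [of n] by (auto simp: borel_partition_def refines_refl)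
  define s where "s n = measure_sum m T (P0 n) (\<rho> n)" for n
  have small: "\<exists>k0. \<forall>k\<ge>k0. inverse (real (Suc k)) < e" if "e > 0" for e
    using order_tendstoD(2) [OF LIMSEQ_inverse_real_of_nat that] by (simp add: eventually_sequentially)
  have "Cauchy s"
    unfolding Cauchy_def
  proof (intro allI impI)
    fix e :: real assume "e > 0"
    then obtain k0 where k0: "\<And>k. k \<ge> k0 \<Longrightarrow> inverse (real (Suc k)) < e / 2"
      using small [of "e / 2"] by auto
    have "dist (s i) (s j) < e" if ij: "i \<ge> k0" "j \<ge> k0" for i j
    proof -
      \<comment> \<open>The P0 n need not be nested, so two of them are compared through a common
        refinement.\<close>
      obtain R where R: "finite R" "borel_partition S R" "refines S R (P0 i)" "refines S R (P0 j)"
        using borel_partition_common_refinement [OF P0(1,2) P0(1,2)] by blast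
      obtain \<tau> where \<tau>: "\<forall>\<delta>\<in>R. \<tau> \<delta> \<in> \<delta>"
        using borel_partition_tags_exist [OF R(2)] by blast
      have "norm (s i - measure_sum m T R \<tau>) < e / 2" "norm (s j - measure_sum m T R \<tau>) < e / 2"
        using close [OF P0(1,2) refl \<rho> R(1,2) _ \<tau>] R(3,4) k0 [OF ij(1)] k0 [OF ij(2)]
        unfolding s_def by (meson less_trans)+
      then show ?thesis
        using dist_triangle_half_l [of "s i" "measure_sum m T R \<tau>" e "s j"] by (simp add: dist_norm)
    qed
    then show "\<exists>k. \<forall>i\<ge>k. \<forall>j\<ge>k. dist (s i) (s j) < e"
      by blast
  qed
  then obtain I where I: "s \<longlonglongrightarrow> I"
    by (meson Cauchy_convergent_iff convergent_def)
  have "\<exists>P0. finite P0 \<and> borel_partition S P0 \<and>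
      (\<forall>P \<tau>. finite P \<longrightarrow> borel_partition S P \<longrightarrow> refines S P P0 \<longrightarrow> (\<forall>\<delta>\<in>P. \<tau> \<delta> \<in> \<delta>) \<longrightarrow>
        norm (measure_sum m T P \<tau> - I) < e)" if "e > 0" for e
  proof -
    have "e / 2 > 0"
      using \<open>e > 0\<close> by simp
    obtain k0 where k0: "\<And>k. k \<ge> k0 \<Longrightarrow> inverse (real (Suc k)) < e / 2"
      using small [OF \<open>e / 2 > 0\<close>] by auto
    obtain k1 where k1: "\<And>k. k \<ge> k1 \<Longrightarrow> norm (s k - I) < e / 2"
      using LIMSEQ_D [OF I \<open>e / 2 > 0\<close>] by auto
    define k where "k = max k0 k1"
    have "norm (measure_sum m T P \<tau> - I) < e"
      if P: "finite P" "borel_partition S P" "refines S P (P0 k)" "\<forall>\<delta>\<in>P. \<tau> \<delta> \<in> \<delta>" for P \<tau>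
    proof -
      have "norm (measure_sum m T P \<tau> - s k) < inverse (real (Suc k))"
        unfolding s_def by (rule close [OF P P0(1,2) refl \<rho>])
      moreover have "inverse (real (Suc k)) < e / 2" "norm (s k - I) < e / 2"
        using k0 [of k] k1 [of k] by (auto simp: k_def)
      ultimately show ?thesis
        using norm_triangle_ineq [of "measure_sum m T P \<tau> - s k" "s k - I"] by simp
    qed
    then show ?thesis
      using P0(1) [of k] P0(2) [of k] by blast
  qed
  then show ?thesis by blast
qed

lemma measure_sum_norm_diff_le:
  assumes ST: "\<And>x. x \<in> S \<Longrightarrow> norm (U (complex_of_real x) - T (complex_of_real x)) \<le> K" and "K \<ge> 0"
    and P: "finite P" "borel_partition S P" "\<forall>\<delta>\<in>P. \<tau> \<delta> \<in> \<delta>"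
  shows "norm (measure_sum m U P \<tau> - measure_sum m T P \<tau>) \<le> K * C"
proof -
  have part: "partition_on S P" "P \<subseteq> sets borel"
    using P by (auto simp: borel_partition_def)
  have PS: "p \<subseteq> S" if "p \<in> P" for p
    using part(1) that by (auto simp: partition_on_def)
  have "measure_sum m U P \<tau> - measure_sum m T P \<tau>
      = (\<Sum>\<delta>\<in>P. m \<delta> o\<^sub>L (U (complex_of_real (\<tau> \<delta>)) - T (complex_of_real (\<tau> \<delta>))))"
    by (simp add: measure_sum_def blinfun_compose_diff_right sum_subtractf)
  also have "norm \<dots> \<le> (\<Sum>\<delta>\<in>P. norm (m \<delta>) * K)"
    using P(3) PS by (intro sum_norm_le norm_blinfun_compose_le ST) auto
  also have "\<dots> = K * (\<Sum>\<delta>\<in>P. norm (m \<delta>))"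
    by (simp add: sum_distrib_left mult.commute)
  also have "\<dots> \<le> K * C"
    using P(1) part PS partition_onD2 [OF part(1)] partition_onD3 [OF part(1)] \<open>K \<ge> 0\<close>
    by (intro mult_left_mono variation_le) auto
  finally show ?thesis .
qed

end

text \<open>On a common refinement with common tags both integrals are approximated at once, and the
  sums differ by at most K times the variation.\<close>

lemma has_spectral_integral_diff_le:
  assumes m: "operator_measure (\<lambda>\<delta>. B10 o\<^sub>L E0 \<delta> o\<^sub>L B01) S C"
    and I: "has_spectral_integral B10 E0 B01 S U I" and J: "has_spectral_integral B10 E0 B01 S T J"
    and UT: "\<And>x. x \<in> S \<Longrightarrow> norm (U (complex_of_real x) - T (complex_of_real x)) \<le> K" and "K \<ge> 0"
  shows "norm (I - J) \<le> K * C"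
proof (rule field_le_epsilon)
  fix e :: real assume "e > 0"
  interpret operator_measure "\<lambda>\<delta>. B10 o\<^sub>L E0 \<delta> o\<^sub>L B01" S C
    by (rule m)
  let ?m = "\<lambda>\<delta>. B10 o\<^sub>L E0 \<delta> o\<^sub>L B01"
  have "e / 2 > 0"
    using \<open>e > 0\<close> by simp
  obtain P where P: "finite P" "borel_partition S P" "\<And>R \<tau>. finite R \<Longrightarrow> borel_partition S R \<Longrightarrow>
      refines S R P \<Longrightarrow> (\<forall>\<delta>\<in>R. \<tau> \<delta> \<in> \<delta>) \<Longrightarrow> norm (measure_sum ?m U R \<tau> - I) < e / 2"
    using I \<open>e / 2 > 0\<close> unfolding has_spectral_integral_iff by meson
  obtain Q where Q: "finite Q" "borel_partition S Q" "\<And>R \<tau>. finite R \<Longrightarrow> borel_partition S R \<Longrightarrow>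
      refines S R Q \<Longrightarrow> (\<forall>\<delta>\<in>R. \<tau> \<delta> \<in> \<delta>) \<Longrightarrow> norm (measure_sum ?m T R \<tau> - J) < e / 2"
    using J \<open>e / 2 > 0\<close> unfolding has_spectral_integral_iff by meson
  obtain R where R: "finite R" "borel_partition S R" "refines S R P" "refines S R Q"
    using borel_partition_common_refinement [OF P(1,2) Q(1,2)] by blast
  obtain \<tau> where \<tau>: "\<forall>\<delta>\<in>R. \<tau> \<delta> \<in> \<delta>"
    using borel_partition_tags_exist [OF R(2)] by blast
  define A where "A = measure_sum ?m U R \<tau>"
  define B where "B = measure_sum ?m T R \<tau>"
  have "norm (A - I) < e / 2" "norm (B - J) < e / 2"
    unfolding A_def B_def using P(3) Q(3) R \<tau> by auto
  moreover have "norm (A - B) \<le> K * C"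
    unfolding A_def B_def using UT \<open>K \<ge> 0\<close> R(1,2) \<tau> by (rule measure_sum_norm_diff_le)
  moreover have "I - J = (A - B) - (A - I) + (B - J)"
    by simp
  then have "norm (I - J) \<le> norm (A - B) + norm (A - I) + norm (B - J)"
    by (metis (no_types, lifting) add_right_mono norm_triangle_ineq norm_triangle_ineq4 order_trans)
  ultimately show "norm (I - J) \<le> K * C + e"
    by linarith
qed

lemma has_spectral_integral_in_bounded_ops:
  assumes m: "operator_measure (\<lambda>\<delta>. B10 o\<^sub>L E0 \<delta> o\<^sub>L B01) S C"
    and ops: "\<And>\<delta>. \<delta> \<in> sets borel \<Longrightarrow> B10 o\<^sub>L E0 \<delta> o\<^sub>L B01 \<in> bounded_ops"
    and T: "\<And>x. x \<in> S \<Longrightarrow> T (complex_of_real x) \<in> bounded_ops"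
    and I: "has_spectral_integral B10 E0 B01 S T I"
  shows "I \<in> bounded_ops"
proof -
  interpret operator_measure "\<lambda>\<delta>. B10 o\<^sub>L E0 \<delta> o\<^sub>L B01" S C
    by (rule m)
  have "I \<in> closure bounded_ops"
    unfolding closure_approachable
  proof (intro allI impI)
    fix e :: real assume "e > 0"
    then obtain P where P: "finite P" "borel_partition S P" "\<And>R \<tau>. finite R \<Longrightarrow> borel_partition S R \<Longrightarrow>
        refines S R P \<Longrightarrow> (\<forall>\<delta>\<in>R. \<tau> \<delta> \<in> \<delta>) \<Longrightarrow>
        norm (measure_sum (\<lambda>\<delta>. B10 o\<^sub>L E0 \<delta> o\<^sub>L B01) T R \<tau> - I) < e"
      using I unfolding has_spectral_integral_iff by meson
    obtain \<tau> where \<tau>: "\<forall>\<delta>\<in>P. \<tau> \<delta> \<in> \<delta>"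
      using borel_partition_tags_exist [OF P(2)] by blast
    have "refines S P P"
      using P(2) by (auto simp: borel_partition_def refines_refl)
    then have "norm (measure_sum (\<lambda>\<delta>. B10 o\<^sub>L E0 \<delta> o\<^sub>L B01) T P \<tau> - I) < e"
      using P \<tau> by blast
    moreover have "measure_sum (\<lambda>\<delta>. B10 o\<^sub>L E0 \<delta> o\<^sub>L B01) T P \<tau> \<in> bounded_ops"
      using ops T P(2) \<tau> by (rule measure_sum_in_bounded_ops)
    ultimately show "\<exists>y\<in>bounded_ops. dist y I < e"
      by (auto simp: dist_norm)
  qed
  then show ?thesis
    by (simp add: closed_bounded_ops)
qed

lemma has_spectral_integral_zero:
  assumes "borel_partition S P" "finite P"
  shows "has_spectral_integral B10 E0 B01 S (\<lambda>_. 0) 0"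
  unfolding has_spectral_integral_iff
proof (intro allI impI exI conjI)
  show "norm (measure_sum (\<lambda>\<delta>. B10 o\<^sub>L E0 \<delta> o\<^sub>L B01) (\<lambda>_. 0) R \<tau> - 0) < \<epsilon>" if "\<epsilon> > 0" for R \<tau> \<epsilon>
    using that by (simp add: measure_sum_def)
qed (use assms in blast)+

section \<open>The contraction\<close>

text \<open>Self-adjointness gives norm R1 \<le> 1/d, and the Neumann bound turns this into (1/d) /
  (1 - norm X / d) = 1 / (d - norm X).\<close>

lemma perturbed_resolvent_exists:
  fixes X :: "'a::complex_hilbert_space \<Rightarrow>\<^sub>L 'a"
  assumes A: "self_adjoint A" and d: "\<And>s. s \<in> spectrum A \<Longrightarrow> d \<le> dist s z"
    and X: "X \<in> bounded_ops" "norm X < d"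
  shows "\<exists>R. is_resolvent (graph_plus A X) z R \<and> norm R \<le> 1 / (d - norm X)"
proof -
  have "d > 0"
    using X(2) norm_ge_zero [of X] by linarith
  then have "z \<notin> spectrum A"
    using d [of z] by auto
  then obtain R1 where R1: "is_resolvent A z R1"
    using not_in_spectrumD by blast
  have R1_le: "norm R1 * d \<le> 1"
    using \<open>d > 0\<close> by (intro self_adjoint_resolvent_norm_le [OF A R1] d) auto
  have "norm R1 * norm X < 1"
  proof (cases "R1 = 0")
    case False
    then have "norm R1 * norm X < norm R1 * d"
      using X(2) by (intro mult_strict_left_mono) auto
    then show ?thesis
      using R1_le by simp
  qed simp
  then obtain R where R: "is_resolvent (graph_plus A X) z R"
      "norm R * (1 - norm R1 * norm X) \<le> norm R1"
    using resolvent_graph_plus_exists [OF R1 X(1)] by blast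
  have "norm R1 * d * norm X \<le> 1 * norm X"
    using R1_le by (intro mult_right_mono) auto
  then have "norm R * (d - norm X) \<le> norm R * (d - norm R1 * d * norm X)"
    by (intro mult_left_mono) auto
  also have "\<dots> = norm R * (1 - norm R1 * norm X) * d"
    by (simp add: algebra_simps)
  also have "\<dots> \<le> norm R1 * d"
    using R(2) \<open>d > 0\<close> by (intro mult_right_mono) auto
  finally have "norm R \<le> 1 / (d - norm X)"
    using R1_le X(2) by (simp add: field_simps)
  with R(1) show ?thesis by blast
qed

lemma resolvent_unique: "is_resolvent A z R \<Longrightarrow> is_resolvent A z S \<Longrightarrow> R = S"
proof -
  assume "is_resolvent A z R" "is_resolvent A z S"
  then have "R - S = op_scale 0 (R o\<^sub>L S)"
    using resolvent_diff by fastforce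
  then have "norm (R - S) \<le> 0"
    using norm_op_scale_le [of 0 "R o\<^sub>L S"] by simp
  then show "R = S"
    by simp
qed

lemma has_op_contour_integral_zero: "has_op_contour_integral (\<lambda>_. 0) g 0"
  unfolding has_op_contour_integral_def
  by (intro exI [of _ "\<lambda>_ _. 0"]) (auto simp: has_stieltjes_integral_zero case_prod_beta')

text \<open>Conjugation is an isometry and taking adjoints does not increase norms, so a \<delta>
  that works for F at \<open>cnj z\<close> also works at z. This carries K_B' from the lower to the
  upper domain.\<close>

lemma compose_adjoint_continuous_on:
  assumes F: "continuous_on D F" and adj: "\<And>z. cnj z \<in> D \<Longrightarrow> is_adjoint (F (cnj z)) (F z)"
  shows "continuous_on {z. cnj z \<in> D} F"
  unfolding continuous_on_iff
proof (intro ballI allI impI)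
  fix z and e :: real assume z: "z \<in> {z. cnj z \<in> D}" and "e > 0"
  then obtain \<delta> where \<delta>: "\<delta> > 0" "\<And>w. w \<in> D \<Longrightarrow> dist w (cnj z) < \<delta> \<Longrightarrow> dist (F w) (F (cnj z)) < e"
    using F unfolding continuous_on_iff by fastforce
  have "dist (F w) (F z) < e" if "w \<in> {z. cnj z \<in> D}" "dist w z < \<delta>" for w
  proof -
    have "norm (F w - F z) \<le> norm (F (cnj w) - F (cnj z))"
      using that z by (intro norm_adjoint_le is_adjoint_diff adj) auto
    moreover have "dist (cnj w) (cnj z) = dist w z"
      by (simp add: dist_norm flip: complex_cnj_diff)
    then have "dist (F (cnj w)) (F (cnj z)) < e"
      using that by (intro \<delta>(2)) auto
    ultimately show ?thesis
      by (simp add: dist_norm)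
  qed
  then show "\<exists>\<delta>>0. \<forall>w\<in>{z. cnj z \<in> D}. dist w z < \<delta> \<longrightarrow> dist (F w) (F z) < e"
    using \<delta>(1) by blast
qed

section \<open>The map from X to V1(A + X) and its fixed point\<close>

locale basic_equation =
  fixes A :: "('a::complex_hilbert_space \<times> 'a) set"
    and B10 :: "'b::complex_hilbert_space \<Rightarrow>\<^sub>L 'a" and E0 :: "real set \<Rightarrow> ('b \<Rightarrow>\<^sub>L 'b)"
    and B01 :: "'a \<Rightarrow>\<^sub>L 'b" and S :: "real set" and C d :: real and n :: nat
    and K' :: "nat \<Rightarrow> complex \<Rightarrow> ('a \<Rightarrow>\<^sub>L 'a)" and g :: "nat \<Rightarrow> real \<Rightarrow> complex"
  assumes A: "self_adjoint A"
    and measure: "operator_measure (\<lambda>\<delta>. B10 o\<^sub>L E0 \<delta> o\<^sub>L B01) S C"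
    and arc: "\<And>k. k \<in> {1..n} \<Longrightarrow> integrable_arc (K' k) (g k)"
    and g_cont: "\<And>k. k \<in> {1..n} \<Longrightarrow> continuous_on {0<..<1} (g k)"
    and measure_ops: "\<And>\<delta>. \<delta> \<in> sets borel \<Longrightarrow> B10 o\<^sub>L E0 \<delta> o\<^sub>L B01 \<in> bounded_ops"
    and K'_ops: "\<And>k u. k \<in> {1..n} \<Longrightarrow> u \<in> {0<..<1} \<Longrightarrow> K' k (g k u) \<in> bounded_ops"
    and dist_spectrum: "\<And>s z. s \<in> spectrum A \<Longrightarrow>
      z \<in> complex_of_real ` S \<union> contour_image n g \<Longrightarrow> d \<le> dist s z"
begin

definition total :: real
  where "total = C + (\<Sum>k\<in>{1..n}. integrable_arc.mass (K' k) (g k))"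

definition path :: "complex set"
  where "path = complex_of_real ` S \<union> contour_image n g"

abbreviation V1 :: "('a \<Rightarrow>\<^sub>L 'a) \<Rightarrow> ('a \<Rightarrow>\<^sub>L 'a) \<Rightarrow> bool"
  where "V1 X I \<equiv> V1_eq B10 E0 B01 S n K' g (graph_plus A X) I"

lemma total_nonneg: "total \<ge> 0"
proof -
  have "(\<Sum>k\<in>{1..n}. integrable_arc.mass (K' k) (g k)) \<ge> 0"
    by (intro sum_nonneg integrable_arc.mass_nonneg arc)
  then show ?thesis
    using operator_measure.C_nonneg [OF measure] by (simp add: total_def)
qed

lemma path_S: "x \<in> S \<Longrightarrow> complex_of_real x \<in> path"
  by (simp add: path_def)

lemma path_arc: "k \<in> {1..n} \<Longrightarrow> u \<in> {0<..<1} \<Longrightarrow> g k u \<in> path"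
  unfolding path_def contour_image_def by blast

lemma resolvent_norm_le:
  assumes X: "X \<in> bounded_ops" "norm X < d" and "z \<in> path" and R: "is_resolvent (graph_plus A X) z R"
  shows "norm R \<le> 1 / (d - norm X)"
proof -
  obtain R' where "is_resolvent (graph_plus A X) z R'" "norm R' \<le> 1 / (d - norm X)"
    using perturbed_resolvent_exists [OF A dist_spectrum X] \<open>z \<in> path\<close> unfolding path_def by blast
  then show ?thesis
    using resolvent_unique [OF R] by blast
qed

text \<open>The integrand behind \<open>V1_eq\<close> is existentially quantified, so what is known
  about it is passed as a property P of every resolvent on the path. The other integrand T is
  arbitrary.\<close>

lemma V1_diff_le:
  assumes I: "V1_eq B10 E0 B01 S n K' g Y I"
    and RY: "\<And>z R. z \<in> path \<Longrightarrow> is_resolvent Y z R \<Longrightarrow> P z R"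
    and J: "has_K_integral B10 E0 B01 S n K' g T J"
    and PT: "\<And>z R. z \<in> path \<Longrightarrow> P z R \<Longrightarrow> norm (R - T z) \<le> \<kappa>" and "\<kappa> \<ge> 0"
  shows "norm (I - J) \<le> \<kappa> * total"
proof -
  obtain R where R: "\<And>z. z \<in> path \<Longrightarrow> is_resolvent Y z (R z)"
    and RI: "has_K_integral B10 E0 B01 S n K' g R I"
    using I unfolding V1_eq_def path_def by blast
  obtain I0 Ik where I0: "has_spectral_integral B10 E0 B01 S R I0"
    and Ik: "\<And>k. k \<in> {1..n} \<Longrightarrow> has_op_contour_integral (\<lambda>\<mu>. K' k \<mu> o\<^sub>L R \<mu>) (g k) (Ik k)"
    and I_eq: "I = I0 + (\<Sum>k\<in>{1..n}. Ik k)"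
    using RI unfolding has_K_integral_def by blast
  obtain J0 Jk where J0: "has_spectral_integral B10 E0 B01 S T J0"
    and Jk: "\<And>k. k \<in> {1..n} \<Longrightarrow> has_op_contour_integral (\<lambda>\<mu>. K' k \<mu> o\<^sub>L T \<mu>) (g k) (Jk k)"
    and J_eq: "J = J0 + (\<Sum>k\<in>{1..n}. Jk k)"
    using J unfolding has_K_integral_def by blast
  have RT: "norm (R z - T z) \<le> \<kappa>" if "z \<in> path" for z
    using that by (intro PT RY R)
  have "norm (I0 - J0) \<le> \<kappa> * C"
    using path_S RT \<open>\<kappa> \<ge> 0\<close> by (intro has_spectral_integral_diff_le [OF measure I0 J0]) auto
  moreover have "norm (Ik k - Jk k) \<le> \<kappa> * integrable_arc.mass (K' k) (g k)" if "k \<in> {1..n}" for k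
    using path_arc [OF that] RT \<open>\<kappa> \<ge> 0\<close>
    by (intro integrable_arc.contour_integral_diff_le [OF arc [OF that] Ik [OF that] Jk [OF that]]) auto
  then have "norm (\<Sum>k\<in>{1..n}. Ik k - Jk k) \<le> (\<Sum>k\<in>{1..n}. \<kappa> * integrable_arc.mass (K' k) (g k))"
    by (intro sum_norm_le) auto
  moreover have "I - J = (I0 - J0) + (\<Sum>k\<in>{1..n}. Ik k - Jk k)"
    by (simp add: I_eq J_eq sum_subtractf)
  ultimately have "norm (I - J) \<le> \<kappa> * C + (\<Sum>k\<in>{1..n}. \<kappa> * integrable_arc.mass (K' k) (g k))"
    using norm_triangle_mono by metis
  then show ?thesis
    by (simp add: total_def distrib_left sum_distrib_left)
qed

text \<open>The second resolvent identity bounds the difference of the integrands. With X = Y it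
  also shows that V1 has at most one value.\<close>

lemma V1_contraction:
  assumes X: "X \<in> bounded_ops" "norm X < d" "V1 X I" and Y: "Y \<in> bounded_ops" "norm Y < d" "V1 Y J"
  shows "norm (I - J) \<le> total / ((d - norm X) * (d - norm Y)) * norm (X - Y)"
proof -
  obtain T where T: "\<And>z. z \<in> path \<Longrightarrow> is_resolvent (graph_plus A Y) z (T z)"
    and J: "has_K_integral B10 E0 B01 S n K' g T J"
    using Y(3) unfolding V1_eq_def path_def by blast
  define \<kappa> where "\<kappa> = 1 / (d - norm X) * norm (Y - X) * (1 / (d - norm Y))"
  have "norm (I - J) \<le> \<kappa> * total"
  proof (rule V1_diff_le [OF X(3) _ J])
    show "norm (R - T z) \<le> \<kappa>" if z: "z \<in> path" and R: "is_resolvent (graph_plus A X) z R" for z R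
      unfolding resolvent_graph_plus_diff [OF R T [OF z]] \<kappa>_def
      by (intro norm_blinfun_compose_le resolvent_norm_le [OF X(1,2) z R]
          resolvent_norm_le [OF Y(1,2) z T [OF z]] order_refl)
    show "\<kappa> \<ge> 0"
      using X(2) Y(2) by (simp add: \<kappa>_def)
  qed
  then show ?thesis
    by (simp add: \<kappa>_def norm_minus_commute mult_ac)
qed

text \<open>Comparison with the zero integrand, whose integral is 0; the partition of S is there
  because the definition of the integral demands one.\<close>

lemma V1_norm_le:
  assumes X: "X \<in> bounded_ops" "norm X < d" "V1 X I"
  shows "norm I \<le> total / (d - norm X)"
proof -
  obtain P where "finite P" "borel_partition S P"
    using operator_measure.small_partition_exists [OF measure zero_less_one] by blast
  then have "has_K_integral B10 E0 B01 S n K' g (\<lambda>_. 0) 0"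
    unfolding has_K_integral_def
    by (intro exI [of _ 0] exI [of _ "\<lambda>_. 0"])
      (auto simp: has_spectral_integral_zero has_op_contour_integral_zero)
  then have "norm (I - 0) \<le> 1 / (d - norm X) * total"
    using X by (intro V1_diff_le [OF X(3)]) (auto intro: resolvent_norm_le)
  then show ?thesis
    by simp
qed

text \<open>On the path the resolvents are bounded by M and, by the first resolvent identity,
  Lipschitz with constant M^2. So they are uniformly continuous even on an unbounded S.\<close>

lemma V1_exists:
  assumes X: "X \<in> bounded_ops" "norm X < d"
  shows "\<exists>I\<in>bounded_ops. V1 X I"
proof -
  define M where "M = 1 / (d - norm X)"
  have "M \<ge> 0"
    using X(2) by (simp add: M_def)
  have "\<exists>R. is_resolvent (graph_plus A X) z R" if "z \<in> path" for z
    using perturbed_resolvent_exists [OF A dist_spectrum X] that unfolding path_def by blast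
  then obtain R where R: "\<And>z. z \<in> path \<Longrightarrow> is_resolvent (graph_plus A X) z (R z)"
    by metis
  have R_bound: "norm (R z) \<le> M" if "z \<in> path" for z
    unfolding M_def by (rule resolvent_norm_le [OF X that R [OF that]])
  have R_ops: "R z \<in> bounded_ops" if "z \<in> path" for z
    by (rule resolvent_in_bounded_ops [OF R [OF that]])
  have lipschitz: "dist (R z) (R w) \<le> (M * M) * dist z w" if "z \<in> path" "w \<in> path" for z w
  proof -
    have "norm (R z - R w) \<le> cmod (z - w) * norm (R z o\<^sub>L R w)"
      unfolding resolvent_diff [OF R R, OF that] by (rule norm_op_scale_le)
    also have "\<dots> \<le> cmod (z - w) * (M * M)"
      using that by (intro mult_left_mono norm_blinfun_compose_le R_bound) auto
    finally show ?thesis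
      by (simp add: dist_norm mult.commute)
  qed
  have R_lip: "(M * M)-lipschitz_on path R"
    using lipschitz \<open>M \<ge> 0\<close> by (intro lipschitz_onI) auto
  have "uniformly_continuous_on S (\<lambda>x. R (complex_of_real x))"
  proof (rule lipschitz_on_uniformly_continuous [where L = "M * M"], rule lipschitz_onI)
    show "dist (R (complex_of_real x)) (R (complex_of_real y)) \<le> M * M * dist x y"
      if "x \<in> S" "y \<in> S" for x y
      using lipschitz [OF path_S path_S, OF that] by (simp add: dist_of_real)
  qed (simp add: \<open>M \<ge> 0\<close>)
  then obtain I0 where I0: "has_spectral_integral B10 E0 B01 S R I0"
    using operator_measure.measure_integral_exists [OF measure, of R M] path_S R_bound \<open>M \<ge> 0\<close>
    unfolding has_spectral_integral_iff by auto
  have "\<exists>J. has_op_contour_integral (\<lambda>\<mu>. K' k \<mu> o\<^sub>L R \<mu>) (g k) J" if k: "k \<in> {1..n}" for k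
  proof (rule integrable_arc.contour_integral_exists [OF arc [OF k]])
    show "continuous_on {0<..<1} (\<lambda>u. R (g k u))"
      by (rule continuous_on_compose2 [OF lipschitz_on_continuous_on [OF R_lip] g_cont [OF k]])
        (use path_arc [OF k] in auto)
    show "norm (R (g k u)) \<le> M" if "u \<in> {0<..<1}" for u
      using k that by (intro R_bound path_arc)
  qed
  then obtain J where J: "\<And>k. k \<in> {1..n} \<Longrightarrow> has_op_contour_integral (\<lambda>\<mu>. K' k \<mu> o\<^sub>L R \<mu>) (g k) (J k)"
    by metis
  have "V1 X (I0 + (\<Sum>k\<in>{1..n}. J k))"
    unfolding V1_eq_def has_K_integral_def using R I0 J unfolding path_def by blast
  moreover have "I0 + (\<Sum>k\<in>{1..n}. J k) \<in> bounded_ops"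
  proof (intro add_in_bounded_ops sum_in_bounded_ops)
    show "I0 \<in> bounded_ops"
      by (rule has_spectral_integral_in_bounded_ops [OF measure measure_ops _ I0])
        (auto intro: R_ops path_S)
    show "J k \<in> bounded_ops" if k: "k \<in> {1..n}" for k
      by (rule has_op_contour_integral_in_bounded_ops [OF J [OF k]])
        (intro compose_in_bounded_ops K'_ops [OF k] R_ops path_arc [OF k])
  qed
  ultimately show ?thesis by blast
qed

text \<open>Existence comes from the smallest ball alone, and uniqueness in larger balls from the
  contraction estimate. This gives one X for all r together with its norm bound.\<close>

theorem unique_solution:
  assumes small: "total < d\<^sup>2 / 4" and "d > 0"
  shows "\<exists>X. norm X \<le> r_min d total \<and>
    (\<forall>r. r_min d total \<le> r \<longrightarrow> r < r_max d total \<longrightarrow> {X' \<in> op_ball r. V1 X' X'} = {X})"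
proof -
  define \<rho> where "\<rho> = r_min d total"
  \<comment> \<open>The roots of r (d - r) = total are d/2 - w and d/2 + w.\<close>
  define w where "w = sqrt (d\<^sup>2 / 4 - total)"
  have w: "w > 0" "w\<^sup>2 = d\<^sup>2 / 4 - total"
    using small by (auto simp: w_def)
  have \<rho>_eq: "\<rho> = d / 2 - w"
    by (simp add: \<rho>_def r_min_def w_def)
  have "w\<^sup>2 \<le> (d / 2)\<^sup>2"
    using w(2) total_nonneg by (simp add: power_divide)
  then have "w \<le> d / 2"
    by (rule power2_le_imp_le) (use \<open>d > 0\<close> in simp)
  then have \<rho>: "0 \<le> \<rho>" "\<rho> < d / 2"
    using w(1) by (auto simp: \<rho>_eq)
  \<comment> \<open>The product of the two roots is \<open>total\<close>, and d - \<rho> is the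
    other root.\<close>
  have fixed_radius: "total / (d - \<rho>) = \<rho>"
  proof -
    have "\<rho> * (d - \<rho>) = (d / 2)\<^sup>2 - w\<^sup>2"
      by (simp add: \<rho>_eq power2_eq_square algebra_simps)
    also have "\<dots> = total"
      by (simp add: w(2) power_divide)
    finally show ?thesis
      using \<rho> \<open>d > 0\<close> by (simp add: field_simps)
  qed
  have "sqrt total < sqrt ((d / 2)\<^sup>2)"
    using small by (simp add: power_divide)
  then have sqrt_total: "sqrt total < d / 2"
    using \<open>d > 0\<close> by simp
  \<comment> \<open>The factor total / (d - r)^2 is below 1 because sqrt total < d - r, which is
    what r < r_max says.\<close>
  have contraction: "\<exists>q. 0 \<le> q \<and> q < 1 \<and> (\<forall>X Y I J. X \<in> op_ball r \<longrightarrow> Y \<in> op_ball r \<longrightarrow>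
      V1 X I \<longrightarrow> V1 Y J \<longrightarrow> norm (I - J) \<le> q * norm (X - Y))" if r: "r < r_max d total" for r
  proof (intro exI [of _ "total / (d - r)\<^sup>2"] conjI allI impI)
    have dr: "sqrt total < d - r"
      using r by (simp add: r_max_def)
    then have "d - r > 0"
      using total_nonneg by (smt (verit) real_sqrt_ge_zero)
    have "(sqrt total)\<^sup>2 < (d - r)\<^sup>2"
      using dr total_nonneg by (intro power_strict_mono) auto
    then show "total / (d - r)\<^sup>2 < 1"
      using total_nonneg by (simp add: divide_less_eq_1)
    show "0 \<le> total / (d - r)\<^sup>2"
      using total_nonneg by simp
    fix X Y I J assume X: "X \<in> op_ball r" and Y: "Y \<in> op_ball r" and "V1 X I" "V1 Y J"
    then have "norm (I - J) \<le> total / ((d - norm X) * (d - norm Y)) * norm (X - Y)"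
      using \<open>d - r > 0\<close> by (intro V1_contraction) (auto simp: op_ball_def)
    also have "\<dots> \<le> total / (d - r)\<^sup>2 * norm (X - Y)"
      unfolding power2_eq_square
      using X Y \<open>d - r > 0\<close> total_nonneg
      by (intro mult_right_mono divide_left_mono mult_mono mult_pos_pos) (auto simp: op_ball_def)
    finally show "norm (I - J) \<le> total / (d - r)\<^sup>2 * norm (X - Y)" .
  qed
  have "\<rho> < r_max d total"
    using \<rho> sqrt_total by (simp add: r_max_def)
  then obtain q where q: "0 \<le> q" "q < 1" and q_lip: "\<And>X Y I J. X \<in> op_ball \<rho> \<Longrightarrow> Y \<in> op_ball \<rho> \<Longrightarrow>
      V1 X I \<Longrightarrow> V1 Y J \<Longrightarrow> norm (I - J) \<le> q * norm (X - Y)"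
    using contraction by meson
  \<comment> \<open>The ball is mapped into itself because the norm bound at radius \<rho> is total
    / (d - \<rho>), which equals \<rho>.\<close>
  have "\<exists>I\<in>op_ball \<rho>. V1 X I" if X: "X \<in> op_ball \<rho>" for X
  proof -
    have X': "X \<in> bounded_ops" "norm X \<le> \<rho>" "norm X < d"
      using X \<rho> \<open>d > 0\<close> by (auto simp: op_ball_def)
    then obtain I where I: "I \<in> bounded_ops" "V1 X I"
      using V1_exists by blast
    have "norm I \<le> total / (d - norm X)"
      using X' I by (intro V1_norm_le)
    also have "\<dots> \<le> total / (d - \<rho>)"
      using X' \<rho> total_nonneg by (intro divide_left_mono mult_pos_pos) auto
    also have "\<dots> = \<rho>"
      by (rule fixed_radius)
    finally show ?thesis
      using I by (auto simp: op_ball_def)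
  qed
  then obtain \<Phi> where \<Phi>: "\<And>X. X \<in> op_ball \<rho> \<Longrightarrow> \<Phi> X \<in> op_ball \<rho>" "\<And>X. X \<in> op_ball \<rho> \<Longrightarrow> V1 X (\<Phi> X)"
    by metis
  have "\<exists>!X\<in>op_ball \<rho>. \<Phi> X = X"
  proof (rule Banach_fix)
    have "closed (op_ball \<rho> :: ('a \<Rightarrow>\<^sub>L 'a) set)"
    proof -
      have "op_ball \<rho> = bounded_ops \<inter> cball (0 :: 'a \<Rightarrow>\<^sub>L 'a) \<rho>"
        by (auto simp: op_ball_def)
      then show ?thesis
        by (simp add: closed_Int closed_bounded_ops)
    qed
    then show "complete (op_ball \<rho> :: ('a \<Rightarrow>\<^sub>L 'a) set)"
      by (simp add: complete_eq_closed)
    show "op_ball \<rho> \<noteq> ({} :: ('a \<Rightarrow>\<^sub>L 'a) set)"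
      using \<rho> zero_in_bounded_ops by (auto simp: op_ball_def)
    show "dist (\<Phi> X) (\<Phi> Y) \<le> q * dist X Y" if "X \<in> op_ball \<rho>" "Y \<in> op_ball \<rho>" for X Y
      using that by (simp add: dist_norm q_lip \<Phi>(2))
  qed (use q \<Phi>(1) in auto)
  then obtain X where X: "X \<in> op_ball \<rho>" "V1 X X"
    using \<Phi>(2) by metis
  \<comment> \<open>A second solution would satisfy norm (X' - X) \<le> q norm (X' - X) with q <
    1.\<close>
  have "{X' \<in> op_ball r. V1 X' X'} = {X}" if r: "\<rho> \<le> r" "r < r_max d total" for r
  proof -
    have X_r: "X \<in> op_ball r"
      using X(1) r(1) by (auto simp: op_ball_def)
    obtain q where "q < 1" and lip: "\<And>X Y I J. X \<in> op_ball r \<Longrightarrow> Y \<in> op_ball r \<Longrightarrow>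
        V1 X I \<Longrightarrow> V1 Y J \<Longrightarrow> norm (I - J) \<le> q * norm (X - Y)"
      using contraction [OF r(2)] by meson
    have "X' = X" if X': "X' \<in> op_ball r" "V1 X' X'" for X'
    proof (rule ccontr)
      assume "X' \<noteq> X"
      then have "q * norm (X' - X) < 1 * norm (X' - X)"
        using \<open>q < 1\<close> by (intro mult_strict_right_mono) auto
      then show False
        using lip [OF X'(1) X_r X'(2) X(2)] by simp
    qed
    then show ?thesis
      using X_r X(2) by blast
  qed
  moreover have "norm X \<le> \<rho>"
    using X(1) by (simp add: op_ball_def)
  ultimately show ?thesis
    unfolding \<rho>_def by blast
qed

end

section \<open>From the hypotheses on A0, A1 and the contour to the abstract setting\<close>

lemma sum_norm_le_SUP_borel_partitions:
  fixes f :: "real set \<Rightarrow> 'a::real_normed_vector"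
  assumes P: "finite P" "disjoint P" "{} \<notin> P" "P \<subseteq> sets borel" "\<Union>P \<subseteq> U" and U: "U \<in> sets borel"
  shows "(\<Sum>\<delta>\<in>P. ennreal (norm (f \<delta>)))
    \<le> (SUP Q \<in> {Q. borel_partition U Q}. \<Sum>\<^sub>\<infinity>\<delta>\<in>Q. ennreal (norm (f \<delta>)))"
proof -
  \<comment> \<open>P need not cover U. The remainder completes it, unless it is empty, which
    \<open>partition_on\<close> excludes.\<close>
  define Q where "Q = P \<union> ({U - \<Union>P} - {{}})"
  have "partition_on U Q"
  proof (rule partition_onI)
    show "disjnt a b" if "a \<in> Q" "b \<in> Q" "a \<noteq> b" for a b
      using that disjointD [OF P(2), of a b] by (auto simp: Q_def disjnt_def)
  qed (use P in \<open>auto simp: Q_def\<close>)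
  moreover have "\<Union>P \<in> sets borel"
    using P by (intro sets.finite_Union) auto
  then have "Q \<subseteq> sets borel"
    using P U by (auto simp: Q_def)
  moreover have "finite Q"
    using P by (simp add: Q_def)
  ultimately have "borel_partition U Q"
    by (simp add: borel_partition_def countable_finite)
  moreover have "(\<Sum>\<delta>\<in>P. ennreal (norm (f \<delta>))) \<le> (\<Sum>\<^sub>\<infinity>\<delta>\<in>Q. ennreal (norm (f \<delta>)))"
    unfolding infsum_finite [OF \<open>finite Q\<close>] using \<open>finite Q\<close> by (intro sum_mono2) (auto simp: Q_def)
  ultimately show ?thesis
    by (intro SUP_upper2 [of Q]) auto
qed

lemma borel_open_interval: "open_interval a b \<in> sets borel"
  unfolding open_interval_def by measurable

theorem theorem1:
  fixes A0 :: "('h0::complex_hilbert_space \<times> 'h0) set"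
    and A1 :: "('h1::complex_hilbert_space \<times> 'h1) set"
    and B01 :: "'h1 \<Rightarrow>\<^sub>L 'h0" and B10 :: "'h0 \<Rightarrow>\<^sub>L 'h1"
    and E0 :: "real set \<Rightarrow> ('h0 \<Rightarrow>\<^sub>L 'h0)"
    and m :: nat and a b :: "nat \<Rightarrow> ereal" and \<Delta> :: "nat \<Rightarrow> real set" and \<sigma>' :: "real set"
    and Dm Dp D :: "nat \<Rightarrow> complex set"
    and K' :: "nat \<Rightarrow> complex \<Rightarrow> ('h1 \<Rightarrow>\<^sub>L 'h1)"
    and l :: "nat \<Rightarrow> int"
    and g :: "nat \<Rightarrow> real \<Rightarrow> complex"
    and V0 :: ennreal and V d :: real
  assumes separable: "separable_space (euclidean :: 'h0 topology)"
      "separable_space (euclidean :: 'h1 topology)"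
    and self_adjoint: "self_adjoint A0" "self_adjoint A1"
    and B01: "B01 \<in> bounded_ops" "B10 \<in> bounded_ops" "is_adjoint B01 B10"
    and E0: "spectral_measure_of A0 E0"
    \<comment> \<open>spectral assumptions\<close>
    and m: "1 \<le> m"
    and \<Delta>: "\<And>k. \<Delta> k = open_interval (a k) (b k)"
    and disjoint: "disjoint_family_on \<Delta> {1..m}"
    and \<Delta>_cont: "\<And>k. k \<in> {1..m} \<Longrightarrow> complex_of_real ` \<Delta> k \<subseteq> continuous_spectrum A0"
    and \<Delta>_A1: "\<And>k. k \<in> {1..m} \<Longrightarrow> complex_of_real ` \<Delta> k \<inter> spectrum A1 \<noteq> {}"
    and \<sigma>': "\<sigma>' = real_spectrum A0 - (\<Union>k\<in>{1..m}. \<Delta> k)"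
    and \<sigma>'_A1: "spectrum A1 \<inter> complex_of_real ` \<sigma>' = {}"
    \<comment> \<open>analyticity assumptions\<close>
    and K'_deriv: "\<And>k \<mu>. k \<in> {1..m} \<Longrightarrow> \<mu> \<in> \<Delta> k \<Longrightarrow>
      (K_fun B10 E0 B01 has_vector_derivative K' k (complex_of_real \<mu>)) (at \<mu>)"
    and K'_cont: "\<And>k. k \<in> {1..m} \<Longrightarrow> continuous_on (complex_of_real ` closure (\<Delta> k)) (K' k)"
    and Dm: "\<And>k. k \<in> {1..m} \<Longrightarrow> open (Dm k) \<and> simply_connected (Dm k) \<and>
      Dm k \<subseteq> {z. Im z < 0} \<and> complex_of_real ` \<Delta> k \<subseteq> frontier (Dm k)"
    and Dm_disjoint: "disjoint_family_on Dm {1..m}"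
    and Dp: "\<And>k. Dp k = {z. cnj z \<in> Dm k}"
    and K'_Dm: "\<And>k. k \<in> {1..m} \<Longrightarrow> K' k ` Dm k \<subseteq> bounded_ops \<and> op_holomorphic_on (K' k) (Dm k) \<and>
      continuous_on (Dm k \<union> complex_of_real ` \<Delta> k) (K' k)"
    and K'_Dp: "\<And>k z. k \<in> {1..m} \<Longrightarrow> z \<in> Dp k \<Longrightarrow> is_adjoint (K' k (cnj z)) (K' k z)"
    and K'_holder: "\<And>k x. k \<in> {1..m} \<Longrightarrow> ereal x = a k \<or> ereal x = b k \<Longrightarrow>
      \<exists>C>0. \<exists>\<gamma>>0. \<forall>\<mu>\<in>Dm k \<union> Dp k.
        norm (K' k \<mu> - K' k (complex_of_real x)) \<le> C * cmod (\<mu> - complex_of_real x) powr \<gamma>"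
    \<comment> \<open>the contour\<close>
    and l: "\<And>k. k \<in> {1..m} \<Longrightarrow> l k = 1 \<or> l k = -1"
    and D: "\<And>k. D k = (if l k = 1 then Dp k else Dm k)"
    and g: "\<And>k. k \<in> {1..m} \<Longrightarrow> contour_piece A0 (a k) (b k) (D k) (g k)"
    and V0: "V0 = modified_variation A0 B10 E0 B01 \<sigma>' m K' g"
    and K_bounded: "V0 < \<infinity>"
    and V: "V = enn2real V0"
    and d: "d = setdist (spectrum A1) (complex_of_real ` \<sigma>' \<union> contour_image m g)"
    and small: "V < d\<^sup>2 / 4"
  shows "\<exists>X. norm X \<le> r_min d V \<and>
    (\<forall>r. r_min d V \<le> r \<longrightarrow> r < r_max d V \<longrightarrow>
      {X' \<in> op_ball r. V1_eq B10 E0 B01 \<sigma>' m K' g (graph_plus A1 X') X'} = {X})"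
proof -
  define \<mu> where "\<mu> \<delta> = B10 o\<^sub>L E0 \<delta> o\<^sub>L B01" for \<delta>
  define W where "W = (SUP P \<in> {P. borel_partition (real_spectrum A0) P}.
      \<Sum>\<^sub>\<infinity>\<delta>\<in>P. ennreal (norm (B10 o\<^sub>L E0 (\<delta> \<inter> \<sigma>') o\<^sub>L B01)))"
  define L where "L k = arc_integral (\<lambda>\<mu>. ennreal (norm (K' k \<mu>))) (g k)" for k
  have V0_eq: "V0 = W + (\<Sum>k\<in>{1..m}. L k)"
    by (simp add: V0 modified_variation_def W_def L_def)
  have W_fin: "W < \<infinity>" and L_sum_fin: "(\<Sum>k\<in>{1..m}. L k) < \<infinity>"
    using K_bounded by (auto simp: V0_eq)
  then have L_fin: "L k < \<infinity>" if "k \<in> {1..m}" for k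
    using that by auto
  have pvm: "projection_valued_measure E0"
    using E0 by (simp add: spectral_measure_of_def)
  have \<sigma>'_borel: "\<sigma>' \<in> sets borel"
    unfolding \<sigma>' \<Delta> by (intro sets.Diff borel_real_spectrum sets.finite_UN borel_open_interval) auto
  \<comment> \<open>The spectral part W of the modified variation serves as the variation bound C;
    strong additivity is inherited from E0.\<close>
  have measure: "operator_measure \<mu> \<sigma>' (enn2real W)"
  proof
    show "\<sigma>' \<in> sets borel"
      by (rule \<sigma>'_borel)
    show "(\<lambda>n. \<mu> (F n) x) sums \<mu> (\<Union>n. F n) x" if F: "range F \<subseteq> sets borel" "disjoint_family F"
      for F :: "nat \<Rightarrow> real set" and x
    proof -
      have "(\<lambda>n. E0 (F n) (B01 x)) sums E0 (\<Union>n. F n) (B01 x)"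
        using pvm F unfolding projection_valued_measure_def by blast
      from bounded_linear.sums [OF blinfun.bounded_linear_right this] show ?thesis
        by (simp add: \<mu>_def)
    qed
    show "(\<Sum>\<delta>\<in>P. norm (\<mu> \<delta>)) \<le> enn2real W"
      if P: "finite P" "disjoint P" "{} \<notin> P" "P \<subseteq> sets borel" "\<Union>P \<subseteq> \<sigma>'" for P
    proof -
      \<comment> \<open>The modified variation intersects every cell with \<sigma>', which changes
        nothing for cells inside \<sigma>'.\<close>
      have "\<mu> \<delta> = B10 o\<^sub>L E0 (\<delta> \<inter> \<sigma>') o\<^sub>L B01" if "\<delta> \<in> P" for \<delta>
      proof -
        have "\<delta> \<inter> \<sigma>' = \<delta>"
          using P(5) that by blast
        then show ?thesis
          by (simp add: \<mu>_def)
      qed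
      then have "(\<Sum>\<delta>\<in>P. ennreal (norm (\<mu> \<delta>))) = (\<Sum>\<delta>\<in>P. ennreal (norm (B10 o\<^sub>L E0 (\<delta> \<inter> \<sigma>') o\<^sub>L B01)))"
        by (intro sum.cong) auto
      also have "\<dots> \<le> W"
        unfolding W_def using P \<sigma>'
        by (intro sum_norm_le_SUP_borel_partitions borel_real_spectrum) auto
      finally have "ennreal (\<Sum>\<delta>\<in>P. norm (\<mu> \<delta>)) \<le> W"
        by (simp add: sum_ennreal)
      then have "enn2real (ennreal (\<Sum>\<delta>\<in>P. norm (\<mu> \<delta>))) \<le> enn2real W"
        using W_fin by (intro enn2real_mono) auto
      then show ?thesis
        by (simp add: sum_nonneg)
    qed
  qed
  have piece: "continuous_on {0<..<1} (g k)" "g k ` {0<..<1} \<subseteq> D k" "rectifiable_arc (a k) (b k) (g k)"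
    if "k \<in> {1..m}" for k
    using g [OF that] by (auto simp: contour_piece_def)
  have K'_Dm_cont: "continuous_on (Dm k) (K' k)" if "k \<in> {1..m}" for k
    using K'_Dm [OF that] continuous_on_subset by blast
  \<comment> \<open>On the upper domain K' is tied to the lower one by the adjoint relation, from
    which both continuity and complex linearity follow.\<close>
  have K'_D: "continuous_on (D k) (K' k)" "K' k ` D k \<subseteq> bounded_ops" if k: "k \<in> {1..m}" for k
  proof -
    have "continuous_on {z. cnj z \<in> Dm k} (K' k)"
      using K'_Dm_cont [OF k] K'_Dp [OF k] Dp by (intro compose_adjoint_continuous_on) auto
    then show "continuous_on (D k) (K' k)"
      using K'_Dm_cont [OF k] by (simp add: D Dp)
    have "K' k z \<in> bounded_ops" if "z \<in> Dp k" for z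
      using K'_Dp [OF k that] by (rule adjoint_in_bounded_ops)
    then show "K' k ` D k \<subseteq> bounded_ops"
      using K'_Dm [OF k] by (auto simp: D)
  qed
  have arc: "integrable_arc (K' k) (g k)" if k: "k \<in> {1..m}" for k
  proof
    show "continuous_on {0<..<1} (\<lambda>u. K' k (g k u))"
      using K'_D(1) [OF k] piece(1,2) [OF k] by (rule continuous_on_compose2)
    \<comment> \<open>For 0 < c and d < 1 the provisos on infinite end points in
      \<open>rectifiable_arc\<close> are vacuous.\<close>
    show "arc_length (g k) {c..d} < \<infinity>" if "0 < c" "d < 1" for c d
    proof -
      have "arc_length (g k) ({c..d} \<inter> {0<..<1}) < \<infinity>"
        using piece(3) [OF k] that unfolding rectifiable_arc_def by auto
      moreover have "{c..d} \<inter> {0<..<1} = {c..d}"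
        using that by auto
      ultimately show ?thesis by simp
    qed
    show "arc_integral (\<lambda>z. ennreal (norm (K' k z))) (g k) < \<infinity>"
      using L_fin [OF k] by (simp add: L_def)
  qed
  interpret basic_equation A1 B10 E0 B01 \<sigma>' "enn2real W" d m K' g
  proof (rule basic_equation.intro)
    show "self_adjoint A1"
      by (rule self_adjoint(2))
    show "operator_measure (\<lambda>\<delta>. B10 o\<^sub>L E0 \<delta> o\<^sub>L B01) \<sigma>' (enn2real W)"
      using measure by (simp add: \<mu>_def [abs_def])
    show "B10 o\<^sub>L E0 \<delta> o\<^sub>L B01 \<in> bounded_ops" if "\<delta> \<in> sets borel" for \<delta>
      using pvm that B01 unfolding projection_valued_measure_def
      by (intro compose_in_bounded_ops) auto
    show "K' k (g k u) \<in> bounded_ops" if "k \<in> {1..m}" "u \<in> {0<..<1}" for k u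
      using K'_D(2) [OF that(1)] piece(2) [OF that(1)] that(2) by blast
    show "d \<le> dist s z" if "s \<in> spectrum A1" "z \<in> complex_of_real ` \<sigma>' \<union> contour_image m g" for s z
      unfolding d using that by (rule setdist_le_dist)
  qed (use arc piece in auto)
  have total_eq: "total = V"
  proof -
    have "enn2real (\<Sum>k\<in>{1..m}. L k) = (\<Sum>k\<in>{1..m}. enn2real (L k))"
      using L_fin by (subst enn2real_sum) auto
    then show ?thesis
      using W_fin L_sum_fin
      by (simp add: total_def V V0_eq enn2real_plus integrable_arc.mass_def [OF arc] L_def)
  qed
  \<comment> \<open>For d = 0 the smallness condition would read V < 0. As \<open>setdist\<close> is
    0 when one of its sets is empty, this also excludes that degenerate case.\<close>
  have "d \<noteq> 0"
    using small total_nonneg by (auto simp: total_eq)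
  moreover have "d \<ge> 0"
    unfolding d by (rule setdist_pos_le)
  ultimately have "d > 0"
    by simp
  then show ?thesis
    using unique_solution small by (simp add: total_eq)
qed

end
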